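(* Let $[\cdot]$ stand either for $\{\cdot\}$ throughout (Roumieu case) or for $(\cdot)$ throughout (Beurling case). Let $\omega$ be a concave weight function and let $U \subseteq \mathbb{R}^d$ be an open subset. Let $f : U \to \mathbb{C}$ be a function such that $f^j, f^{j+1} \in \mathcal{E}^{[\omega]}(U)$ for some positive integer $j$ (pointwise powers). Then $f \in \mathcal{E}^{[\omega]}(U)$.
   Context: A weight function is a continuous increasing function $\omega:[0,\infty)\to[0,\infty)$ such that $\omega(2t)=O(\omega(t))$, $\omega(t)=o(t)$ and $\log t=o(\omega(t))$ as $t\to\infty$, and $\varphi_\omega(t):=\omega(e^t)$ is convex on $[0,\infty)$. Braun–Meise–Taylor classes: let $\varphi_\omega^*(y):=\sup_{x\ge0}(xy-\varphi_\omega(x))$ for $y\ge 0$. For $U\subseteq\mathbb{R}^d$ open, $\mathcal{E}^{\{\omega\}}(U)$ (resp. $\mathcal{E}^{(\omega)}(U)$) is the set of all complex valued $f\in C^\infty(U)$ such that for every compact $K\subseteq U$ there exists $\rho>0$ (resp. for every compact $K\subseteq U$ and every $\rho>0$) one has $$\sup_{x\in K}\sup_{k\in\mathbb{N}}\|f^{(k)}(x)\|_{L^k(\mathbb{R}^d,\mathbb{C})}\exp\Big(-\frac1\rho\varphi_\omega^*(\rho k)\Big)<\infty,$$ where $f^{(k)}$ is the Fréchet derivative of order $k$, with the operator norm on $k$-linear maps. *)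

theory Defs
  imports "HOL-Analysis.Analysis" "HOL-Library.Landau_Symbols"
begin

section \<open>Weight functions\<close>

text \<open>A weight function lives on \<open>[0,\<infinity>)\<close>; it is encoded as a total function on the reals of
  which only the values on \<open>{0..}\<close> are constrained. ``Increasing'' is read as nondecreasing.\<close>

definition weight_function :: "(real \<Rightarrow> real) \<Rightarrow> bool" where
  "weight_function \<omega> \<longleftrightarrow>
     \<omega> ` {0..} \<subseteq> {0..} \<and>
     continuous_on {0..} \<omega> \<and>
     mono_on {0..} \<omega> \<and>
     (\<lambda>t. \<omega> (2 * t)) \<in> O[at_top](\<omega>) \<and>
     \<omega> \<in> o[at_top](\<lambda>t. t) \<and>
     ln \<in> o[at_top](\<omega>) \<and>
     convex_on {0..} (\<lambda>t. \<omega> (exp t))"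

definition young_conjugate :: "(real \<Rightarrow> real) \<Rightarrow> real \<Rightarrow> real" where
  "young_conjugate \<omega> y = (SUP x\<in>{0..}. x * y - \<omega> (exp x))"

text \<open>The real supremum in the definition is over a set that is bounded above.\<close>

lemma young_conjugate_bdd_above:
  assumes "weight_function \<omega>" and "y \<ge> 0"
  shows "bdd_above ((\<lambda>x. x * y - \<omega> (exp x)) ` {0..})"
proof -
  from assms(1) have o: "ln \<in> o[at_top](\<omega>)" and pos: "\<And>t. t \<ge> 0 \<Longrightarrow> \<omega> t \<ge> 0"
    by (auto simp: weight_function_def)
  have "1 / (y + 1) > 0" using assms(2) by simp
  from landau_o.smallD[OF o this] obtain T where
    T: "\<And>t. t \<ge> T \<Longrightarrow> norm (ln t) \<le> 1 / (y + 1) * norm (\<omega> t)"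
    by (auto simp: eventually_at_top_linorder)
  have "x * y - \<omega> (exp x) \<le> y * \<bar>ln (max 1 T)\<bar>" if x: "x \<ge> 0" for x
  proof (cases "exp x \<ge> T")
    case True
    from T[OF this] x pos[of "exp x"] assms(2) have "x * (y + 1) \<le> \<omega> (exp x)"
      by (simp add: field_simps)
    then have "x * y - \<omega> (exp x) \<le> 0" using x by (simp add: algebra_simps)
    also have "0 \<le> y * \<bar>ln (max 1 T)\<bar>" using assms(2) by simp
    finally show ?thesis .
  next
    case False
    then have "exp x \<le> max 1 T" by simp
    then have "x \<le> ln (max 1 T)" by (simp add: ln_ge_iff)
    then have "x \<le> \<bar>ln (max 1 T)\<bar>" by linarith
    then have "x * y \<le> y * \<bar>ln (max 1 T)\<bar>" using assms(2) mult_left_mono[of x "\<bar>ln (max 1 T)\<bar>" y] by (simp only: mult.commute)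
    then show ?thesis using pos[of "exp x"] by simp
  qed
  then show ?thesis by (auto simp: bdd_above_def)
qed


section \<open>Higher Frechet derivatives\<close>

text \<open>The \<open>k\<close>-linear map \<open>f\<^sup>(\<^sup>k\<^sup>)(x)\<close> is encoded as a function on lists of length \<open>k\<close>:
  \<open>iter_frechet f [v\<^sub>1, \<dots>, v\<^sub>k] x = f\<^sup>(\<^sup>k\<^sup>)(x)(v\<^sub>1, \<dots>, v\<^sub>k)\<close>. As usual, \<open>f\<^sup>(\<^sup>k\<^sup>+\<^sup>1\<^sup>)(x)\<close> evaluated
  in the direction \<open>v\<close> is the derivative of \<open>y \<mapsto> f\<^sup>(\<^sup>k\<^sup>)(y)\<close> at \<open>x\<close> in the direction \<open>v\<close>.\<close>

fun iter_frechet :: "('a::euclidean_space \<Rightarrow> complex) \<Rightarrow> 'a list \<Rightarrow> 'a \<Rightarrow> complex" where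
  "iter_frechet f [] x = f x"
| "iter_frechet f (v # vs) x = frechet_derivative (iter_frechet f vs) (at x) v"

text \<open>For open \<open>U\<close> this is \<open>C\<^sup>\<infinity>(U)\<close>. Differentiability of \<open>f\<^sup>(\<^sup>k\<^sup>)\<close> is required for all values
  \<open>y \<mapsto> f\<^sup>(\<^sup>k\<^sup>)(y)(vs)\<close>; as the space of \<open>k\<close>-linear maps is finite-dimensional, this is the same as
  differentiability with respect to the operator norm, see \<open>iter_frechet_has_derivative\<close> below.
  Continuity of all derivatives is automatic.\<close>

definition smooth_on :: "'a::euclidean_space set \<Rightarrow> ('a \<Rightarrow> complex) \<Rightarrow> bool" where
  "smooth_on U f \<longleftrightarrow> (\<forall>vs. \<forall>x\<in>U. iter_frechet f vs differentiable (at x))"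

definition multilinear_norm :: "nat \<Rightarrow> ('a::euclidean_space list \<Rightarrow> complex) \<Rightarrow> ennreal" where
  "multilinear_norm k A =
     (SUP vs\<in>{vs. length vs = k \<and> (\<forall>v\<in>set vs. norm v \<le> 1)}. ennreal (norm (A vs)))"


section \<open>Braun--Meise--Taylor classes\<close>

definition BMT_seminorm ::
  "(real \<Rightarrow> real) \<Rightarrow> 'a::euclidean_space set \<Rightarrow> real \<Rightarrow> ('a \<Rightarrow> complex) \<Rightarrow> ennreal" where
  "BMT_seminorm \<omega> K \<rho> f =
     (SUP x\<in>K. SUP k. multilinear_norm k (\<lambda>vs. iter_frechet f vs x)
        * ennreal (exp (- (1 / \<rho>) * young_conjugate \<omega> (\<rho> * real k))))"

definition BMT_Roumieu :: "(real \<Rightarrow> real) \<Rightarrow> 'a::euclidean_space set \<Rightarrow> ('a \<Rightarrow> complex) set" where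
  "BMT_Roumieu \<omega> U =
     {f. smooth_on U f \<and>
         (\<forall>K. compact K \<and> K \<subseteq> U \<longrightarrow> (\<exists>\<rho>>0. BMT_seminorm \<omega> K \<rho> f < \<infinity>))}"

definition BMT_Beurling :: "(real \<Rightarrow> real) \<Rightarrow> 'a::euclidean_space set \<Rightarrow> ('a \<Rightarrow> complex) set" where
  "BMT_Beurling \<omega> U =
     {f. smooth_on U f \<and>
         (\<forall>K. compact K \<and> K \<subseteq> U \<longrightarrow> (\<forall>\<rho>>0. BMT_seminorm \<omega> K \<rho> f < \<infinity>))}"


section \<open>The encoding of higher derivatives agrees with the usual one\<close>

lemma iter_frechet_linear:
  assumes "smooth_on U f" and "open U" and "x \<in> U"
  shows "linear (\<lambda>v. iter_frechet f (us @ v # ws) x)"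
  using assms(3)
proof (induction us arbitrary: x)
  case Nil
  then show ?case using assms(1) linear_frechet_derivative by (auto simp: smooth_on_def)
next
  case (Cons u us)
  have hd: "(iter_frechet f vs has_derivative frechet_derivative (iter_frechet f vs) (at x)) (at x)" for vs
    using assms(1) Cons.prems frechet_derivative_works by (auto simp: smooth_on_def)
  show ?case
  proof (rule linearI)
    fix a b
    have "((\<lambda>y. iter_frechet f (us @ a # ws) y + iter_frechet f (us @ b # ws) y) has_derivative
        (\<lambda>v. iter_frechet f (v # us @ a # ws) x + iter_frechet f (v # us @ b # ws) x)) (at x)"
      using has_derivative_add[OF hd hd] by simp
    then have "(iter_frechet f (us @ (a + b) # ws) has_derivative
        (\<lambda>v. iter_frechet f (v # us @ a # ws) x + iter_frechet f (v # us @ b # ws) x)) (at x)"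
      by (rule has_derivative_transform_within_open[OF _ assms(2) Cons.prems])
        (simp add: linear_add[OF Cons.IH])
    from has_derivative_unique[OF hd this]
    show "iter_frechet f ((u # us) @ (a + b) # ws) x =
      iter_frechet f ((u # us) @ a # ws) x + iter_frechet f ((u # us) @ b # ws) x"
      by simp
  next
    fix r a
    have "((\<lambda>y. r *\<^sub>R iter_frechet f (us @ a # ws) y) has_derivative
        (\<lambda>v. r *\<^sub>R iter_frechet f (v # us @ a # ws) x)) (at x)"
      using has_derivative_scaleR_right[OF hd] by simp
    then have "(iter_frechet f (us @ (r *\<^sub>R a) # ws) has_derivative
        (\<lambda>v. r *\<^sub>R iter_frechet f (v # us @ a # ws) x)) (at x)"
      by (rule has_derivative_transform_within_open[OF _ assms(2) Cons.prems])
        (simp add: linear_scale[OF Cons.IH])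
    from has_derivative_unique[OF hd this]
    show "iter_frechet f ((u # us) @ (r *\<^sub>R a) # ws) x = r *\<^sub>R iter_frechet f ((u # us) @ a # ws) x"
      by simp
  qed
qed

lemma multilinear_norm_le_sum_Basis:
  fixes A :: "'a::euclidean_space list \<Rightarrow> complex"
  assumes "\<And>us ws. length us + length ws + 1 = k \<Longrightarrow> linear (\<lambda>v. A (us @ v # ws))"
  shows "multilinear_norm k A \<le> ennreal (\<Sum>bs\<in>{bs. set bs \<subseteq> Basis \<and> length bs = k}. norm (A bs))"
proof -
  have "norm (A vs) \<le> (\<Sum>bs\<in>{bs. set bs \<subseteq> Basis \<and> length bs = k}. norm (A bs))"
    if "length vs = k" "\<forall>v\<in>set vs. norm v \<le> 1" for vs
    using that assms
  proof (induction k arbitrary: A vs)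
    case 0
    have "{bs::'a list. set bs \<subseteq> Basis \<and> bs = []} = {[]}" by auto
    then show ?case using 0 by simp
  next
    case (Suc k)
    then obtain v ws where vs: "vs = v # ws" by (cases vs) auto
    let ?B = "{bs::'a list. set bs \<subseteq> Basis \<and> length bs = k}"
    have lin: "linear (\<lambda>v. A (v # ws))" using Suc.prems(3)[of "[]" ws] Suc.prems(1) vs by simp
    have "A vs = A ((\<Sum>b\<in>Basis. (v \<bullet> b) *\<^sub>R b) # ws)" by (simp add: vs euclidean_representation)
    also have "\<dots> = (\<Sum>b\<in>Basis. (v \<bullet> b) *\<^sub>R A (b # ws))"
      by (simp only: linear_sum[OF lin] linear_scale[OF lin])
    finally have "norm (A vs) \<le> (\<Sum>b\<in>Basis. norm ((v \<bullet> b) *\<^sub>R A (b # ws)))"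
      by (simp only: norm_sum)
    also have "\<dots> \<le> (\<Sum>b\<in>Basis. norm (A (b # ws)))"
    proof (rule sum_mono)
      fix b :: 'a assume "b \<in> Basis"
      then have "\<bar>v \<bullet> b\<bar> \<le> 1" using Basis_le_norm[of b v] Suc.prems(2) vs by auto
      then show "norm ((v \<bullet> b) *\<^sub>R A (b # ws)) \<le> norm (A (b # ws))"
        by (simp add: mult_left_le_one_le)
    qed
    also have "\<dots> \<le> (\<Sum>b\<in>Basis. \<Sum>bs\<in>?B. norm (A (b # bs)))"
    proof (rule sum_mono)
      fix b :: 'a assume "b \<in> Basis"
      show "norm (A (b # ws)) \<le> (\<Sum>bs\<in>?B. norm (A (b # bs)))"
      proof (rule Suc.IH)
        fix us ws' :: "'a list" assume "length us + length ws' + 1 = k"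
        then show "linear (\<lambda>v. A (b # us @ v # ws'))" using Suc.prems(3)[of "b # us" ws'] by simp
      qed (use Suc.prems vs in auto)
    qed
    also have "\<dots> = (\<Sum>(b, bs)\<in>Basis \<times> ?B. norm (A (b # bs)))"
      by (simp add: sum.cartesian_product)
    also have "\<dots> = (\<Sum>bs\<in>{bs. set bs \<subseteq> Basis \<and> length bs = Suc k}. norm (A bs))"
      by (rule sum.reindex_bij_witness[where i = "\<lambda>bs. (hd bs, tl bs)" and j = "\<lambda>(b, bs). b # bs"])
        (auto simp: length_Suc_conv)
    finally show ?case .
  qed
  then show ?thesis unfolding multilinear_norm_def by (intro SUP_least) (auto intro!: ennreal_leI)
qed

text \<open>\<open>f\<^sup>(\<^sup>k\<^sup>+\<^sup>1\<^sup>)(x)\<close> is the Frechet derivative at \<open>x\<close> of \<open>y \<mapsto> f\<^sup>(\<^sup>k\<^sup>)(y)\<close> with respect to the operator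
  norm, for every \<open>k\<close>.\<close>

lemma iter_frechet_has_derivative:
  assumes "smooth_on U f" and "open U" and "x \<in> U"
  shows "((\<lambda>h. multilinear_norm k
            (\<lambda>vs. iter_frechet f vs (x + h) - iter_frechet f vs x - iter_frechet f (h # vs) x)
          / ennreal (norm h)) \<longlongrightarrow> 0) (at 0)"
proof -
  let ?A = "\<lambda>h vs. iter_frechet f vs (x + h) - iter_frechet f vs x - iter_frechet f (h # vs) x"
  let ?B = "{bs::'a list. set bs \<subseteq> Basis \<and> length bs = k}"
  have "((\<lambda>h. norm (?A h bs) / norm h) \<longlongrightarrow> 0) (at 0)" for bs
    using assms(1,3) frechet_derivative_works[of "iter_frechet f bs" "at x"]
    by (auto simp: smooth_on_def has_derivative_at)
  then have "((\<lambda>h. \<Sum>bs\<in>?B. norm (?A h bs) / norm h) \<longlongrightarrow> (\<Sum>bs\<in>?B. 0)) (at 0)"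
    by (intro tendsto_sum)
  then have lim: "((\<lambda>h. ennreal (\<Sum>bs\<in>?B. norm (?A h bs) / norm h)) \<longlongrightarrow> 0) (at 0)"
    using tendsto_ennrealI by fastforce
  have "open ((\<lambda>h. x + h) -` U)"
    by (intro open_vimage assms continuous_intros)
  then have "\<forall>\<^sub>F h in at 0. h \<in> (\<lambda>h. x + h) -` U"
    by (rule eventually_at_in_open') (use assms(3) in simp)
  moreover have "\<forall>\<^sub>F h in at 0. h \<noteq> (0::'a)"
    by (simp add: eventually_at_filter)
  ultimately have "\<forall>\<^sub>F h in at 0. multilinear_norm k (?A h) / ennreal (norm h)
      \<le> ennreal (\<Sum>bs\<in>?B. norm (?A h bs) / norm h)"
  proof eventually_elim
    case (elim h)
    have "multilinear_norm k (?A h) \<le> ennreal (\<Sum>bs\<in>?B. norm (?A h bs))"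
    proof (rule multilinear_norm_le_sum_Basis)
      fix us ws :: "'a list"
      show "linear (\<lambda>v. ?A h (us @ v # ws))"
        using iter_frechet_linear[OF assms(1,2), of "x + h" us ws]
          iter_frechet_linear[OF assms, of us ws] iter_frechet_linear[OF assms, of "h # us" ws] elim
        by (auto intro!: linear_compose_sub)
    qed
    then have "multilinear_norm k (?A h) / ennreal (norm h)
        \<le> ennreal (\<Sum>bs\<in>?B. norm (?A h bs)) / ennreal (norm h)"
      by (rule divide_right_mono_ennreal)
    also have "\<dots> = ennreal (\<Sum>bs\<in>?B. norm (?A h bs) / norm h)"
      using elim by (simp add: divide_ennreal sum_nonneg flip: sum_divide_distrib)
    finally show ?case .
  qed
  then show ?thesis
    by (intro tendsto_sandwich[OF _ _ tendsto_const lim]) auto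
qed

end

theory Submission
  imports Defs "HOL-Complex_Analysis.Complex_Analysis" "HOL-Computational_Algebra.Fundamental_Theorem_Algebra"
begin

text \<open>
  Put \<open>\<nu> = \<omega>(s) / \<rho>\<close>. Near a point and along a line, \<open>f\<^sup>j\<close> and \<open>f\<^sup>j\<^sup>+\<^sup>1\<close> are approximated by their Taylor
  polynomials \<open>P\<close> and \<open>Q\<close> of order \<open>n \<le> \<nu> / ln 2\<close> on a complex disc of radius comparable to \<open>\<nu> / s\<close>, and
  the residual \<open>P\<^sup>j\<^sup>+\<^sup>1 - Q\<^sup>j\<close> is exponentially small in \<open>\<nu>\<close> there (this is where concavity of \<open>\<omega>\<close> enters).
  After a generic small perturbation of \<open>P\<close> by a constant, the quotient \<open>Q / P\<close> has only simple poles,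
  with tiny residues because \<open>Q\<close> is small where \<open>P\<close> is small. Subtracting its principal parts leaves a
  holomorphic function which is exponentially close to \<open>f\<close>: where \<open>P\<close> is not small this is a direct
  estimate, elsewhere it follows from the maximum principle. Letting \<open>s\<close> run through \<open>s\<^sub>0 2\<^sup>l\<close> and summing
  the differences of the resulting polynomial approximations yields Taylor expansions of \<open>f\<close> along all
  lines, with uniform remainders and coefficients of the required size. Mixed finite differences turn
  these directional expansions into smoothness and bounds for the full derivatives.
\<close>

section \<open>Polynomials on discs and intervals\<close>

text \<open>The obstacle is the zero set of \<open>f\<close>: away from it \<open>f\<close> is the
  quotient of its two powers, near it division loses everything. Polynomials in one variable tame
  this: \<open>P - \<mu>\<close> has at most \<open>n\<close> zeros, and on some circle
  \<open>P\<close> is bounded below with a loss of only \<open>72 ^ n\<close>. Hence the detour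
  through lines, and the need for \<open>n \<le> \<nu> / ln 2\<close>, which makes losses
  exponential in \<open>n\<close> comparable to \<open>exp \<nu>\<close>. They are paid for by
  shrinking the disc by a factor \<open>\<kappa>\<close> that depends on \<open>j\<close> only,
  since this improves the residual by \<open>\<kappa> ^ n\<close>. The radius
  \<open>\<nu> / s\<close> is the natural one: Taylor coefficients of size \<open>s ^ k / k!\<close>
  add up to at most \<open>exp (\<theta> * \<nu>)\<close> on a disc of radius
  \<open>\<theta> * \<nu> / s\<close>. Conversely, for approximating polynomials of degree at most
  \<open>\<nu>\<close>, Cauchy's factor \<open>(s / \<nu>) ^ k\<close> is at most
  \<open>s ^ k / k!\<close>, which restores the factorial that mixed differences use up. In the end
  \<open>\<rho>\<close> is only multiplied by a number depending on \<open>j\<close> alone. This is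
  why one estimate settles both the Roumieu case (some \<open>\<rho>\<close>) and the Beurling case
  (every \<open>\<rho>\<close>).\<close>

lemma lagrange_interpolation:
  fixes p :: "complex poly"
  assumes inj: "inj_on x {..N}" and deg: "degree p \<le> N"
  shows "poly p z = (\<Sum>i\<le>N. poly p (x i) * (\<Prod>k\<in>{..N}-{i}. (z - x k) / (x i - x k)))"
proof -
  define q where "q = (\<Sum>i\<le>N. smult (poly p (x i)) (\<Prod>k\<in>{..N}-{i}. smult (1 / (x i - x k)) [:- x k, 1:]))"
  have q: "poly q z = (\<Sum>i\<le>N. poly p (x i) * (\<Prod>k\<in>{..N}-{i}. (z - x k) / (x i - x k)))" for z
    by (simp add: q_def poly_sum poly_prod algebra_simps diff_divide_distrib)
  have degq: "degree q \<le> N"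
    unfolding q_def
  proof (intro degree_sum_le)
    fix i assume "i \<in> {..N}"
    have "degree (\<Prod>k\<in>{..N}-{i}. smult (1 / (x i - x k)) [:- x k, 1:])
        \<le> sum (degree \<circ> (\<lambda>k. smult (1 / (x i - x k)) [:- x k, 1:])) ({..N}-{i})"
      by (rule degree_prod_sum_le) simp
    also have "\<dots> \<le> (\<Sum>k\<in>{..N}-{i}. 1)"
      by (intro sum_mono) (auto simp: o_def)
    also have "\<dots> = N" using \<open>i \<in> {..N}\<close> by simp
    finally show "degree (smult (poly p (x i)) (\<Prod>k\<in>{..N}-{i}. smult (1 / (x i - x k)) [:- x k, 1:])) \<le> N"
      using degree_smult_le order_trans by blast
  qed auto
  have "p = q"
  proof (rule poly_eqI_degree[where A = "x ` {..N}"])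
    fix w assume "w \<in> x ` {..N}"
    then obtain l where l: "l \<le> N" "w = x l" by auto
    have "poly q w = (\<Sum>i\<le>N. if i = l then poly p (x l) else 0)"
      unfolding q
    proof (intro sum.cong refl)
      fix i assume i: "i \<in> {..N}"
      show "poly p (x i) * (\<Prod>k\<in>{..N}-{i}. (w - x k) / (x i - x k)) = (if i = l then poly p (x l) else 0)"
      proof (cases "i = l")
        case True
        have "(\<Prod>k\<in>{..N}-{i}. (w - x k) / (x i - x k)) = (\<Prod>k\<in>{..N}-{i}. 1)"
          using inj l True by (intro prod.cong refl) (auto simp: inj_on_def)
        then show ?thesis using True by simp
      next
        case False
        have "(\<Prod>k\<in>{..N}-{i}. (w - x k) / (x i - x k)) = 0"
          using l False by (intro prod_zero) auto
        then show ?thesis using False by simp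
      qed
    qed
    also have "\<dots> = poly p w" using l by simp
    finally show "poly p w = poly q w" by simp
  qed (use deg degq card_image[OF inj] in auto)
  then show ?thesis using q[of z] by metis
qed

lemma exp_sum_bound:
  fixes x :: real
  assumes "x \<ge> 0"
  shows "(\<Sum>k<n. x ^ k / fact k) \<le> exp x"
proof -
  have "(\<lambda>n. x ^ n /\<^sub>R fact n) sums exp x" by (rule exp_converges)
  then have "(\<Sum>k<n. x ^ k /\<^sub>R fact k) \<le> exp x"
    using sum_le_suminf[of "\<lambda>n. x ^ n /\<^sub>R fact n" "{..<n}"] assms by (auto simp: sums_iff)
  then show ?thesis by (simp add: divide_inverse mult.commute)
qed

lemma pow_div_fact_le_exp:
  fixes x :: real
  assumes "x \<ge> 0"
  shows "x ^ n / fact n \<le> exp x"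
proof -
  have "x ^ n / fact n \<le> (\<Sum>k<Suc n. x ^ k / fact k)"
    using assms sum_nonneg[of "{..<n}" "\<lambda>k. x ^ k / fact k"] by simp
  also have "\<dots> \<le> exp x" by (rule exp_sum_bound[OF assms])
  finally show ?thesis .
qed

lemma power_self_le_exp_fact: "real N ^ N \<le> exp (real N) * fact N"
  using pow_div_fact_le_exp[of "real N" N] by (simp add: divide_le_eq)

lemma prod_abs_diff_nat:
  assumes "i \<le> N"
  shows "(\<Prod>k\<in>{..N}-{i}. \<bar>real i - real k\<bar>) = fact i * fact (N - i)"
proof -
  have split: "{..N}-{i} = {..<i} \<union> {i<..N}" using assms by auto
  have "(\<Prod>k\<in>{..N}-{i}. \<bar>real i - real k\<bar>) = (\<Prod>k<i. \<bar>real i - real k\<bar>) * (\<Prod>k\<in>{i<..N}. \<bar>real i - real k\<bar>)"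
    unfolding split by (rule prod.union_disjoint) auto
  also have "(\<Prod>k<i. \<bar>real i - real k\<bar>) = (\<Prod>k\<in>{1..i}. real k)"
    by (rule prod.reindex_bij_witness[where i = "\<lambda>k. i - k" and j = "\<lambda>k. i - k"]) auto
  also have "\<dots> = fact i" by (simp add: fact_prod)
  also have "(\<Prod>k\<in>{i<..N}. \<bar>real i - real k\<bar>) = (\<Prod>k\<in>{1..N-i}. real k)"
    by (rule prod.reindex_bij_witness[where i = "\<lambda>k. k + i" and j = "\<lambda>k. k - i"]) auto
  also have "\<dots> = fact (N - i)" by (simp add: fact_prod)
  finally show ?thesis .
qed

text \<open>Lagrange interpolation at \<open>N + 1\<close> equispaced nodes: each basis polynomial
  is at most \<open>N^N / N! * (N choose i)\<close> on the disc, the binomials sum to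
  \<open>2 ^ N\<close>, and \<open>N^N / N!\<close> is at most \<open>3 ^ N\<close>. A base cruder
  than the sharp \<open>1 + sqrt 2\<close> is affordable because the approximating polynomials will
  have a degree that is a small multiple of \<open>\<nu>\<close>.\<close>

lemma poly_bound_disc:
  fixes p :: "complex poly"
  assumes deg: "degree p \<le> N" and M: "\<And>t::real. \<bar>t\<bar> \<le> 1 \<Longrightarrow> norm (poly p (of_real t)) \<le> M"
    and z: "norm z \<le> 1"
  shows "norm (poly p z) \<le> 6 ^ N * M"
proof (cases "N = 0")
  case True
  then obtain c where "p = [:c:]" using deg degree_eq_zeroE by auto
  then show ?thesis using M[of 0] True by simp
next
  case False
  define x where "x = (\<lambda>i. 2 * real i / real N - 1)"
  have M0: "M \<ge> 0" using order_trans[OF norm_ge_zero M[of 0]] by simp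
  have xb: "\<bar>x i\<bar> \<le> 1" if "i \<le> N" for i
    using that False by (simp add: x_def abs_le_iff divide_simps)
  have inj: "inj_on (\<lambda>i. complex_of_real (x i)) {..N}"
    using False by (simp add: inj_on_def x_def)
  have summand: "norm (\<Prod>k\<in>{..N}-{i}. (z - of_real (x k)) / (of_real (x i) - of_real (x k)))
      \<le> real N ^ N / fact N * real (N choose i)" if i: "i \<le> N" for i
  proof -
    have "norm (\<Prod>k\<in>{..N}-{i}. (z - of_real (x k)) / (of_real (x i) - of_real (x k)))
       = (\<Prod>k\<in>{..N}-{i}. norm (z - of_real (x k)) / \<bar>x i - x k\<bar>)"
      unfolding prod_norm[symmetric] norm_divide of_real_diff[symmetric] norm_of_real ..
    also have "\<dots> \<le> (\<Prod>k\<in>{..N}-{i}. real N / \<bar>real i - real k\<bar>)"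
    proof (intro prod_mono conjI)
      fix k assume k: "k \<in> {..N}-{i}"
      have "norm (z - of_real (x k)) \<le> norm z + \<bar>x k\<bar>" using norm_triangle_ineq4[of z "of_real (x k)"] by simp
      also have "\<dots> \<le> 2" using z xb[of k] k by auto
      finally have "norm (z - of_real (x k)) \<le> 2" .
      have "x i - x k = 2 / real N * (real i - real k)" by (simp add: x_def right_diff_distrib)
      then have "\<bar>x i - x k\<bar> = 2 / real N * \<bar>real i - real k\<bar>" by (simp only: abs_mult) simp
      then have eq: "1 / \<bar>x i - x k\<bar> = real N / (2 * \<bar>real i - real k\<bar>)"
        using False k by (simp only:) simp
      have "norm (z - of_real (x k)) / \<bar>x i - x k\<bar> = norm (z - of_real (x k)) * (real N / (2 * \<bar>real i - real k\<bar>))"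
        unfolding eq[symmetric] by simp
      also have "\<dots> \<le> 2 * (real N / (2 * \<bar>real i - real k\<bar>))"
        using \<open>norm (z - of_real (x k)) \<le> 2\<close> by (intro mult_right_mono) auto
      finally show "norm (z - of_real (x k)) / \<bar>x i - x k\<bar> \<le> real N / \<bar>real i - real k\<bar>" by simp
    qed auto
    also have "\<dots> = real N ^ N / (\<Prod>k\<in>{..N}-{i}. \<bar>real i - real k\<bar>)"
      using i by (simp add: prod_dividef)
    also have "\<dots> = real N ^ N / fact N * real (N choose i)"
      using i by (simp add: prod_abs_diff_nat binomial_fact field_simps)
    finally show ?thesis .
  qed
  have "norm (poly p z) \<le> (\<Sum>i\<le>N. norm (poly p (of_real (x i)) *
      (\<Prod>k\<in>{..N}-{i}. (z - of_real (x k)) / (of_real (x i) - of_real (x k)))))"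
    unfolding lagrange_interpolation[OF inj deg, of z] by (rule norm_sum)
  also have "\<dots> \<le> (\<Sum>i\<le>N. M * (real N ^ N / fact N * real (N choose i)))"
    unfolding norm_mult using M xb summand M0 by (intro sum_mono mult_mono) auto
  also have "\<dots> = M * (real N ^ N / fact N) * (\<Sum>i\<le>N. real (N choose i))"
    by (simp only: sum_distrib_left mult.assoc)
  also have "(\<Sum>i\<le>N. real (N choose i)) = 2 ^ N"
    using choose_row_sum[of N] by (metis of_nat_numeral of_nat_power of_nat_sum)
  also have "M * (real N ^ N / fact N) * 2 ^ N \<le> M * 3 ^ N * 2 ^ N"
  proof (intro mult_right_mono mult_left_mono M0)
    have "real N ^ N / fact N \<le> exp (real N)" using power_self_le_exp_fact[of N] by (simp add: field_simps)
    also have "\<dots> = exp 1 ^ N" by (simp flip: exp_of_nat_mult)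
    also have "\<dots> \<le> 3 ^ N" by (intro power_mono exp_le) auto
    finally show "real N ^ N / fact N \<le> 3 ^ N" .
  qed auto
  also have "\<dots> = 6 ^ N * M" by (simp flip: power_mult_distrib)
  finally show ?thesis .
qed

section \<open>Coefficients of a polynomial from its values on a real interval\<close>

lemma higher_deriv_poly: "(deriv ^^ k) (poly p) = poly ((pderiv ^^ k) (p :: complex poly))"
proof (induction k)
  case (Suc k)
  have "deriv (poly q) = poly (pderiv q)" for q :: "complex poly"
    by (intro ext DERIV_imp_deriv poly_DERIV)
  then show ?case using Suc by simp
qed simp

lemma poly_coeff_Cauchy:
  fixes p :: "complex poly"
  assumes "\<And>z. norm z \<le> 1 \<Longrightarrow> norm (poly p z) \<le> M"
  shows "norm (coeff p k) \<le> M"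
proof -
  have "norm ((deriv ^^ k) (poly p) 0) \<le> fact k * M / 1 ^ k"
    by (rule Cauchy_inequality) (use assms in \<open>auto intro!: holomorphic_intros continuous_intros\<close>)
  moreover have "(deriv ^^ k) (poly p) 0 = fact k * coeff p k"
    by (simp add: higher_deriv_poly poly_0_coeff_0 coeff_higher_pderiv pochhammer_fact)
  ultimately show ?thesis by (simp add: norm_mult)
qed

lemma poly_coeff_bound_real:
  fixes p :: "complex poly"
  assumes deg: "degree p \<le> N" and R: "R > 0"
    and M: "\<And>t::real. \<bar>t\<bar> \<le> R \<Longrightarrow> norm (poly p (of_real t)) \<le> M"
  shows "norm (coeff p k) \<le> 6 ^ N * M / R ^ k"
proof -
  define q where "q = pcompose p [:0, of_real R:]"
  have "degree q \<le> N" using deg unfolding q_def by (simp add: degree_pcompose)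
  moreover have "norm (poly q (of_real t)) \<le> M" if "\<bar>t\<bar> \<le> 1" for t :: real
    using M[of "t * R"] that R by (simp add: q_def poly_pcompose abs_mult mult_left_le_one_le)
  ultimately have "norm (poly q z) \<le> 6 ^ N * M" if "norm z \<le> 1" for z
    using poly_bound_disc that by blast
  then have "norm (coeff q k) \<le> 6 ^ N * M" by (rule poly_coeff_Cauchy)
  moreover have "coeff q k = of_real R ^ k * coeff p k"
    unfolding q_def by (simp add: coeff_pcompose_linear)
  ultimately show ?thesis using R by (simp add: norm_mult norm_power field_simps)
qed

text \<open>A Chebyshev type bound: a monic polynomial that is too small on the whole interval would
  violate the coefficient estimate for its leading term. Rescaling \<open>{1/2..1}\<close> to
  \<open>{-1..1}\<close> turns the leading coefficient into \<open>(1 / 4) ^ m\<close>, and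
  \<open>24 = 4 * 6\<close> with the 6 from \<open>poly_coeff_bound_real\<close>.\<close>

lemma poly_real_prod_lower_bound:
  fixes a :: "nat \<Rightarrow> real"
  shows "\<exists>r\<in>{1/2..1}. (1 / 24) ^ m \<le> (\<Prod>i<m. \<bar>r - a i\<bar>)"
proof (rule ccontr)
  assume neg: "\<not> ?thesis"
  define p where "p = (\<Prod>i<m. [:complex_of_real (3 / 4 - a i), 1 / 4:])"
  have deg: "degree p = m"
    unfolding p_def by (subst degree_prod_sum_eq) auto
  have lead: "lead_coeff p = (1 / 4) ^ m"
    unfolding p_def by (simp add: lead_coeff_prod)
  have p: "norm (poly p (of_real t)) = (\<Prod>i<m. \<bar>(3 / 4 + t / 4) - a i\<bar>)" for t
  proof -
    have "poly p (of_real t) = of_real (\<Prod>i<m. (3 / 4 + t / 4) - a i)"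
      unfolding p_def by (simp add: poly_prod algebra_simps)
    then show ?thesis by (simp only: norm_of_real abs_prod)
  qed
  have lt: "norm (poly p (of_real t)) < (1 / 24) ^ m" if "\<bar>t\<bar> \<le> 1" for t :: real
  proof -
    have "3 / 4 + t / 4 \<in> {1/2..1}" using that by auto
    then show ?thesis unfolding p using neg by force
  qed
  \<comment> \<open>The maximum is attained, hence strictly below \<open>(1 / 24) ^ m\<close>; the
    contradiction rests on this strictness.\<close>
  have "compact ((\<lambda>t::real. norm (poly p (of_real t))) ` {-1..1})"
    by (intro compact_continuous_image continuous_intros) auto
  then obtain M where M: "M \<in> (\<lambda>t::real. norm (poly p (of_real t))) ` {-1..1}"
      "\<And>y. y \<in> (\<lambda>t::real. norm (poly p (of_real t))) ` {-1..1} \<Longrightarrow> y \<le> M"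
    using compact_attains_sup[of "(\<lambda>t::real. norm (poly p (of_real t))) ` {-1..1}"] by auto
  have "M < (1 / 24) ^ m" using M(1) lt by (auto simp: abs_le_iff)
  have "norm (coeff p m) \<le> 6 ^ m * M / 1 ^ m"
    by (rule poly_coeff_bound_real) (use deg M(2) in \<open>auto simp: abs_le_iff\<close>)
  also have "\<dots> < 6 ^ m * (1 / 24) ^ m" using \<open>M < (1 / 24) ^ m\<close> by simp
  also have "\<dots> = (1 / 4) ^ m" by (simp flip: power_mult_distrib)
  also have "\<dots> = norm (coeff p m)" using lead deg by (simp add: norm_power norm_divide)
  finally show False by simp
qed

text \<open>An estimate of Cartan type. On the circle of radius \<open>r\<close> the distance to a
  root \<open>a\<close> is at least the difference of \<open>r\<close> and \<open>norm a\<close>, so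
  a radius that is good for the moduli of all roots is good on the whole circle.
  \<open>72 = 3 * 24\<close>, where 3 bounds the distance from \<open>w\<close> to a root of modulus
  at most 2.\<close>

lemma poly_minimum_modulus_circle:
  fixes p :: "complex poly"
  assumes deg: "degree p \<le> n" and w: "norm w \<le> 1"
  shows "\<exists>r\<in>{1/2..1}. \<forall>z. norm z = r \<longrightarrow> norm (poly p w) \<le> 72 ^ n * norm (poly p z)"
proof -
  define N where "N = degree p"
  obtain root where root: "smult (lead_coeff p) (\<Prod>i<N. [:-root i, 1:]) = p"
    unfolding N_def by (rule complex_poly_decompose')
  define c where "c = lead_coeff p"
  have eq: "norm (poly p z) = norm c * (\<Prod>i<N. norm (z - root i))" for z
    by (subst root[symmetric]) (simp add: poly_prod norm_mult c_def flip: prod_norm)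
  \<comment> \<open>For a far root the distance from \<open>w\<close> is unbounded, but its ratio to
    the distance from \<open>z\<close> is not. Clamping the modulus at 2 keeps the comparison
    \<open>fac\<close> valid with the same constant 3.\<close>
  define b where "b = (\<lambda>i. if norm (root i) \<le> 2 then norm (root i) else 2)"
  obtain r where r: "r \<in> {1/2..1}" "(1 / 24) ^ N \<le> (\<Prod>i<N. \<bar>r - b i\<bar>)"
    using poly_real_prod_lower_bound[of N b] by blast
  have fac: "norm (w - root i) * \<bar>r - b i\<bar> \<le> 3 * norm (z - root i)" if z: "norm z = r" for z i
  proof (cases "norm (root i) \<le> 2")
    case True
    have "norm (w - root i) \<le> 3" using norm_triangle_ineq4[of w "root i"] w True by linarith
    moreover have "\<bar>r - b i\<bar> \<le> norm (z - root i)"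
      using norm_triangle_ineq3[of z "root i"] z True by (simp add: b_def)
    ultimately show ?thesis by (intro mult_mono) auto
  next
    case False
    have 1: "norm (w - root i) \<le> 1 + norm (root i)" using norm_triangle_ineq4[of w "root i"] w by linarith
    have 2: "norm (root i) - r \<le> norm (z - root i)" using norm_triangle_ineq3[of z "root i"] z by linarith
    have b: "\<bar>r - b i\<bar> = 2 - r" using False r(1) by (simp add: b_def)
    have "norm (w - root i) * (2 - r) \<le> (1 + norm (root i)) * (2 - r)"
      using 1 r(1) by (intro mult_right_mono) auto
    also have "\<dots> \<le> 3 * (norm (root i) - r)"
    proof -
      have "0 \<le> (norm (root i) - 2) * (1 + r)" using False r(1) by (intro mult_nonneg_nonneg) auto
      then show ?thesis by (simp add: algebra_simps)
    qed
    also have "\<dots> \<le> 3 * norm (z - root i)" using 2 by simp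
    finally show ?thesis unfolding b .
  qed
  show ?thesis
  proof (intro bexI[OF _ r(1)] allI impI)
    fix z :: complex assume z: "norm z = r"
    have "(\<Prod>i<N. norm (w - root i)) * (1 / 24) ^ N \<le> (\<Prod>i<N. norm (w - root i)) * (\<Prod>i<N. \<bar>r - b i\<bar>)"
      using r(2) by (intro mult_left_mono prod_nonneg) auto
    also have "\<dots> = (\<Prod>i<N. norm (w - root i) * \<bar>r - b i\<bar>)" by (simp add: prod.distrib)
    also have "\<dots> \<le> (\<Prod>i<N. 3 * norm (z - root i))" using fac[OF z] by (intro prod_mono) auto
    also have "\<dots> = 3 ^ N * (\<Prod>i<N. norm (z - root i))" by (simp add: prod.distrib)
    finally have "(\<Prod>i<N. norm (w - root i)) \<le> 24 ^ N * (3 ^ N * (\<Prod>i<N. norm (z - root i)))"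
      by (simp add: power_one_over divide_le_eq mult_ac)
    also have "\<dots> = 72 ^ N * (\<Prod>i<N. norm (z - root i))" by (simp flip: power_mult_distrib mult.assoc)
    finally have "norm (poly p w) \<le> 72 ^ N * norm (poly p z)"
      unfolding eq by (metis mult.left_commute mult_left_mono norm_ge_zero)
    also have "\<dots> \<le> 72 ^ n * norm (poly p z)"
      using deg N_def by (intro mult_right_mono power_increasing) auto
    finally show "norm (poly p w) \<le> 72 ^ n * norm (poly p z)" .
  qed
qed

text \<open>The points where \<open>p'\<close> is small have an image of small area, so they cannot cover the disc of
  radius \<open>\<delta>\<close>.\<close>

lemma poly_regular_value:
  fixes p :: "complex poly"
  assumes d: "\<delta> > 0"
  shows "\<exists>\<mu>. norm \<mu> \<le> \<delta> \<and> (\<forall>a. norm a \<le> 1 \<and> poly p a = \<mu> \<longrightarrow> \<delta> / 12 \<le> norm (poly (pderiv p) a))"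
proof (rule ccontr)
  assume neg: "\<not> ?thesis"
  define E where "E = {a. norm a \<le> 1 \<and> norm (poly (pderiv p) a) < \<delta> / 12}"
  have cover: "cball (0::complex) \<delta> \<subseteq> poly p ` E"
  proof
    fix v assume "v \<in> cball (0::complex) \<delta>"
    then obtain a where "norm a \<le> 1" "poly p a = v" "\<not> \<delta> / 12 \<le> norm (poly (pderiv p) a)"
      using neg by (auto simp: dist_norm)
    then show "v \<in> poly p ` E" by (auto simp: E_def)
  qed
  \<comment> \<open>Points between two elements of \<open>E\<close> need not lie in
    \<open>E\<close>; on short segments uniform continuity still keeps the derivative below
    \<open>\<delta> / 6\<close>.\<close>
  have "uniformly_continuous_on (cball 0 1) (poly (pderiv p))"
    by (intro compact_uniformly_continuous continuous_intros) auto
  then have "\<exists>e>0. \<forall>z\<in>cball 0 1. \<forall>w\<in>cball 0 1. dist w z < e \<longrightarrow>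
      dist (poly (pderiv p) w) (poly (pderiv p) z) < \<delta> / 12"
    using d unfolding uniformly_continuous_on_def by (metis divide_pos_pos zero_less_numeral)
  then obtain e where e: "e > 0" and e': "\<And>z w. z \<in> cball 0 1 \<Longrightarrow> w \<in> cball 0 1 \<Longrightarrow> dist w z < e \<Longrightarrow>
      dist (poly (pderiv p) w) (poly (pderiv p) z) < \<delta> / 12" by blast
  obtain N0 :: nat where N0: "real N0 > 4 / e" using reals_Archimedean2 by blast
  \<comment> \<open>At least 3, for the area count at the end: \<open>(N + 1)^2\<close> discs of
    radius \<open>2 * \<delta> / (3 * N)\<close> have less total area than the disc of radius
    \<open>\<delta>\<close> exactly if \<open>2 * (N + 1) < 3 * N\<close>.\<close>
  define N where "N = N0 + 3"
  have N: "4 / real N < e" "N \<ge> 3"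
    using N0 e by (auto simp: N_def field_simps add_pos_pos)
  define cell where "cell = (\<lambda>a. (nat \<lfloor>(Re a + 1) * real N / 2\<rfloor>, nat \<lfloor>(Im a + 1) * real N / 2\<rfloor>))"
  define I where "I = {..N} \<times> {..N}"
  have idx: "nat \<lfloor>(x + 1) * real N / 2\<rfloor> \<le> N" if "\<bar>x\<bar> \<le> 1" for x
  proof -
    have "(x + 1) * real N \<le> 2 * real N" using that by (intro mult_right_mono) auto
    then have "(x + 1) * real N / 2 \<le> real N" by simp
    then show ?thesis by linarith
  qed
  have cellI: "cell a \<in> I" if "a \<in> E" for a
    using that idx[of "Re a"] idx[of "Im a"] abs_Re_le_cmod[of a] abs_Im_le_cmod[of a]
    by (auto simp: cell_def I_def E_def)
  have near1: "\<bar>x - y\<bar> < 2 / real N"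
    if "nat \<lfloor>(x + 1) * real N / 2\<rfloor> = nat \<lfloor>(y + 1) * real N / 2\<rfloor>" "\<bar>x\<bar> \<le> 1" "\<bar>y\<bar> \<le> 1" for x y
  proof -
    have "0 \<le> (x + 1) * real N / 2" "0 \<le> (y + 1) * real N / 2" using that by auto
    then have "\<lfloor>(x + 1) * real N / 2\<rfloor> = \<lfloor>(y + 1) * real N / 2\<rfloor>" using that(1) by linarith
    then have "\<bar>(x + 1) * real N / 2 - (y + 1) * real N / 2\<bar> < 1" by linarith
    moreover have "(x + 1) * real N / 2 - (y + 1) * real N / 2 = (x - y) * (real N / 2)" by (simp add: field_simps)
    ultimately have "\<bar>x - y\<bar> * (real N / 2) < 1" by (simp add: abs_mult)
    then show ?thesis using N(2) by (simp add: field_simps)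
  qed
  have near: "norm (poly p z - poly p a) \<le> 2 * \<delta> / (3 * real N)"
    if "a \<in> E" "z \<in> E" "cell a = cell z" for a z
  proof -
    have za: "norm (z - a) \<le> 4 / real N"
      using cmod_le[of "z - a"] near1[of "Re z" "Re a"] near1[of "Im z" "Im a"] that
        abs_Re_le_cmod[of a] abs_Im_le_cmod[of a] abs_Re_le_cmod[of z] abs_Im_le_cmod[of z]
      by (auto simp: cell_def E_def)
    have "norm (poly p z - poly p a) \<le> \<delta> / 6 * norm (z - a)"
    proof (rule field_differentiable_bound[where S = "closed_segment a z"])
      fix u assume u: "u \<in> closed_segment a z"
      have "norm u \<le> 1"
        using u that closed_segment_subset[of a "cball 0 1" z] by (auto simp: E_def)
      moreover have "dist u a < e"
        using u za N(1) by (metis dist_commute dist_in_closed_segment(1) dist_norm le_less_trans)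
      ultimately have "dist (poly (pderiv p) u) (poly (pderiv p) a) < \<delta> / 12"
        using e'[of a u] that by (auto simp: E_def)
      then show "norm (poly (pderiv p) u) \<le> \<delta> / 6"
        using that(1) norm_triangle_ineq2[of "poly (pderiv p) u" "poly (pderiv p) a"]
        by (simp add: E_def dist_norm)
    qed (auto intro: has_field_derivative_at_within poly_DERIV)
    also have "\<dots> \<le> \<delta> / 6 * (4 / real N)" using za d by (intro mult_left_mono) auto
    finally show ?thesis by simp
  qed
  have "\<exists>y. \<forall>z\<in>E. cell z = i \<longrightarrow> norm (poly p z - y) \<le> 2 * \<delta> / (3 * real N)" for i
    using near by metis
  then obtain y where y: "\<And>i z. z \<in> E \<Longrightarrow> cell z = i \<Longrightarrow> norm (poly p z - y i) \<le> 2 * \<delta> / (3 * real N)"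
    by metis
  have "cball 0 \<delta> \<subseteq> (\<Union>i\<in>I. cball (y i) (2 * \<delta> / (3 * real N)))"
  proof
    fix v assume "v \<in> cball (0::complex) \<delta>"
    then obtain z where z: "z \<in> E" "v = poly p z" using cover by blast
    then show "v \<in> (\<Union>i\<in>I. cball (y i) (2 * \<delta> / (3 * real N)))"
      using y[OF z(1) refl] cellI[OF z(1)] by (intro UN_I[of "cell z"]) (auto simp: dist_norm norm_minus_commute)
  qed
  then have "measure lborel (cball (0::complex) \<delta>) \<le> measure lborel (\<Union>i\<in>I. cball (y i) (2 * \<delta> / (3 * real N)))"
    by (intro measure_mono_fmeasurable fmeasurable.finite_UN) (auto simp: I_def intro: fmeasurable_compact)
  also have "\<dots> \<le> (\<Sum>i\<in>I. measure lborel (cball (y i) (2 * \<delta> / (3 * real N))))"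
    by (intro measure_UNION_le) (auto simp: I_def)
  also have "\<dots> = (real N + 1)\<^sup>2 * (pi * (2 * \<delta> / (3 * real N))\<^sup>2)"
    using d by (simp add: content_cball unit_ball_vol_2 I_def power2_eq_square algebra_simps)
  also have "\<dots> < pi * \<delta>\<^sup>2"
  proof -
    define a where "a = real N + 1"
    have "a * 2 < 3 * real N" using N(2) by (simp add: a_def)
    then have "(a * 2)\<^sup>2 < (3 * real N)\<^sup>2" by (intro power_strict_mono) (auto simp: a_def)
    then have "(a * 2)\<^sup>2 / (3 * real N)\<^sup>2 < 1" using N(2) by (simp add: divide_less_eq)
    then have "(pi * \<delta>\<^sup>2) * ((a * 2)\<^sup>2 / (3 * real N)\<^sup>2) < (pi * \<delta>\<^sup>2) * 1"
      using d by (intro mult_strict_left_mono) auto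
    then show ?thesis unfolding a_def[symmetric] by (simp add: power_mult_distrib power_divide mult_ac)
  qed
  also have "\<dots> = measure lborel (cball (0::complex) \<delta>)"
    using d by (simp add: content_cball unit_ball_vol_2)
  finally show False by simp
qed

lemma prod_roots_dvd:
  fixes p :: "'a::field poly"
  assumes "finite A" "\<And>a. a \<in> A \<Longrightarrow> poly p a = 0"
  shows "(\<Prod>a\<in>A. [:- a, 1:]) dvd p"
  using assms
proof (induction A rule: finite_induct)
  case (insert a A)
  then obtain q where q: "p = (\<Prod>a\<in>A. [:- a, 1:]) * q" by (auto elim: dvdE)
  have "poly (\<Prod>a\<in>A. [:- a, 1:]) a \<noteq> 0" using insert.hyps by (auto simp: poly_prod)
  then have "poly q a = 0" using insert.prems[of a] q by simp
  then obtain q' where "q = [:- a, 1:] * q'" by (auto simp: poly_eq_0_iff_dvd elim: dvdE)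
  then have "p = (\<Prod>a\<in>insert a A. [:- a, 1:]) * q'"
    unfolding q prod.insert[OF insert.hyps] by (simp only: mult_ac)
  then show ?case by (metis dvd_triv_left)
qed simp

section \<open>Approximation of a function from two of its powers\<close>

text \<open>The exponent in \<open>\<delta> = \<eta> ^ (2 * j)\<close> is dictated by the residues.
  At a zero \<open>a\<close> of \<open>P - \<mu>\<close> the modulus of \<open>P\<close> is at most
  \<open>\<delta>\<close>, so that of \<open>Q ^ j\<close> is at most
  \<open>2 * \<delta> ^ (j + 1)\<close> and that of \<open>Q\<close> at most
  \<open>2 * \<delta> * \<eta>\<^sup>2\<close>. Division by the derivative, which is at least
  \<open>\<delta> / 12\<close>, leaves a residue of order \<open>\<eta>\<^sup>2\<close>. Where
  \<open>P\<close> is at least \<open>\<eta>\<close> in modulus, the distance to \<open>a\<close> is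
  at least \<open>\<eta> / (2 * B)\<close>, so each of the at most \<open>n\<close> principal parts
  is of order \<open>B * \<eta>\<close> there.\<close>

lemma regularized_quotient:
  fixes P Q :: "complex poly"
  assumes j: "j \<ge> 1" and deg: "degree P \<le> n" and \<eta>: "0 < \<eta>" "\<eta> \<le> 1 / 2"
    and B: "\<And>z. norm z \<le> 1 \<Longrightarrow> norm (poly (pderiv P) z) \<le> B"
    and res: "\<And>z. norm z \<le> 1 \<Longrightarrow> norm (poly P z ^ (j + 1) - poly Q z ^ j) \<le> \<epsilon>"
    and \<epsilon>: "\<epsilon> \<le> \<eta> ^ (2 * j * (j + 1))"
  shows "\<exists>F \<mu>. F holomorphic_on cball 0 1 \<and> norm \<mu> \<le> \<eta> ^ (2 * j) \<and>
    (\<forall>z. norm z \<le> 1 \<and> \<eta> \<le> norm (poly P z) \<longrightarrow>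
       norm (F z - poly Q z / (poly P z - \<mu>)) \<le> 48 * real n * B * \<eta>)"
proof -
  define \<delta> where "\<delta> = \<eta> ^ (2 * j)"
  have \<delta>: "\<delta> > 0" using \<eta> by (simp add: \<delta>_def)
  have \<delta>\<eta>: "\<delta> \<le> \<eta> / 2"
  proof -
    have "\<delta> \<le> \<eta> ^ 2" unfolding \<delta>_def using \<eta> j by (intro power_decreasing) auto
    also have "\<dots> \<le> \<eta> * (1 / 2)" unfolding power2_eq_square using \<eta> by (intro mult_left_mono) auto
    finally show ?thesis by simp
  qed
  obtain \<mu> where \<mu>: "norm \<mu> \<le> \<delta>"
    "\<And>a. norm a \<le> 1 \<Longrightarrow> poly P a = \<mu> \<Longrightarrow> \<delta> / 12 \<le> norm (poly (pderiv P) a)"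
    using poly_regular_value[OF \<delta>, of P] by blast
  define pm where "pm = P - [:\<mu>:]"
  have pm: "poly pm z = poly P z - \<mu>" "pderiv pm = pderiv P" for z
    by (simp_all add: pm_def pderiv_diff)
  have pm0: "pm \<noteq> 0"
  proof
    assume "pm = 0"
    then have "P = [:\<mu>:]" by (simp add: pm_def)
    then show False using \<mu>(2)[of 0] \<delta> by simp
  qed
  define A where "A = {a. norm a \<le> 1 \<and> poly pm a = 0}"
  have finA: "finite A" unfolding A_def using poly_roots_finite[OF pm0] by (rule rev_finite_subset) auto
  have "card A \<le> card {a. poly pm a = 0}"
    using poly_roots_finite[OF pm0] by (intro card_mono) (auto simp: A_def)
  also have "\<dots> \<le> degree pm" by (rule card_poly_roots_bound[OF pm0])
  also have "\<dots> \<le> n" using deg unfolding pm_def by (intro degree_diff_le) auto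
  finally have cardA: "card A \<le> n" .
  define d where "d = (\<lambda>a. synthetic_div pm a)"
  have d: "pm = [:- a, 1:] * d a" if "a \<in> A" for a
    using synthetic_div_correct'[of a pm] that by (simp add: d_def A_def)
  have dz: "poly pm z = (z - a) * poly (d a) z" if "a \<in> A" for a z
    by (subst d[OF that]) (simp add: algebra_simps)
  have dd: "poly (d a) a = poly (pderiv P) a" if "a \<in> A" for a
    by (subst pm(2)[symmetric], subst d[OF that], subst pderiv_mult) (simp add: pderiv_pCons)
  have nz: "poly (pderiv P) a \<noteq> 0" if "a \<in> A" for a
    using \<mu>(2)[of a] that \<delta> pm by (auto simp: A_def)
  have d0: "poly (d a) b = 0" if "a \<in> A" "b \<in> A" "a \<noteq> b" for a b
    using dz[of a b] that by (simp add: A_def)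
  \<comment> \<open>Since \<open>d a\<close> is \<open>pm\<close> divided by \<open>z - a\<close>,
    the polynomial \<open>num\<close> divided by \<open>pm\<close> is \<open>Q / pm\<close> minus
    its principal parts at the points of \<open>A\<close>.\<close>
  define num where "num = Q - (\<Sum>a\<in>A. smult (poly Q a / poly (pderiv P) a) (d a))"
  have num0: "poly num b = 0" if b: "b \<in> A" for b
  proof -
    have "(\<Sum>a\<in>A. poly Q a / poly (pderiv P) a * poly (d a) b) = (\<Sum>a\<in>A. if a = b then poly Q b else 0)"
      using b nz d0 by (intro sum.cong) (auto simp: dd)
    then show ?thesis using b finA by (simp add: num_def poly_sum)
  qed
  define Bp where "Bp = (\<Prod>a\<in>A. [:- a, 1:])"
  have "Bp dvd pm" unfolding Bp_def using finA by (intro prod_roots_dvd) (auto simp: A_def)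
  then obtain S where S: "pm = Bp * S" by (auto elim: dvdE)
  have "Bp dvd num" unfolding Bp_def using finA num0 by (intro prod_roots_dvd) auto
  then obtain R where R: "num = Bp * R" by (auto elim: dvdE)
  \<comment> \<open>A zero of \<open>S\<close> in the disc would be a multiple zero of
    \<open>P - \<mu>\<close>, which the choice of \<open>\<mu>\<close> excludes. So
    \<open>R / S\<close> continues \<open>num / pm\<close> holomorphically across
    \<open>A\<close>.\<close>
  have S0: "poly S z \<noteq> 0" if z: "norm z \<le> 1" for z
  proof
    assume s: "poly S z = 0"
    then have zA: "z \<in> A" using z S by (simp add: A_def)
    then have "poly Bp z = 0" using finA by (auto simp: Bp_def poly_prod)
    then have "poly (pderiv pm) z = 0" using s by (simp add: S pderiv_mult)
    then show False using nz[OF zA] pm(2) by simp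
  qed
  define F where "F = (\<lambda>z. poly R z / poly S z)"
  have "F holomorphic_on cball 0 1"
    unfolding F_def using S0 by (intro holomorphic_intros) auto
  moreover have "norm (F z - poly Q z / (poly P z - \<mu>)) \<le> 48 * real n * B * \<eta>"
    if z: "norm z \<le> 1" and zP: "\<eta> \<le> norm (poly P z)" for z
  proof -
    have ge: "\<eta> / 2 \<le> norm (poly pm z)"
      using norm_triangle_ineq2[of "poly P z" \<mu>] zP \<mu>(1) \<delta>\<eta> by (simp add: pm)
    then have pmz: "poly pm z \<noteq> 0" using \<eta> by auto
    have B0: "B \<ge> 0" using order_trans[OF norm_ge_zero B[OF z]] .
    have "F z = poly num z / poly pm z" using pmz by (simp add: F_def S R)
    also have "\<dots> = poly Q z / (poly P z - \<mu>) - (\<Sum>a\<in>A. poly Q a / poly (pderiv P) a * poly (d a) z / poly pm z)"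
      by (simp add: num_def poly_sum diff_divide_distrib sum_divide_distrib pm)
    finally have "norm (F z - poly Q z / (poly P z - \<mu>))
        = norm (\<Sum>a\<in>A. poly Q a / poly (pderiv P) a * poly (d a) z / poly pm z)"
      by (simp add: norm_minus_commute)
    also have "\<dots> \<le> (\<Sum>a\<in>A. norm (poly Q a / poly (pderiv P) a * poly (d a) z / poly pm z))"
      by (rule norm_sum)
    also have "\<dots> \<le> (\<Sum>a\<in>A. 48 * B * \<eta>)"
    proof (rule sum_mono)
      fix a assume a: "a \<in> A"
      have a1: "norm a \<le> 1" and Pa: "poly P a = \<mu>" using a pm by (auto simp: A_def)
      have "norm (poly Q a) ^ j = norm (poly P a ^ (j + 1) - (poly P a ^ (j + 1) - poly Q a ^ j))"
        by (simp add: norm_power)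
      also have "\<dots> \<le> norm (poly P a) ^ (j + 1) + \<epsilon>"
        by (rule order_trans[OF norm_triangle_ineq4]) (use res[OF a1] in \<open>simp add: norm_power norm_mult\<close>)
      also have "norm (poly P a) ^ (j + 1) \<le> \<delta> ^ (j + 1)" unfolding Pa by (intro power_mono \<mu>) auto
      also have "\<epsilon> \<le> \<delta> ^ (j + 1)" using \<epsilon> by (simp only: \<delta>_def power_mult)
      also have "\<delta> ^ (j + 1) + \<delta> ^ (j + 1) = 2 * (\<eta> ^ (2 * (j + 1))) ^ j"
        by (simp add: \<delta>_def algebra_simps flip: power_mult power_add)
      also have "\<dots> \<le> 2 ^ j * (\<eta> ^ (2 * (j + 1))) ^ j"
        using j \<eta> self_le_power[of "2::real" j] by (intro mult_right_mono) auto
      finally have "norm (poly Q a) ^ j \<le> (2 * \<eta> ^ (2 * (j + 1))) ^ j" by (simp add: power_mult_distrib)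
      then have "norm (poly Q a) \<le> 2 * \<eta> ^ (2 * (j + 1))"
        using j \<eta> by (subst (asm) power_mono_iff) auto
      also have "\<dots> = 2 * \<delta> * \<eta>\<^sup>2" by (simp add: \<delta>_def flip: power_add)
      finally have Qa: "norm (poly Q a) \<le> 2 * \<delta> * \<eta>\<^sup>2" .
      have "norm (poly Q a / poly (pderiv P) a) \<le> 2 * \<delta> * \<eta>\<^sup>2 / (\<delta> / 12)"
        unfolding norm_divide using Qa \<mu>(2)[OF a1 Pa] \<delta> \<eta> by (intro frac_le) auto
      also have "\<dots> = 24 * \<eta>\<^sup>2" using \<delta> by simp
      finally have c: "norm (poly Q a / poly (pderiv P) a) \<le> 24 * \<eta>\<^sup>2" .
      have "norm (poly P z - poly P a) \<le> B * norm (z - a)"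
        by (rule field_differentiable_bound[where S = "cball 0 1"])
          (use z a1 B in \<open>auto intro: has_field_derivative_at_within poly_DERIV\<close>)
      then have "\<eta> / 2 \<le> B * norm (z - a)" using ge by (simp add: pm Pa)
      moreover have "z \<noteq> a" using pmz a by (auto simp: A_def)
      ultimately have "1 / norm (z - a) \<le> 2 * B / \<eta>"
        using \<eta> by (simp add: field_simps)
      moreover have "poly (d a) z / poly pm z = 1 / (z - a)"
        using pmz dz[OF a, of z] by auto
      ultimately have "norm (poly (d a) z / poly pm z) \<le> 2 * B / \<eta>" by (simp add: norm_divide)
      then have "norm (poly Q a / poly (pderiv P) a) * norm (poly (d a) z / poly pm z) \<le> 24 * \<eta>\<^sup>2 * (2 * B / \<eta>)"
        using c by (intro mult_mono) auto
      also have "\<dots> = 48 * B * \<eta>" using \<eta> by (simp add: power2_eq_square)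
      finally show "norm (poly Q a / poly (pderiv P) a * poly (d a) z / poly pm z) \<le> 48 * B * \<eta>"
        by (simp add: norm_mult norm_divide)
    qed
    also have "\<dots> = real (card A) * (48 * B * \<eta>)" by simp
    also have "\<dots> \<le> real n * (48 * B * \<eta>)" using cardA B0 \<eta> by (intro mult_right_mono) auto
    finally show ?thesis by (simp add: mult_ac)
  qed
  ultimately show ?thesis using \<mu>(1) unfolding \<delta>_def by blast
qed

text \<open>Since \<open>P\<close> stands for \<open>f ^ j\<close>, accuracy \<open>\<xi>\<close>
  for \<open>f\<close> corresponds to the threshold \<open>\<eta> = \<xi> ^ j\<close> for
  \<open>P\<close>. Above the threshold the regularized quotient is close to \<open>f\<close>; below
  it \<open>f\<close> and \<open>F\<close> are small separately. In terms of \<open>\<eta>\<close>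
  the hypothesis on \<open>\<epsilon>\<close> reads
  \<open>\<epsilon> \<le> \<eta> ^ (2 * j * (j + 1))\<close>, which is what
  \<open>regularized_quotient\<close> asks for.\<close>

lemma holomorphic_root_approx:
  fixes P Q :: "complex poly" and f :: "real \<Rightarrow> complex"
  assumes j: "j \<ge> 1" and n: "n \<ge> 1" and deg: "degree P \<le> n" and B1: "B \<ge> 1"
    and PB: "\<And>z. norm z \<le> 1 \<Longrightarrow> norm (poly P z) \<le> B"
    and P'B: "\<And>z. norm z \<le> 1 \<Longrightarrow> norm (poly (pderiv P) z) \<le> B"
    and res: "\<And>z. norm z \<le> 1 \<Longrightarrow> norm (poly P z ^ (j + 1) - poly Q z ^ j) \<le> \<epsilon>"
    and f: "\<And>x. \<bar>x\<bar> \<le> 1 \<Longrightarrow> norm (f x ^ j - poly P (of_real x)) \<le> \<epsilon>"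
      "\<And>x. \<bar>x\<bar> \<le> 1 \<Longrightarrow> norm (f x ^ (j + 1) - poly Q (of_real x)) \<le> \<epsilon>"
    and \<xi>: "0 < \<xi>" "\<xi> \<le> 1 / 2" and \<epsilon>: "\<epsilon> \<le> \<xi> ^ (2 * j\<^sup>2 * (j + 1))"
  shows "\<exists>F. F holomorphic_on ball 0 (1 / 2) \<and>
    (\<forall>z. norm z < 1 / 2 \<longrightarrow> norm (F z) \<le> 52 * real n * B) \<and>
    (\<forall>x. \<bar>x\<bar> < 1 / 2 \<longrightarrow> norm (F (of_real x) - f x) \<le> 55 * 72 ^ n * real n * B * \<xi>)"
proof -
  define \<eta> where "\<eta> = \<xi> ^ j"
  have \<eta>: "0 < \<eta>" using \<xi> by (simp add: \<eta>_def)
  have \<eta>\<xi>: "\<eta> \<le> \<xi>" using power_decreasing[of 1 j \<xi>] j \<xi> by (simp add: \<eta>_def)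
  have \<epsilon>0: "\<epsilon> \<ge> 0" using order_trans[OF norm_ge_zero res[of 0]] by simp
  have \<epsilon>\<eta>: "\<epsilon> \<le> \<eta> ^ (2 * j * (j + 1))"
    using \<epsilon> by (simp add: \<eta>_def power2_eq_square mult_ac flip: power_mult)
  have \<epsilon>2: "\<epsilon> \<le> \<eta>\<^sup>2"
  proof -
    have "\<eta> ^ (2 * j * (j + 1)) \<le> \<eta>\<^sup>2" using j \<eta> \<eta>\<xi> \<xi> by (intro power_decreasing) auto
    then show ?thesis using \<epsilon>\<eta> by simp
  qed
  have \<eta>2: "\<eta>\<^sup>2 \<le> \<eta> / 2" using \<eta> \<eta>\<xi> \<xi> unfolding power2_eq_square by (simp add: mult_left_mono)
  have two_pow: "2 * x ^ j \<le> (2 * x) ^ j" if "x \<ge> 0" for x :: real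
    using j self_le_power[of "2::real" j] that by (simp add: power_mult_distrib mult_right_mono)
  have root_le: "x \<le> y" if "x ^ j \<le> y ^ j" "y \<ge> 0" for x y :: real
    using that j by (intro power_le_imp_le_base[of x "j - 1" y]) auto
  have fsmall: "norm (f x) \<le> 2 * y" if "\<bar>x\<bar> \<le> 1" "norm (poly P (of_real x)) \<le> y ^ j" "\<epsilon> \<le> y ^ j" "y \<ge> 0" for x y
  proof (rule root_le)
    have "norm (f x) ^ j = norm (poly P (of_real x) + (f x ^ j - poly P (of_real x)))"
      by (simp add: norm_power)
    also have "\<dots> \<le> norm (poly P (of_real x)) + norm (f x ^ j - poly P (of_real x))" by (rule norm_triangle_ineq)
    also have "\<dots> \<le> y ^ j + y ^ j" using f(1)[OF that(1)] that by (intro add_mono) auto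
    also have "\<dots> \<le> (2 * y) ^ j" using two_pow[OF that(4)] by simp
    finally show "norm (f x) ^ j \<le> (2 * y) ^ j" .
  qed (use that in auto)
  have one: "1 \<le> (72::real) ^ n" by simp
  \<comment> \<open>If \<open>P\<close> is below \<open>72 ^ n * \<eta>\<close> on the whole disc,
    then \<open>f\<close> is small and 0 approximates it. Otherwise one large value at
    \<open>w\<close> forces \<open>P\<close> above the threshold on a whole circle, and this circle
    closes off the region where \<open>P\<close> is small.\<close>
  show ?thesis
  proof (cases "\<exists>w. norm w \<le> 1 \<and> 72 ^ n * \<eta> < norm (poly P w)")
    case False
    have "norm (f x) \<le> 2 * (72 ^ n * \<xi>)" if "\<bar>x\<bar> \<le> 1" for x
    proof (rule fsmall[OF that])
      have ge: "72 ^ n * \<eta> \<le> (72 ^ n * \<xi>) ^ j"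
        using j one self_le_power[OF one, of j] \<eta> by (simp add: power_mult_distrib \<eta>_def)
      show "norm (poly P (of_real x)) \<le> (72 ^ n * \<xi>) ^ j"
        using False[simplified, rule_format, of "of_real x"] that ge by (simp add: not_less)
      have "\<epsilon> \<le> 1 * \<eta>" using \<epsilon>2 \<eta>2 \<eta> by linarith
      also have "\<dots> \<le> 72 ^ n * \<eta>" using one \<eta> by (intro mult_right_mono) auto
      finally show "\<epsilon> \<le> (72 ^ n * \<xi>) ^ j" using ge by simp
    qed (use \<xi> in auto)
    moreover have "2 * (72 ^ n * \<xi>) \<le> 55 * 72 ^ n * real n * B * \<xi>"
    proof -
      have "1 * 1 \<le> real n * B" using n B1 by (intro mult_mono) auto
      then have "2 * (72 ^ n * \<xi>) * 1 \<le> 55 * (72 ^ n * \<xi>) * (real n * B)"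
        using \<xi> by (intro mult_mono) auto
      then show ?thesis by (simp add: mult_ac)
    qed
    ultimately have "norm (f x) \<le> 55 * 72 ^ n * real n * B * \<xi>" if "\<bar>x\<bar> < 1 / 2" for x
      using that by (rule_tac order_trans[of _ "2 * (72 ^ n * \<xi>)"]) auto
    then show ?thesis using B1 by (intro exI[of _ "\<lambda>_. 0"]) auto
  next
    case True
    then obtain w where w: "norm w \<le> 1" "72 ^ n * \<eta> < norm (poly P w)" by blast
    obtain r where r: "r \<in> {1/2..1}" "\<And>z. norm z = r \<Longrightarrow> norm (poly P w) \<le> 72 ^ n * norm (poly P z)"
      using poly_minimum_modulus_circle[OF deg w(1)] by blast
    have circ: "\<eta> \<le> norm (poly P z)" if "norm z = r" for z
    proof -
      have "72 ^ n * \<eta> \<le> 72 ^ n * norm (poly P z)" using w(2) r(2)[OF that] by linarith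
      then show ?thesis by simp
    qed
    have \<eta>h: "\<eta> \<le> 1 / 2" using \<eta>\<xi> \<xi> by simp
    obtain F \<mu> where F: "F holomorphic_on cball 0 1" and \<mu>: "norm \<mu> \<le> \<eta> ^ (2 * j)"
      and FQ: "\<And>z. norm z \<le> 1 \<Longrightarrow> \<eta> \<le> norm (poly P z) \<Longrightarrow>
        norm (F z - poly Q z / (poly P z - \<mu>)) \<le> 48 * real n * B * \<eta>"
      using regularized_quotient[OF j deg \<eta> \<eta>h P'B res \<epsilon>\<eta>] by blast
    have \<mu>\<eta>: "norm \<mu> \<le> \<eta>\<^sup>2"
      by (rule order_trans[OF \<mu> power_decreasing]) (use j \<eta> \<eta>h in auto)
    \<comment> \<open>A substitute for the modulus of \<open>f\<close> that makes sense off the real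
      line.\<close>
    define p where "p = (\<lambda>z. root j (norm (poly P z)))"
    have p: "p z ^ j = norm (poly P z)" "p z \<ge> 0" for z
      using j by (simp_all add: p_def)
    have pB: "p z \<le> B" if "norm z \<le> 1" for z
    proof (rule root_le)
      show "p z ^ j \<le> B ^ j" unfolding p using PB[OF that] self_le_power[of B j] B1 j by simp
    qed (use B1 in auto)
    have half: "norm (poly P z) / 2 \<le> norm (poly P z - \<mu>)" if "\<eta> \<le> norm (poly P z)" for z
      using norm_triangle_ineq2[of "poly P z" \<mu>] \<mu>\<eta> \<eta>2 that by linarith
    have QP: "norm (poly Q z / (poly P z - \<mu>)) \<le> 4 * p z" if z: "norm z \<le> 1" "\<eta> \<le> norm (poly P z)" for z
    proof -
      have "norm (poly Q z) \<le> 2 * p z ^ (j + 1)"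
      proof (rule root_le)
        have "norm (poly Q z) ^ j = norm (poly P z ^ (j + 1) - (poly P z ^ (j + 1) - poly Q z ^ j))"
          by (simp add: norm_power)
        also have "\<dots> \<le> norm (poly P z) ^ (j + 1) + \<epsilon>"
          by (rule order_trans[OF norm_triangle_ineq4]) (use res[OF z(1)] in \<open>simp add: norm_power norm_mult\<close>)
        also have "\<epsilon> \<le> norm (poly P z) ^ (j + 1)"
        proof -
          have "\<eta> ^ (2 * j * (j + 1)) \<le> \<eta> ^ (j + 1)" using j \<eta> \<eta>h by (intro power_decreasing) auto
          also have "\<dots> \<le> norm (poly P z) ^ (j + 1)" using z \<eta> by (intro power_mono) auto
          finally show ?thesis using \<epsilon>\<eta> by simp
        qed
        also have "norm (poly P z) ^ (j + 1) + norm (poly P z) ^ (j + 1) = 2 * (p z ^ (j + 1)) ^ j"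
          unfolding p(1)[symmetric] power_mult[symmetric] by (simp only: mult.commute[of j] mult_2)
        also have "\<dots> \<le> (2 * p z ^ (j + 1)) ^ j" using p by (intro two_pow) simp
        finally show "norm (poly Q z) ^ j \<le> (2 * p z ^ (j + 1)) ^ j" by simp
      qed (use p in auto)
      then have "norm (poly Q z / (poly P z - \<mu>)) \<le> 2 * p z ^ (j + 1) / (norm (poly P z) / 2)"
        unfolding norm_divide using half[OF z(2)] z(2) \<eta> p by (intro frac_le) auto
      also have "\<dots> = 4 * p z" using z(2) \<eta> unfolding p(1)[symmetric] by (simp add: field_simps)
      finally show ?thesis .
    qed
    have Fbig: "norm (F z) \<le> 4 * p z + 48 * real n * B * \<eta>" if z: "norm z \<le> 1" "\<eta> \<le> norm (poly P z)" for z
    proof -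
      have "norm (F z) = norm (poly Q z / (poly P z - \<mu>) + (F z - poly Q z / (poly P z - \<mu>)))" by simp
      also have "\<dots> \<le> norm (poly Q z / (poly P z - \<mu>)) + norm (F z - poly Q z / (poly P z - \<mu>))"
        by (rule norm_triangle_ineq)
      also have "\<dots> \<le> 4 * p z + 48 * real n * B * \<eta>" by (intro add_mono QP FQ z)
      finally show ?thesis .
    qed
    have Fedge: "norm (F z) \<le> 4 * \<xi> + 48 * real n * B * \<eta>" if z: "norm z \<le> 1" "norm (poly P z) = \<eta>" for z
    proof -
      have "p z = \<xi>" unfolding p_def z(2) \<eta>_def using \<xi> j by (simp add: real_root_power_cancel)
      then show ?thesis using Fbig[of z] z by simp
    qed
    have Fsmall: "norm (F z) \<le> 4 * \<xi> + 48 * real n * B * \<eta>" if z: "norm z < r" "norm (poly P z) \<le> \<eta>" for z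
    proof (cases "norm (poly P z) = \<eta>")
      case True
      then show ?thesis using z r(1) by (intro Fedge) auto
    next
      case False
      \<comment> \<open>\<open>V\<close> may well be disconnected. By \<open>circ\<close> no
        frontier point can lie on the circle unless the modulus of \<open>P\<close> equals
        \<open>\<eta>\<close> there, so this equality holds on the whole frontier and
        \<open>Fedge\<close> applies.\<close>
      define V where "V = {z. norm z < r} \<inter> {z. norm (poly P z) < \<eta>}"
      have oV: "open V" unfolding V_def by (intro open_Int open_Collect_less continuous_intros)
      have "closed ({z. norm z \<le> r} \<inter> {z. norm (poly P z) \<le> \<eta>})"
        by (intro closed_Int closed_Collect_le continuous_intros)
      then have cV: "closure V \<subseteq> {z. norm z \<le> r} \<inter> {z. norm (poly P z) \<le> \<eta>}"
        by (intro closure_minimal) (auto simp: V_def)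
      have cV1: "closure V \<subseteq> cball 0 1" using cV r(1) by force
      show ?thesis
      proof (rule maximum_modulus_frontier[of F V])
        show "F holomorphic_on interior V"
          using F cV1 closure_subset interior_subset by (blast intro: holomorphic_on_subset)
        show "continuous_on (closure V) F"
          using F cV1 holomorphic_on_imp_continuous_on continuous_on_subset by blast
        show "bounded V" by (rule bounded_subset[OF bounded_cball[of 0 1] order_trans[OF closure_subset cV1]])
        show "z \<in> V" using z False by (simp add: V_def)
        fix u assume u: "u \<in> frontier V"
        have "u \<in> closure V" "u \<notin> V" using u oV unfolding frontier_def by (simp_all add: interior_open)
        have 1: "norm u \<le> r" "norm (poly P u) \<le> \<eta>" using \<open>u \<in> closure V\<close> cV by blast+
        have "norm u = r \<or> norm (poly P u) = \<eta>"
          using 1 \<open>u \<notin> V\<close> unfolding V_def by force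
        then have "norm (poly P u) = \<eta>" using circ[of u] 1 by linarith
        then show "norm (F u) \<le> 4 * \<xi> + 48 * real n * B * \<eta>" using 1 r(1) by (intro Fedge) auto
      qed
    qed
    have nB: "1 \<le> real n * B" using mult_mono[of 1 "real n" 1 B] n B1 by auto
    have nB': "B \<le> real n * B" using mult_right_mono[of 1 "real n" B] n B1 by auto
    have bound: "norm (F z) \<le> 52 * real n * B" if z: "norm z < 1 / 2" for z
    proof -
      have *: "48 * real n * B * \<eta> \<le> 24 * real n * B"
        using mult_left_mono[OF \<eta>h, of "48 * real n * B"] B1 by simp
      show ?thesis
      proof (cases "\<eta> \<le> norm (poly P z)")
        case True
        then have "norm (F z) \<le> 4 * p z + 48 * real n * B * \<eta>" "p z \<le> B" using z by (auto intro!: Fbig pB)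
        then show ?thesis using * nB' B1 by linarith
      next
        case False
        then have "norm (F z) \<le> 4 * \<xi> + 48 * real n * B * \<eta>" using z r(1) by (intro Fsmall) auto
        then show ?thesis using \<xi> * nB by linarith
      qed
    qed
    have approx: "norm (F (of_real x) - f x) \<le> 55 * real n * B * \<xi>" if x: "\<bar>x\<bar> < 1 / 2" for x
    proof (cases "\<eta> \<le> norm (poly P (of_real x))")
      case True
      define z where "z = complex_of_real x"
      have z: "norm z \<le> 1" "\<eta> \<le> norm (poly P z)" and x1: "\<bar>x\<bar> \<le> 1" using x True by (auto simp: z_def)
      have P0: "poly P z \<noteq> 0" and Pm: "poly P z - \<mu> \<noteq> 0" using z(2) half[OF z(2)] \<eta> by auto
      have "norm (f x) \<le> 2 * p z"
        using p z \<epsilon>2 \<eta>2 \<eta> by (intro fsmall[OF x1]) (auto simp: z_def)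
      then have fx: "norm (f x) \<le> 2 * B" using pB[OF z(1)] by simp
      have "norm (f x * poly P z - poly Q z) = norm (f x * (poly P z - f x ^ j) + (f x ^ (j + 1) - poly Q z))"
        by (simp add: algebra_simps)
      also have "\<dots> \<le> norm (f x) * norm (poly P z - f x ^ j) + norm (f x ^ (j + 1) - poly Q z)"
        by (rule order_trans[OF norm_triangle_ineq]) (simp add: norm_mult)
      also have "\<dots> \<le> 2 * B * \<epsilon> + \<epsilon>"
        using f[OF x1] fx B1 unfolding z_def by (intro add_mono mult_mono) (auto simp: norm_minus_commute)
      also have "\<dots> \<le> 3 * B * \<epsilon>" using mult_right_mono[OF B1 \<epsilon>0] by simp
      also have "\<dots> \<le> 3 * B * \<eta>\<^sup>2" using \<epsilon>2 B1 by (intro mult_left_mono) auto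
      finally have 1: "norm (f x * poly P z - poly Q z) \<le> 3 * B * \<eta>\<^sup>2" .
      have "norm (f x - poly Q z / poly P z) = norm (f x * poly P z - poly Q z) / norm (poly P z)"
        using P0 by (simp add: diff_divide_eq_iff flip: norm_divide)
      also have "\<dots> \<le> 3 * B * \<eta>\<^sup>2 / \<eta>" using 1 z(2) \<eta> B1 by (intro frac_le) auto
      also have "\<dots> = 3 * B * \<eta>" using \<eta> by (simp add: power2_eq_square)
      finally have a: "norm (f x - poly Q z / poly P z) \<le> 3 * B * \<eta>" .
      have "poly Q z / (poly P z - \<mu>) - poly Q z / poly P z = poly Q z / (poly P z - \<mu>) * (\<mu> / poly P z)"
        using P0 Pm by (simp add: field_simps)
      then have "norm (poly Q z / (poly P z - \<mu>) - poly Q z / poly P z)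
          = norm (poly Q z / (poly P z - \<mu>)) * (norm \<mu> / norm (poly P z))"
        by (simp add: norm_mult norm_divide)
      also have "\<dots> \<le> (4 * B) * (\<eta>\<^sup>2 / \<eta>)"
        using QP[OF z] pB[OF z(1)] \<mu>\<eta> z(2) \<eta> B1 by (intro mult_mono frac_le) auto
      also have "\<dots> = 4 * B * \<eta>" using \<eta> by (simp add: power2_eq_square)
      finally have b: "norm (poly Q z / (poly P z - \<mu>) - poly Q z / poly P z) \<le> 4 * B * \<eta>" .
      \<comment> \<open>\<open>55 = 48 + 4 + 3\<close>: principal parts, replacement of
        \<open>P - \<mu>\<close> by \<open>P\<close>, replacement of \<open>Q / P\<close> by
        \<open>f\<close>.\<close>
      have "norm (F z - f x) = norm ((F z - poly Q z / (poly P z - \<mu>)) +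
          (poly Q z / (poly P z - \<mu>) - poly Q z / poly P z) - (f x - poly Q z / poly P z))" by simp
      also have "\<dots> \<le> 48 * real n * B * \<eta> + 4 * B * \<eta> + 3 * B * \<eta>"
        by (rule order_trans[OF norm_triangle_ineq4] add_mono order_trans[OF norm_triangle_ineq] FQ z a b)+
      also have "\<dots> \<le> 55 * real n * B * \<eta>"
        using mult_right_mono[OF nB', of \<eta>] \<eta> by linarith
      also have "\<dots> \<le> 55 * real n * B * \<xi>" using \<eta>\<xi> B1 by (intro mult_left_mono) auto
      finally show ?thesis by (simp add: z_def)
    next
      case False
      then have P: "norm (poly P (of_real x)) \<le> \<eta>" by simp
      have "norm (f x) \<le> 2 * \<xi>"
      proof (rule fsmall)
        show "\<epsilon> \<le> \<xi> ^ j" using \<epsilon>2 \<eta>2 \<eta> unfolding \<eta>_def by linarith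
      qed (use x P \<xi> in \<open>auto simp: \<eta>_def\<close>)
      moreover have "norm (F (of_real x)) \<le> 4 * \<xi> + 48 * real n * B * \<eta>"
        using x r(1) P by (intro Fsmall) auto
      moreover have "48 * real n * B * \<eta> \<le> 48 * real n * B * \<xi>" using \<eta>\<xi> B1 by (intro mult_left_mono) auto
      ultimately have "norm (F (of_real x) - f x) \<le> 6 * \<xi> + 48 * real n * B * \<xi>"
        using norm_triangle_ineq4[of "F (of_real x)" "f x"] by linarith
      also have "\<dots> \<le> 55 * real n * B * \<xi>"
        using mult_right_mono[OF nB, of \<xi>] \<xi> by linarith
      finally show ?thesis .
    qed
    have "55 * real n * B * \<xi> \<le> 55 * 72 ^ n * real n * B * \<xi>"
    proof -
      have "55 * real n * B * \<xi> * 1 \<le> 55 * real n * B * \<xi> * 72 ^ n"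
        using one B1 \<xi> by (intro mult_left_mono) auto
      then show ?thesis by (simp add: mult_ac)
    qed
    moreover have "F holomorphic_on ball 0 (1 / 2)" using F by (rule holomorphic_on_subset) auto
    ultimately show ?thesis using bound approx by (intro exI[of _ F]) force
  qed
qed

text \<open>The degree \<open>N\<close> of the result is independent of the order \<open>n\<close>
  of the Taylor data: \<open>F\<close> is holomorphic on a fixed disc, so on an interval of small
  length \<open>\<sigma>\<close> a short section of its power series suffices. The base 4 is the
  inverse radius in Cauchy's estimate, and \<open>104 = 2 * 52\<close> contains the geometric
  tail.\<close>

lemma polynomial_root_approx:
  fixes P Q :: "complex poly" and f :: "real \<Rightarrow> complex"
  assumes j: "j \<ge> 1" and n: "n \<ge> 1" and deg: "degree P \<le> n" and B1: "B \<ge> 1"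
    and PB: "\<And>z. norm z \<le> 1 \<Longrightarrow> norm (poly P z) \<le> B"
    and P'B: "\<And>z. norm z \<le> 1 \<Longrightarrow> norm (poly (pderiv P) z) \<le> B"
    and res: "\<And>z. norm z \<le> 1 \<Longrightarrow> norm (poly P z ^ (j + 1) - poly Q z ^ j) \<le> \<epsilon>"
    and f: "\<And>x. \<bar>x\<bar> \<le> 1 \<Longrightarrow> norm (f x ^ j - poly P (of_real x)) \<le> \<epsilon>"
      "\<And>x. \<bar>x\<bar> \<le> 1 \<Longrightarrow> norm (f x ^ (j + 1) - poly Q (of_real x)) \<le> \<epsilon>"
    and \<xi>: "0 < \<xi>" "\<xi> \<le> 1 / 2" and \<epsilon>: "\<epsilon> \<le> \<xi> ^ (2 * j\<^sup>2 * (j + 1))"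
    and \<sigma>: "0 < \<sigma>" "\<sigma> \<le> 1 / 8"
  shows "\<exists>T. degree T \<le> N \<and> (\<forall>x. \<bar>x\<bar> \<le> \<sigma> \<longrightarrow>
    norm (f x - poly T (of_real x)) \<le> real n * B * (55 * 72 ^ n * \<xi> + 104 * (4 * \<sigma>) ^ (N + 1)))"
proof -
  obtain F where F: "F holomorphic_on ball 0 (1 / 2)"
    and FB: "\<And>z. norm z < 1 / 2 \<Longrightarrow> norm (F z) \<le> 52 * real n * B"
    and Ff: "\<And>x. \<bar>x\<bar> < 1 / 2 \<Longrightarrow> norm (F (of_real x) - f x) \<le> 55 * 72 ^ n * real n * B * \<xi>"
    using holomorphic_root_approx[OF assms(1-12)] by blast
  define a where "a = (\<lambda>k. (deriv ^^ k) F 0 / fact k)"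
  define M where "M = 52 * real n * B"
  have M0: "M \<ge> 0" using B1 by (simp add: M_def)
  have aM: "norm (a k) \<le> M * 4 ^ k" for k
  proof -
    have "norm ((deriv ^^ k) F 0) \<le> fact k * M / (1 / 4) ^ k"
    proof (rule Cauchy_inequality)
      show "F holomorphic_on ball 0 (1 / 4)" using F by (rule holomorphic_on_subset) auto
      show "continuous_on (cball 0 (1 / 4)) F"
        by (rule continuous_on_subset[OF holomorphic_on_imp_continuous_on[OF F]]) auto
    qed (auto simp: M_def intro!: FB)
    then show ?thesis by (simp add: a_def norm_divide divide_simps power_one_over mult_ac)
  qed
  define T where "T = (\<Sum>k\<le>N. monom (a k) k)"
  have "degree T \<le> N" unfolding T_def
    by (intro degree_sum_le) (auto intro: order_trans[OF degree_monom_le])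
  moreover have "norm (f x - poly T (of_real x)) \<le> real n * B * (55 * 72 ^ n * \<xi> + 104 * (4 * \<sigma>) ^ (N + 1))"
    if x: "\<bar>x\<bar> \<le> \<sigma>" for x
  proof -
    have sums: "(\<lambda>k. a k * of_real x ^ k) sums F (of_real x)"
      using holomorphic_power_series[OF F, of "of_real x"] x \<sigma> by (simp add: a_def)
    have T: "poly T (of_real x) = (\<Sum>k<N + 1. a k * of_real x ^ k)"
      unfolding T_def by (simp add: poly_sum poly_monom lessThan_Suc_atMost)
    have "(\<lambda>k. a (k + (N + 1)) * of_real x ^ (k + (N + 1))) sums (F (of_real x) - poly T (of_real x))"
      unfolding T by (rule sums_split_initial_segment[OF sums])
    moreover have "(\<lambda>k. M * (4 * \<sigma>) ^ (N + 1) * (4 * \<sigma>) ^ k) sums (M * (4 * \<sigma>) ^ (N + 1) * (1 / (1 - 4 * \<sigma>)))"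
      using \<sigma> by (intro sums_mult geometric_sums) auto
    moreover have "norm (a (k + (N + 1)) * of_real x ^ (k + (N + 1))) \<le> M * (4 * \<sigma>) ^ (N + 1) * (4 * \<sigma>) ^ k" for k
    proof -
      have "norm (a (k + (N + 1)) * of_real x ^ (k + (N + 1))) \<le> (M * 4 ^ (k + (N + 1))) * \<sigma> ^ (k + (N + 1))"
        unfolding norm_mult norm_power norm_of_real
        using M0 x by (intro mult_mono power_mono aM) auto
      also have "\<dots> = M * (4 * \<sigma>) ^ (N + 1) * (4 * \<sigma>) ^ k"
        by (simp add: power_mult_distrib power_add mult_ac)
      finally show ?thesis .
    qed
    ultimately have "norm (F (of_real x) - poly T (of_real x)) \<le> M * (4 * \<sigma>) ^ (N + 1) * (1 / (1 - 4 * \<sigma>))"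
      by (rule norm_sums_le)
    also have "\<dots> \<le> M * (4 * \<sigma>) ^ (N + 1) * 2"
      using \<sigma> M0 by (intro mult_left_mono) (auto simp: divide_simps)
    finally have "norm (F (of_real x) - poly T (of_real x)) \<le> 104 * real n * B * (4 * \<sigma>) ^ (N + 1)"
      by (simp add: M_def)
    moreover have "norm (F (of_real x) - f x) \<le> 55 * 72 ^ n * real n * B * \<xi>"
      using x \<sigma> by (intro Ff) auto
    ultimately have "norm ((F (of_real x) - poly T (of_real x)) - (F (of_real x) - f x))
        \<le> 104 * real n * B * (4 * \<sigma>) ^ (N + 1) + 55 * 72 ^ n * real n * B * \<xi>"
      by (rule order_trans[OF norm_triangle_ineq4 add_mono])
    then show ?thesis by (simp add: algebra_simps)
  qed
  ultimately show ?thesis by blast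
qed

section \<open>Residual of the Taylor polynomials and choice of the constants\<close>

lemma monom_dvd_poly:
  fixes p :: "complex poly"
  assumes r: "r > 0" and le: "\<And>x::real. 0 < x \<Longrightarrow> x \<le> r \<Longrightarrow> norm (poly p (of_real x)) \<le> K * x ^ n"
  shows "monom 1 n dvd p"
proof (cases "p = 0")
  case False
  define i where "i = order 0 p"
  obtain q where q: "p = [:- 0, 1:] ^ i * q" "\<not> [:- 0, 1:] dvd q"
    using order_decomp[OF False, of 0] unfolding i_def by blast
  have q0: "poly q 0 \<noteq> 0" using q(2) by (simp add: poly_eq_0_iff_dvd)
  have "n \<le> i"
  proof (rule ccontr)
    assume "\<not> n \<le> i"
    then have ni: "n = Suc (n - i - 1) + i" by simp
    have bd: "norm (poly q (of_real x)) \<le> \<bar>K\<bar> * x" if x: "0 < x" "x \<le> min r 1" for x :: real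
    proof -
      have "x ^ i * norm (poly q (of_real x)) \<le> K * x ^ n"
        using le[of x] x by (simp add: q(1) norm_mult norm_power)
      also have "\<dots> = x ^ i * (K * (x ^ (n - i - 1) * x))" by (subst ni) (simp add: power_add mult_ac)
      finally have "norm (poly q (of_real x)) \<le> K * (x ^ (n - i - 1) * x)" using x by simp
      also have "\<dots> \<le> \<bar>K\<bar> * (1 * x)" using x by (intro mult_mono power_le_one) auto
      finally show ?thesis by simp
    qed
    have "((\<lambda>x::real. norm (poly q (of_real x))) \<longlongrightarrow> norm (poly q (of_real 0))) (at_right 0)"
      by (intro tendsto_intros)
    moreover have "((\<lambda>x. \<bar>K\<bar> * x) \<longlongrightarrow> \<bar>K\<bar> * 0) (at_right 0)" by (intro tendsto_intros)
    moreover have "eventually (\<lambda>x::real. norm (poly q (of_real x)) \<le> \<bar>K\<bar> * x) (at_right 0)"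
      using bd r by (intro eventually_at_right_real[of 0 "min r 1", THEN eventually_mono]) auto
    ultimately have "norm (poly q (of_real 0)) \<le> \<bar>K\<bar> * 0"
      by (intro tendsto_le[of "at_right (0::real)"]) auto
    then show False using q0 by simp
  qed
  then have "monom 1 n dvd [:0, 1::complex:] ^ i"
    by (simp add: monom_altdef le_imp_power_dvd)
  then show ?thesis by (subst q(1)) simp
qed simp

lemma norm_power_diff_le:
  fixes a b :: complex
  assumes "M \<ge> 1" "norm a \<le> M" "norm b \<le> M"
  shows "norm (a ^ k - b ^ k) \<le> real k * M ^ k * norm (a - b)"
proof -
  have M: "complex_of_real M \<noteq> 0" using assms by auto
  have "norm ((a / of_real M) ^ k - (b / of_real M) ^ k) \<le> real k * norm (a / of_real M - b / of_real M)"
    using assms by (intro norm_power_diff) (auto simp: norm_divide)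
  also have "(a / of_real M) ^ k - (b / of_real M) ^ k = (a ^ k - b ^ k) / of_real M ^ k"
    by (simp add: power_divide diff_divide_distrib)
  also have "a / of_real M - b / of_real M = (a - b) / of_real M" by (simp add: diff_divide_distrib)
  finally have "norm (a ^ k - b ^ k) / M ^ k \<le> real k * (norm (a - b) / M)"
    using assms by (simp add: norm_divide norm_power)
  also have "\<dots> \<le> real k * norm (a - b)"
    using assms by (intro mult_left_mono) (auto simp: divide_le_eq mult_left_mono[of 1 M "norm (a-b)", simplified])
  finally show ?thesis using assms by (simp add: divide_le_eq mult_ac)
qed

text \<open>If two polynomials are Taylor polynomials of order \<open>n\<close> of \<open>\<phi>\<^sup>j\<close> and \<open>\<phi>\<^sup>j\<^sup>+\<^sup>1\<close>, then \<open>P\<^sup>j\<^sup>+\<^sup>1 - Q\<^sup>j\<close> is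
  divisible by \<open>z\<^sup>n\<close>, so that the maximum principle on the disc of radius \<open>1 / y\<close> gains a factor \<open>y\<^sup>n\<close>.\<close>

lemma taylor_residual_bound:
  fixes P Q :: "complex poly" and \<phi> :: "real \<Rightarrow> complex"
  assumes y: "0 < y" "y \<le> 1" and L: "L \<ge> 1"
    and PL: "\<And>z. norm z \<le> 1 / y \<Longrightarrow> norm (poly P z) \<le> L"
    and QL: "\<And>z. norm z \<le> 1 / y \<Longrightarrow> norm (poly Q z) \<le> L"
    and f: "\<And>x. \<bar>x\<bar> \<le> 1 \<Longrightarrow> norm (\<phi> x ^ j - poly P (of_real x)) \<le> K * \<bar>x\<bar> ^ n"
      "\<And>x. \<bar>x\<bar> \<le> 1 \<Longrightarrow> norm (\<phi> x ^ (j + 1) - poly Q (of_real x)) \<le> K * \<bar>x\<bar> ^ n"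
    and z: "norm z \<le> 1"
  shows "norm (poly P z ^ (j + 1) - poly Q z ^ j) \<le> 2 * L ^ (j + 1) * y ^ n"
proof -
  define D where "D = P ^ (j + 1) - Q ^ j"
  have D: "poly D z = poly P z ^ (j + 1) - poly Q z ^ j" for z by (simp add: D_def)
  have K0: "K \<ge> 0" using order_trans[OF norm_ge_zero f(1)[of 1]] by simp
  define M where "M = L + K"
  have M: "M \<ge> 1" using L K0 by (simp add: M_def)
  have y1: "1 \<le> 1 / y" using y by simp
  \<comment> \<open>Both \<open>(\<phi>^j)^(j+1)\<close> and \<open>(\<phi>^(j+1))^j\<close> are the
    same function, so they cancel in the residual and only Taylor remainders are left. The constant
    \<open>K\<close> enters here alone, for divisibility, and is absent from the final
    bound.\<close>
  have "monom 1 n dvd D"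
  proof (rule monom_dvd_poly[OF zero_less_one])
    fix x :: real assume x01: "0 < x" "x \<le> 1"
    then have x: "\<bar>x\<bar> \<le> 1" by simp
    have xn: "K * \<bar>x\<bar> ^ n \<le> K" using x K0 by (intro mult_left_le power_le_one) auto
    have P: "norm (poly P (of_real x)) \<le> L" and Q: "norm (poly Q (of_real x)) \<le> L"
      using x y1 by (auto intro!: PL QL)
    have g: "norm (\<phi> x ^ j) \<le> M" "norm (\<phi> x ^ (j + 1)) \<le> M"
      using norm_triangle_ineq2[of "\<phi> x ^ j" "poly P (of_real x)"] f(1)[OF x] P
        norm_triangle_ineq2[of "\<phi> x ^ (j + 1)" "poly Q (of_real x)"] f(2)[OF x] Q xn
      unfolding M_def by linarith+
    have LM: "L \<le> M" using K0 by (simp add: M_def)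
    have "poly D (of_real x) = (poly P (of_real x) ^ (j + 1) - (\<phi> x ^ j) ^ (j + 1))
        + ((\<phi> x ^ (j + 1)) ^ j - poly Q (of_real x) ^ j)"
      unfolding D power_mult[symmetric] by (simp add: mult.commute)
    also have "norm \<dots> \<le> norm (poly P (of_real x) ^ (j + 1) - (\<phi> x ^ j) ^ (j + 1))
        + norm ((\<phi> x ^ (j + 1)) ^ j - poly Q (of_real x) ^ j)" by (rule norm_triangle_ineq)
    also have "\<dots> \<le> real (j + 1) * M ^ (j + 1) * norm (poly P (of_real x) - \<phi> x ^ j)
        + real j * M ^ j * norm (\<phi> x ^ (j + 1) - poly Q (of_real x))"
      using P Q g LM by (intro add_mono norm_power_diff_le M) auto
    also have "\<dots> \<le> real (j + 1) * M ^ (j + 1) * (K * \<bar>x\<bar> ^ n) + real j * M ^ j * (K * \<bar>x\<bar> ^ n)"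
      using f[OF x] M by (intro add_mono mult_left_mono) (auto simp: norm_minus_commute)
    finally show "norm (poly D (of_real x)) \<le> (real (j + 1) * M ^ (j + 1) * K + real j * M ^ j * K) * x ^ n"
      using x01 by (simp add: algebra_simps)
  qed
  then obtain E where E: "D = monom 1 n * E" by (auto elim: dvdE)
  have DE: "poly D z = z ^ n * poly E z" for z by (simp add: E poly_monom)
  have DL: "norm (poly D z) \<le> 2 * L ^ (j + 1)" if z: "norm z \<le> 1 / y" for z
  proof -
    have "norm (poly D z) \<le> norm (poly P z) ^ (j + 1) + norm (poly Q z) ^ j"
      unfolding D by (rule order_trans[OF norm_triangle_ineq4]) (simp only: norm_power order_refl)
    also have "\<dots> \<le> L ^ (j + 1) + L ^ j" using PL[OF z] QL[OF z] by (intro add_mono power_mono) auto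
    also have "L ^ j \<le> L ^ (j + 1)" using L by (intro power_increasing) auto
    finally show ?thesis by simp
  qed
  have "norm (poly E z) \<le> 2 * L ^ (j + 1) * y ^ n"
  proof (rule maximum_modulus_frontier[of "poly E" "cball 0 (1 / y)"])
    show "poly E holomorphic_on interior (cball 0 (1 / y))" by (intro holomorphic_intros)
    show "continuous_on (closure (cball 0 (1 / y))) (poly E)" by (intro continuous_intros)
    fix u :: complex assume "u \<in> frontier (cball 0 (1 / y))"
    then have u: "norm u = 1 / y" using y by (simp add: frontier_cball)
    have "(1 / y) ^ n * norm (poly E u) \<le> 2 * L ^ (j + 1)"
      using DL[of u] u y by (simp add: DE norm_mult norm_power)
    then show "norm (poly E u) \<le> 2 * L ^ (j + 1) * y ^ n"
      using y by (simp add: power_divide field_simps)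
  qed (use z y1 in auto)
  moreover have "norm (z ^ n) \<le> 1" using z by (simp add: norm_power power_le_one)
  ultimately have "norm (z ^ n) * norm (poly E z) \<le> 1 * (2 * L ^ (j + 1) * y ^ n)"
    by (intro mult_mono) auto
  then show ?thesis unfolding D[symmetric] DE by (simp only: norm_mult mult_1)
qed

text \<open>The \<open>m\<close>-th root of the residual is the final accuracy. The factor \<open>\<kappa>\<^sup>n\<close> gained from the residual pays,
  after taking this root, for the loss \<open>72\<^sup>n\<close> in the minimum modulus estimate; \<open>\<theta>\<close> keeps the size
  \<open>exp(\<theta> \<nu>)\<close> of the polynomials negligible, and \<open>\<sigma>\<close> allows for a degree which is a small multiple
  of \<open>\<nu>\<close>, so that passing to coefficients costs little.\<close>

lemma line_polynomial_approx:
  fixes g h :: "nat \<Rightarrow> complex" and \<phi> :: "real \<Rightarrow> complex"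
  assumes j: "j \<ge> 1" and m: "m = 2 * j\<^sup>2 * (j + 1)" and b: "b = 1 / (8 * real m)"
    and \<theta>: "\<theta> = b / 2" and \<kappa>: "\<kappa> = (1 / 288) ^ m" and \<sigma>: "\<sigma> = exp (- (24 / b)) / 4"
    and n: "n \<ge> 1" "real n * ln 2 \<le> \<nu>" and s: "s > 0" and A: "A \<ge> 1"
    and r: "r = \<kappa> * \<theta> * \<nu> / s"
    and C1: "C1 = 2 * A ^ (j + 1)" "C1 * exp (- (2 * b * \<nu>)) \<le> 1 / 2"
    and g: "\<And>k. k < n \<Longrightarrow> norm (g k) \<le> A * (s ^ k * exp (- (real k / real n) * (\<nu> / 2))) / fact k"
    and h: "\<And>k. k < n \<Longrightarrow> norm (h k) \<le> A * (s ^ k * exp (- (real k / real n) * (\<nu> / 2))) / fact k"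
    and \<phi>g: "\<And>t. \<bar>t\<bar> \<le> r \<Longrightarrow>
      norm (\<phi> t ^ j - (\<Sum>k<n. g k * of_real t ^ k)) \<le> A * (s ^ n * exp (- (\<nu> / 2))) * \<bar>t\<bar> ^ n / fact n"
    and \<phi>h: "\<And>t. \<bar>t\<bar> \<le> r \<Longrightarrow>
      norm (\<phi> t ^ (j + 1) - (\<Sum>k<n. h k * of_real t ^ k)) \<le> A * (s ^ n * exp (- (\<nu> / 2))) * \<bar>t\<bar> ^ n / fact n"
  shows "\<exists>T. degree T \<le> nat \<lfloor>b / 8 * \<nu>\<rfloor> \<and>
    (\<forall>t. \<bar>t\<bar> \<le> \<sigma> * r \<longrightarrow> norm (\<phi> t - poly T (of_real t)) \<le> 159 * A * C1 * exp (- (b * \<nu>)))"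
proof -
  have "j\<^sup>2 \<ge> 1" using j by simp
  then have mj: "m \<ge> 2 * (j + 1)" unfolding m by (intro mult_le_mono1) simp
  then have "m \<ge> 4" using j by simp
  then have m4: "real m \<ge> 4" by simp
  have b0: "0 < b" "b \<le> 1 / 32" and bm: "2 * b * real m = 1 / 4" using m4 by (auto simp: b divide_simps)
  have \<theta>0: "0 < \<theta>" "\<theta> \<le> b" using b0 by (auto simp: \<theta>)
  have j\<theta>: "real (j + 1) * \<theta> \<le> 1 / 4"
  proof -
    have "real (j + 1) * \<theta> \<le> real m * b" using mj \<theta>0 b0 by (intro mult_mono) auto
    also have "real m * b = 1 / 8" using bm by (simp add: mult.commute)
    finally show ?thesis by simp
  qed
  have ln2: "ln (2::real) > 0" by simp
  have \<nu>: "\<nu> > 0" using n ln2 by (smt (verit) mult_pos_pos of_nat_0_less_iff not_less_eq_eq One_nat_def less_eq_Suc_le)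
  have \<kappa>0: "0 < \<kappa>" by (simp add: \<kappa>)
  have \<kappa>1: "\<kappa> \<le> 1 / 288"
  proof -
    have "(1 / 288 :: real) ^ m \<le> (1 / 288) ^ 1" using m4 by (intro power_decreasing) auto
    then show ?thesis by (simp add: \<kappa>)
  qed
  have r0: "r > 0" using \<kappa>0 \<theta>0 \<nu> s by (simp add: r)
  define E where "E = exp (- (\<nu> / (2 * real n)))"
  have E: "0 < E" "E \<le> 1" using \<nu> by (auto simp: E_def)
  have Ek: "exp (- (real k / real n) * (\<nu> / 2)) = E ^ k" for k
    by (simp add: E_def field_simps flip: exp_of_nat_mult)
  have En: "exp (- (\<nu> / 2)) = E ^ n" using Ek[of n] n by simp
  \<comment> \<open>In the variable \<open>z = t / r\<close> the choice of \<open>r\<close> bounds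
    the \<open>k\<close>-th Taylor term by
    \<open>A * (\<theta> * \<nu> * y * norm z)^k / k!\<close>, see \<open>key\<close>. Hence the
    polynomials are at most \<open>L = A * exp (\<theta> * \<nu>)\<close> on the large disc of
    radius \<open>1 / y\<close>, while the gain in the residual is
    \<open>y ^ n = \<kappa> ^ n * exp (- (\<nu> / 2))\<close>.\<close>
  define y where "y = \<kappa> * E"
  have y: "0 < y" "y \<le> 1 / 288"
    using \<kappa>0 \<kappa>1 E mult_mono[of \<kappa> "1/288" E 1] by (auto simp: y_def)
  have y2: "2 \<le> 1 / y" using y by (simp add: field_simps)
  have key: "s ^ k * E ^ k * r ^ k = (\<theta> * \<nu>) ^ k * y ^ k" for k
    using s by (simp add: r y_def field_simps flip: power_mult_distrib)
  have C1A: "1 \<le> C1" "A \<le> C1"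
    using self_le_power[OF A, of "j + 1"] one_le_power[OF A, of "j + 1"] A unfolding C1(1) by linarith+
  define L where "L = A * exp (\<theta> * \<nu>)"
  have L1: "L \<ge> 1" unfolding L_def using A \<theta>0 \<nu> mult_mono[of 1 A 1 "exp (\<theta> * \<nu>)"] by simp
  define pol where "pol = (\<lambda>c. \<Sum>k<n. monom (c k * complex_of_real r ^ k) k)"
  have pol_deg: "degree (pol c) \<le> n" for c
    unfolding pol_def by (intro degree_sum_le) (auto intro: order_trans[OF degree_monom_le])
  have pol: "poly (pol c) z = (\<Sum>k<n. c k * (of_real r * z) ^ k)" for c z
    unfolding pol_def by (simp add: poly_sum poly_monom power_mult_distrib mult_ac)
  have polL: "norm (poly (pol c) z) \<le> L" if z: "norm z \<le> 1 / y"
    and c: "\<And>k. k < n \<Longrightarrow> norm (c k) \<le> A * (s ^ k * exp (- (real k / real n) * (\<nu> / 2))) / fact k" for c z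
  proof -
    have "norm (poly (pol c) z) \<le> (\<Sum>k<n. norm (c k * (of_real r * z) ^ k))" unfolding pol by (rule norm_sum)
    also have "\<dots> \<le> (\<Sum>k<n. A * ((\<theta> * \<nu>) ^ k / fact k))"
    proof (rule sum_mono)
      fix k assume "k \<in> {..<n}"
      then have "norm (c k) \<le> A * (s ^ k * E ^ k) / fact k" using c[of k] unfolding Ek by simp
      then have "norm (c k * (of_real r * z) ^ k) \<le> A * (s ^ k * E ^ k) / fact k * (r * (1 / y)) ^ k"
        unfolding norm_mult norm_power using z r0 s A E
        by (intro mult_mono power_mono) (auto simp: norm_mult intro!: mult_left_mono)
      also have "\<dots> = A * (s ^ k * E ^ k * r ^ k) / fact k / y ^ k"
        by (simp add: power_mult_distrib power_divide)
      also have "\<dots> = A * ((\<theta> * \<nu>) ^ k / fact k)" unfolding key using y by simp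
      finally show "norm (c k * (of_real r * z) ^ k) \<le> A * ((\<theta> * \<nu>) ^ k / fact k)" .
    qed
    also have "\<dots> = A * (\<Sum>k<n. (\<theta> * \<nu>) ^ k / fact k)" by (simp add: sum_distrib_left)
    also have "\<dots> \<le> L" unfolding L_def using A \<theta>0 \<nu> by (intro mult_left_mono exp_sum_bound) auto
    finally show ?thesis .
  qed
  define P where "P = pol g"
  define Q where "Q = pol h"
  have PL: "norm (poly P z) \<le> L" if "norm z \<le> 1 / y" for z unfolding P_def by (rule polL[OF that g])
  have QL: "norm (poly Q z) \<le> L" if "norm z \<le> 1 / y" for z unfolding Q_def by (rule polL[OF that h])
  have P'L: "norm (poly (pderiv P) z) \<le> L" if z: "norm z \<le> 1" for z
  proof -
    have "norm ((deriv ^^ 1) (poly P) z) \<le> fact 1 * L / 1 ^ 1"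
    proof (rule Cauchy_inequality)
      fix x assume "norm (z - x) = 1"
      then have "norm x \<le> 2" using norm_triangle_ineq2[of x z] z by (simp add: norm_minus_commute)
      then show "norm (poly P x) \<le> L" using y2 by (intro PL) simp
    qed (auto intro!: holomorphic_intros continuous_intros)
    then show ?thesis using higher_deriv_poly[of 1 P] by simp
  qed
  define K where "K = A * exp (\<theta> * \<nu>) * y ^ n"
  define \<psi> where "\<psi> = (\<lambda>x. \<phi> (r * x))"
  have K: "norm (w - poly (pol c) (of_real x)) \<le> K * \<bar>x\<bar> ^ n"
    if "\<bar>x\<bar> \<le> 1" and w: "norm (w - (\<Sum>k<n. c k * of_real (r * x) ^ k)) \<le> A * (s ^ n * exp (- (\<nu> / 2))) * \<bar>r * x\<bar> ^ n / fact n"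
    for x w c
  proof -
    have "A * (s ^ n * exp (- (\<nu> / 2))) * \<bar>r * x\<bar> ^ n / fact n = A * (s ^ n * E ^ n * r ^ n) * \<bar>x\<bar> ^ n / fact n"
      unfolding En using r0 by (simp add: abs_mult power_mult_distrib)
    also have "\<dots> = A * ((\<theta> * \<nu>) ^ n / fact n) * y ^ n * \<bar>x\<bar> ^ n" unfolding key by simp
    also have "\<dots> \<le> K * \<bar>x\<bar> ^ n"
      unfolding K_def using A y \<theta>0 \<nu> by (intro mult_right_mono mult_left_mono pow_div_fact_le_exp) auto
    finally show ?thesis using w unfolding pol by simp
  qed
  have rx: "\<bar>r * x\<bar> \<le> r" if "\<bar>x\<bar> \<le> 1" for x using that r0 by (simp add: abs_mult)
  have \<psi>g: "norm (\<psi> x ^ j - poly P (of_real x)) \<le> K * \<bar>x\<bar> ^ n" if "\<bar>x\<bar> \<le> 1" for x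
    unfolding P_def \<psi>_def by (rule K[OF that \<phi>g[OF rx[OF that]]])
  have \<psi>h: "norm (\<psi> x ^ (j + 1) - poly Q (of_real x)) \<le> K * \<bar>x\<bar> ^ n" if "\<bar>x\<bar> \<le> 1" for x
    unfolding Q_def \<psi>_def by (rule K[OF that \<phi>h[OF rx[OF that]]])
  define \<epsilon> where "\<epsilon> = C1 * \<kappa> ^ n * exp (- (\<nu> / 4))"
  have yn: "y ^ n = \<kappa> ^ n * exp (- (\<nu> / 2))" unfolding y_def En by (simp add: power_mult_distrib)
  have res: "norm (poly P z ^ (j + 1) - poly Q z ^ j) \<le> \<epsilon>" if "norm z \<le> 1" for z
  proof -
    have "norm (poly P z ^ (j + 1) - poly Q z ^ j) \<le> 2 * L ^ (j + 1) * y ^ n"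
      using y by (intro taylor_residual_bound[OF _ _ L1 PL QL \<psi>g \<psi>h that]) auto
    also have "2 * L ^ (j + 1) = C1 * exp (real (j + 1) * \<theta> * \<nu>)"
      unfolding L_def C1(1) power_mult_distrib by (simp only: exp_of_nat_mult[symmetric] mult_ac)
    also have "\<dots> \<le> C1 * exp (1 / 4 * \<nu>)"
      using mult_right_mono[OF j\<theta>, of \<nu>] \<nu> C1A by (intro mult_left_mono) auto
    also have "C1 * exp (1 / 4 * \<nu>) * y ^ n = C1 * \<kappa> ^ n * (exp (1 / 4 * \<nu>) * exp (- (\<nu> / 2)))"
      unfolding yn by (simp only: mult_ac)
    also have "exp (1 / 4 * \<nu>) * exp (- (\<nu> / 2)) = exp (- (\<nu> / 4))" unfolding mult_exp_exp by simp
    finally show ?thesis using y by (simp add: \<epsilon>_def mult_right_mono)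
  qed
  have K\<epsilon>: "K * \<bar>x\<bar> ^ n \<le> \<epsilon>" if "\<bar>x\<bar> \<le> 1" for x
  proof -
    have "K * \<bar>x\<bar> ^ n \<le> K * 1" using that A y by (intro mult_left_mono power_le_one) (auto simp: K_def)
    also have "K * 1 = A * \<kappa> ^ n * (exp (\<theta> * \<nu>) * exp (- (\<nu> / 2)))"
      unfolding K_def yn by (simp only: mult_ac mult_1_right)
    also have "\<dots> \<le> C1 * \<kappa> ^ n * exp (- (\<nu> / 4))"
    proof (intro mult_mono)
      have "\<theta> * \<nu> \<le> 1 / 4 * \<nu>" using \<theta>0 b0 \<nu> by (intro mult_right_mono) auto
      then show "exp (\<theta> * \<nu>) * exp (- (\<nu> / 2)) \<le> exp (- (\<nu> / 4))" unfolding mult_exp_exp by simp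
    qed (use C1A A \<kappa>0 in auto)
    finally show ?thesis by (simp add: \<epsilon>_def)
  qed
  \<comment> \<open>Tuned so that its \<open>m\<close>-th power dominates \<open>\<epsilon>\<close>:
    \<open>2 * b * m = 1 / 4\<close>, and \<open>\<kappa>\<close> is the \<open>m\<close>-th power
    of \<open>1 / 288\<close>. Here \<open>288 = 72 * 4\<close>, and the surplus
    \<open>4 ^ n\<close> absorbs the factor \<open>n\<close>.\<close>
  define \<xi> where "\<xi> = C1 * (1 / 288) ^ n * exp (- (2 * b * \<nu>))"
  have \<xi>1: "\<xi> \<le> C1 * 1 * exp (- (2 * b * \<nu>))"
    unfolding \<xi>_def using C1A by (intro mult_right_mono mult_left_mono power_le_one) auto
  have \<xi>: "0 < \<xi>" "\<xi> \<le> 1 / 2" using \<xi>1 C1(2) C1A by (simp add: \<xi>_def) (use \<xi>1 C1(2) in linarith)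
  have \<epsilon>\<xi>: "\<epsilon> \<le> \<xi> ^ (2 * j\<^sup>2 * (j + 1))"
  proof -
    have "exp (- (2 * b * \<nu>)) ^ m = exp (- (2 * b * real m * \<nu>))" by (simp add: mult_ac flip: exp_of_nat_mult)
    then have e: "exp (- (2 * b * \<nu>)) ^ m = exp (- (\<nu> / 4))" unfolding bm by simp
    have k: "((1 / 288) ^ n) ^ m = \<kappa> ^ n" unfolding \<kappa> by (simp only: power_mult[symmetric] mult.commute)
    have "\<epsilon> = C1 ^ 1 * \<kappa> ^ n * exp (- (\<nu> / 4))" by (simp add: \<epsilon>_def)
    also have "\<dots> \<le> C1 ^ m * \<kappa> ^ n * exp (- (\<nu> / 4))"
      using C1A \<kappa>0 m4 by (intro mult_right_mono power_increasing) auto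
    also have "\<dots> = \<xi> ^ m" unfolding \<xi>_def power_mult_distrib e k ..
    finally show ?thesis unfolding m .
  qed
  have \<sigma>0: "0 < \<sigma>" "\<sigma> \<le> 1 / 8"
  proof -
    have "exp (- (24 / b)) \<le> exp (- 1)" using b0 by (simp add: field_simps)
    also have "exp (- 1 :: real) \<le> 1 / 2"
      using exp_ge_add_one_self[of "1::real"] by (simp add: exp_minus field_simps)
    finally show "\<sigma> \<le> 1 / 8" by (simp add: \<sigma>)
  qed (simp add: \<sigma>)
  define N where "N = nat \<lfloor>b / 8 * \<nu>\<rfloor>"
  obtain T where T: "degree T \<le> N" "\<And>x. \<bar>x\<bar> \<le> \<sigma> \<Longrightarrow>
      norm (\<psi> x - poly T (of_real x)) \<le> real n * L * (55 * 72 ^ n * \<xi> + 104 * (4 * \<sigma>) ^ (N + 1))"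
  proof -
    have "\<exists>T. degree T \<le> N \<and> (\<forall>x. \<bar>x\<bar> \<le> \<sigma> \<longrightarrow>
      norm (\<psi> x - poly T (of_real x)) \<le> real n * L * (55 * 72 ^ n * \<xi> + 104 * (4 * \<sigma>) ^ (N + 1)))"
    proof (rule polynomial_root_approx[OF j n(1) _ L1 _ P'L res _ _ \<xi> \<epsilon>\<xi> \<sigma>0])
      show "degree P \<le> n" unfolding P_def by (rule pol_deg)
      show "norm (poly P z) \<le> L" if "norm z \<le> 1" for z using that y2 by (intro PL) simp
      show "norm (\<psi> x ^ j - poly P (of_real x)) \<le> \<epsilon>" if "\<bar>x\<bar> \<le> 1" for x
        by (rule order_trans[OF \<psi>g[OF that] K\<epsilon>[OF that]])
      show "norm (\<psi> x ^ (j + 1) - poly Q (of_real x)) \<le> \<epsilon>" if "\<bar>x\<bar> \<le> 1" for x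
        by (rule order_trans[OF \<psi>h[OF that] K\<epsilon>[OF that]])
    qed
    then show thesis using that by blast
  qed
  have nn: "real n \<le> 2 ^ n" by (rule order_less_imp_le[OF of_nat_less_two_power])
  have "(2::real) ^ n = exp (real n * ln 2)" by (simp add: exp_of_nat_mult)
  also have "\<dots> \<le> exp \<nu>" using n by simp
  finally have n\<nu>: "real n \<le> exp \<nu>" using nn by linarith
  have "real n * (72 ^ n * (1 / 288) ^ n) \<le> 2 ^ n * (72 ^ n * (1 / 288) ^ n)" using nn by (intro mult_right_mono) auto
  also have "\<dots> = (1 / 2) ^ n" by (simp flip: power_mult_distrib)
  also have "\<dots> \<le> 1" by (intro power_le_one) auto
  finally have n288: "real n * (72 ^ n * (1 / 288) ^ n) \<le> 1" .
  have p1: "real n * L * (55 * 72 ^ n * \<xi>) \<le> 55 * A * C1 * exp (- (b * \<nu>))"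
  proof -
    have "real n * L * (55 * 72 ^ n * \<xi>) = (real n * (72 ^ n * (1 / 288) ^ n)) * (55 * A * C1) * (exp (\<theta> * \<nu>) * exp (- (2 * b * \<nu>)))"
      by (simp only: L_def \<xi>_def mult_ac)
    also have "\<dots> \<le> 1 * (55 * A * C1) * (exp (\<theta> * \<nu>) * exp (- (2 * b * \<nu>)))"
      using A C1A n288 by (intro mult_right_mono) auto
    also have "\<dots> \<le> 1 * (55 * A * C1) * exp (- (b * \<nu>))"
      unfolding mult_exp_exp using A C1A mult_right_mono[OF \<theta>0(2), of \<nu>] \<nu> by (intro mult_left_mono) auto
    finally show ?thesis by simp
  qed
  \<comment> \<open>The 24 in \<open>\<sigma>\<close> is \<open>3 * 8\<close>: as
    \<open>N + 1\<close> is at least \<open>b / 8 * \<nu>\<close>, the power is at most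
    \<open>exp (- (3 * \<nu>))\<close>. One \<open>\<nu>\<close> pays for the factor
    \<open>n\<close>, one for \<open>exp (\<theta> * \<nu>)\<close>, and the last gives the
    decay.\<close>
  have p2: "real n * L * (104 * (4 * \<sigma>) ^ (N + 1)) \<le> 104 * A * C1 * exp (- (b * \<nu>))"
  proof -
    have "b / 8 * \<nu> \<le> real (N + 1)" unfolding N_def by linarith
    then have "24 / b * (b / 8 * \<nu>) \<le> 24 / b * real (N + 1)" using b0 by (intro mult_left_mono) auto
    then have "3 * \<nu> \<le> 24 / b * real (N + 1)" using b0 by simp
    moreover have "(4 * \<sigma>) ^ (N + 1) = exp (- (24 / b * real (N + 1)))"
    proof -
      have "4 * \<sigma> = exp (- (24 / b))" by (simp add: \<sigma>)
      then have "(4 * \<sigma>) ^ (N + 1) = exp (real (N + 1) * (- (24 / b)))" by (simp only: exp_of_nat_mult)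
      then show ?thesis by (simp only: mult_minus_right mult.commute[of "real (N + 1)"])
    qed
    ultimately have s3: "(4 * \<sigma>) ^ (N + 1) \<le> exp (- (3 * \<nu>))" by simp
    have "real n * L * (104 * (4 * \<sigma>) ^ (N + 1)) \<le> exp \<nu> * (A * exp (\<theta> * \<nu>)) * (104 * exp (- (3 * \<nu>)))"
      unfolding L_def using n\<nu> s3 A \<sigma>0 by (intro mult_mono) auto
    also have "\<dots> = 104 * A * exp (\<theta> * \<nu> - 2 * \<nu>)"
      by (simp add: mult_ac flip: exp_add)
    also have "\<dots> \<le> 104 * (A * C1) * exp (- (b * \<nu>))"
    proof (intro mult_mono)
      have "\<theta> * \<nu> \<le> 1 * \<nu>" "b * \<nu> \<le> 1 * \<nu>" using \<theta>0 b0 \<nu> by (auto intro!: mult_right_mono)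
      then show "exp (\<theta> * \<nu> - 2 * \<nu>) \<le> exp (- (b * \<nu>))" by simp
      show "A \<le> A * C1" using A C1A by simp
    qed (use A C1A in auto)
    finally show ?thesis by simp
  qed
  define T' where "T' = pcompose T [:0, complex_of_real (1 / r):]"
  have "degree T' \<le> N" using T(1) r0 unfolding T'_def by (simp add: degree_pcompose)
  moreover have "norm (\<phi> t - poly T' (of_real t)) \<le> 159 * A * C1 * exp (- (b * \<nu>))" if t: "\<bar>t\<bar> \<le> \<sigma> * r" for t
  proof -
    have "\<bar>t / r\<bar> \<le> \<sigma>" using t r0 by (simp add: divide_le_eq)
    from T(2)[OF this] have "norm (\<phi> t - poly T' (of_real t)) \<le> real n * L * (55 * 72 ^ n * \<xi> + 104 * (4 * \<sigma>) ^ (N + 1))"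
      using r0 by (simp add: \<psi>_def T'_def poly_pcompose)
    also have "\<dots> \<le> 159 * A * C1 * exp (- (b * \<nu>))"
      using p1 p2 by (simp only: distrib_left)
    finally show ?thesis .
  qed
  ultimately show ?thesis unfolding N_def by blast
qed

section \<open>Limits of polynomial approximations\<close>

text \<open>For given \<open>t\<close> take the scale \<open>i\<close> with
  \<open>R (Suc i) / 2 < \<bar>t\<bar> \<le> R i / 2\<close>. The remainder of order
  \<open>p\<close> then consists of three errors: that of \<open>q i\<close> against
  \<open>\<psi>\<close>; the coefficients of \<open>q i\<close> of index at least \<open>p\<close>,
  which come from the coarser scales \<open>l < i\<close>; and the lower coefficients, which still
  lack the finer scales \<open>l \<ge> i\<close>. They contribute 1, 2 and \<open>p\<close> to the
  factor \<open>3 + real p\<close>.\<close>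

lemma peano_expansion:
  fixes \<psi> :: "real \<Rightarrow> complex" and q :: "nat \<Rightarrow> complex poly" and R d :: "nat \<Rightarrow> real"
  assumes q0: "q 0 = 0" and R: "\<And>l. R l > 0" "\<And>l. R (Suc l) \<le> R l" "R \<longlonglongrightarrow> 0"
    and \<psi>: "\<And>l t. \<bar>t\<bar> \<le> R l \<Longrightarrow> norm (\<psi> t - poly (q l) (of_real t)) \<le> d l"
    and coeff: "\<And>l k. norm (coeff (q (Suc l) - q l) k) \<le> d l / R (Suc l) ^ k"
    and sm: "\<And>M. (\<lambda>l. d l / R (Suc l) ^ M) sums S M"
  shows "\<exists>c. (\<forall>k. (\<lambda>l. coeff (q (Suc l) - q l) k) sums c k) \<and>
    (\<forall>p t. \<bar>t\<bar> \<le> R 0 / 2 \<longrightarrow> norm (\<psi> t - (\<Sum>k<p. c k * of_real t ^ k)) \<le> (3 + real p) * 2 ^ p * S p * \<bar>t\<bar> ^ p)"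
proof -
  have Rmono: "R l \<le> R i" if "i \<le> l" for i l
    using R(2) that by (rule lift_Suc_antimono_le)
  have d0: "d l \<ge> 0" for l using order_trans[OF norm_ge_zero \<psi>[of 0 l]] R(1)[of l] by simp
  define a where "a = (\<lambda>l k. coeff (q (Suc l) - q l) k)"
  have a: "norm (a l k) \<le> d l / R (Suc l) ^ k" for l k unfolding a_def by (rule coeff)
  have na: "summable (\<lambda>l. norm (a l k))" for k
    by (rule summable_comparison_test'[OF sums_summable[OF sm[of k]], of 0]) (simp add: a)
  define c where "c = (\<lambda>k. \<Sum>l. a l k)"
  have c: "(\<lambda>l. a l k) sums c k" for k
    unfolding c_def by (rule summable_sums[OF summable_norm_cancel[OF na]])
  have terms: "d l / R (Suc l) ^ M \<ge> 0" for l M using d0 R(1)[of "Suc l"] by simp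
  have Spart: "(\<Sum>l\<in>F. d l / R (Suc l) ^ M) \<le> S M" if "finite F" for F M
    using sum_le_suminf[of "\<lambda>l. d l / R (Suc l) ^ M" F] that terms sm[of M] by (auto simp: sums_iff)
  have S0: "S M \<ge> 0" for M using Spart[of "{}" M] by simp
  have tele: "coeff (q i) k = (\<Sum>l<i. a l k)" for i k
    by (induction i) (simp_all add: q0 a_def)
  have main: "norm (\<psi> t - (\<Sum>k<p. c k * of_real t ^ k)) \<le> (3 + real p) * 2 ^ p * S p * \<bar>t\<bar> ^ p"
    if t: "\<bar>t\<bar> \<le> R 0 / 2" "t \<noteq> 0" for p t
  proof -
    have "\<exists>l. R (Suc l) / 2 < \<bar>t\<bar>"
    proof -
      have "(\<lambda>l. R (Suc l)) \<longlonglongrightarrow> 0" using R(3) by (rule LIMSEQ_Suc)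
      then have "eventually (\<lambda>l. R (Suc l) < 2 * \<bar>t\<bar>) sequentially"
        using t by (intro order_tendstoD) auto
      then obtain l where "R (Suc l) < 2 * \<bar>t\<bar>" by (auto simp: eventually_sequentially)
      then show ?thesis by (intro exI[of _ l]) simp
    qed
    define i where "i = (LEAST l. R (Suc l) / 2 < \<bar>t\<bar>)"
    have i1: "R (Suc i) / 2 < \<bar>t\<bar>" unfolding i_def by (rule LeastI_ex) fact
    have i2: "\<bar>t\<bar> \<le> R i / 2"
    proof (cases i)
      case 0 then show ?thesis using t by simp
    next
      case (Suc l)
      then have "\<not> R (Suc l) / 2 < \<bar>t\<bar>" using not_less_Least[of l "\<lambda>l. R (Suc l) / 2 < \<bar>t\<bar>"] unfolding i_def by simp
      then show ?thesis using Suc by simp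
    qed
    define x where "x = \<bar>t\<bar>"
    have x: "0 < x" "x \<le> R i / 2" "R (Suc i) < 2 * x" using i1 i2 t by (auto simp: x_def)
    \<comment> \<open>At finer scales the radius is at most \<open>2 * x\<close>, so
      \<open>p - k\<close> powers of it may be traded for powers of \<open>2 * x\<close>.\<close>
    have small: "d l / R (Suc l) ^ k * x ^ k \<le> 2 ^ p * x ^ p * (d l / R (Suc l) ^ p)" if "l \<ge> i" "k \<le> p" for l k
    proof -
      have Rl: "R (Suc l) \<le> 2 * x" "0 < R (Suc l)" using Rmono[of "Suc i" "Suc l"] x that R(1)[of "Suc l"] by auto
      have p: "R (Suc l) ^ p = R (Suc l) ^ (p - k) * R (Suc l) ^ k" using that by (simp flip: power_add)
      have "d l / R (Suc l) ^ k * x ^ k = d l / R (Suc l) ^ p * (R (Suc l) ^ (p - k) * x ^ k)"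
        unfolding p using Rl by simp
      also have "\<dots> \<le> d l / R (Suc l) ^ p * ((2 * x) ^ (p - k) * (2 * x) ^ k)"
        using Rl x d0[of l] by (intro mult_left_mono mult_mono power_mono) auto
      also have "(2 * x) ^ (p - k) * (2 * x) ^ k = 2 ^ p * x ^ p"
        using that by (simp only: power_mult_distrib[symmetric] power_add[symmetric] le_add_diff_inverse2)
      finally show ?thesis by (simp add: mult_ac)
    qed
    have A: "norm (\<psi> t - poly (q i) (of_real t)) \<le> 2 ^ p * S p * x ^ p"
    proof -
      have "norm (\<psi> t - poly (q i) (of_real t)) \<le> d i / R (Suc i) ^ 0 * x ^ 0"
        using \<psi>[of t i] i2 R(1)[of i] by simp
      also have "\<dots> \<le> 2 ^ p * x ^ p * (d i / R (Suc i) ^ p)" by (rule small) auto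
      also have "\<dots> \<le> 2 ^ p * x ^ p * S p" using Spart[of "{i}" p] x by (intro mult_left_mono) auto
      finally show ?thesis by (simp add: mult_ac)
    qed
    define D where "D = Max (insert p (degree ` q ` {..i}))"
    have degD: "degree (q l) \<le> D" if "l \<le> i" for l unfolding D_def using that by (intro Max_ge) auto
    have pD: "p \<le> D" unfolding D_def by (intro Max_ge) auto
    have B: "norm (poly (q i) (of_real t) - (\<Sum>k<p. coeff (q i) k * of_real t ^ k)) \<le> 2 ^ p * (2 * S p * x ^ p)"
    proof -
      have "poly (q i) (of_real t) = (\<Sum>k\<le>D. coeff (q i) k * of_real t ^ k)"
        using degD[of i] unfolding poly_altdef by (intro sum.mono_neutral_left) (auto simp: coeff_eq_0)
      also have "{..D} = {..<p} \<union> {p..D}" using pD by auto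
      also have "(\<Sum>k\<in>{..<p} \<union> {p..D}. coeff (q i) k * of_real t ^ k)
          = (\<Sum>k<p. coeff (q i) k * of_real t ^ k) + (\<Sum>k=p..D. coeff (q i) k * of_real t ^ k)"
        by (intro sum.union_disjoint) auto
      finally have "poly (q i) (of_real t) - (\<Sum>k<p. coeff (q i) k * of_real t ^ k)
          = (\<Sum>k=p..D. \<Sum>l<i. a l k * of_real t ^ k)" by (simp add: tele sum_distrib_right)
      also have "norm \<dots> \<le> (\<Sum>k=p..D. \<Sum>l<i. norm (a l k * of_real t ^ k))"
        by (intro order_trans[OF norm_sum] sum_mono order_refl)
      \<comment> \<open>At coarser scales \<open>x / R (Suc l)\<close> is at most
        \<open>1 / 2\<close>, so the sum over \<open>k\<close> is geometric whatever the degree of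
        \<open>q i\<close>.\<close>
      also have "\<dots> \<le> (\<Sum>k=p..D. \<Sum>l<i. d l / R (Suc l) ^ p * x ^ p * (1 / 2) ^ (k - p))"
      proof (intro sum_mono)
        fix k l assume k: "k \<in> {p..D}" and l: "l \<in> {..<i}"
        have Rl: "0 < R (Suc l)" "x \<le> R (Suc l) / 2" using R(1) Rmono[of "Suc l" i] l x by auto
        have kp: "k = p + (k - p)" using k by simp
        have "norm (a l k * of_real t ^ k) \<le> d l / R (Suc l) ^ k * x ^ k"
          unfolding norm_mult norm_power norm_of_real x_def[symmetric] using a x by (intro mult_right_mono) auto
        also have "\<dots> = d l / R (Suc l) ^ p * x ^ p * (x / R (Suc l)) ^ (k - p)"
          by (subst (1 2) kp) (simp add: power_add power_divide)
        also have "\<dots> \<le> d l / R (Suc l) ^ p * x ^ p * (1 / 2) ^ (k - p)"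
          using Rl x d0[of l] by (intro mult_left_mono power_mono) (auto simp: divide_le_eq)
        finally show "norm (a l k * of_real t ^ k) \<le> d l / R (Suc l) ^ p * x ^ p * (1 / 2) ^ (k - p)" .
      qed
      also have "\<dots> = (\<Sum>k=p..D. (1 / 2) ^ (k - p)) * (x ^ p * (\<Sum>l<i. d l / R (Suc l) ^ p))"
        unfolding sum_distrib_left[of "x ^ p"] sum_product by (simp only: mult_ac)
      also have "\<dots> \<le> 2 * (x ^ p * S p)"
      proof (intro mult_mono)
        have "(\<Sum>k=p..D. (1 / 2 :: real) ^ (k - p)) = (\<Sum>k\<in>{..D - p}. (1 / 2) ^ k)"
          using pD by (intro sum.reindex_bij_witness[where i = "\<lambda>k. k + p" and j = "\<lambda>k. k - p"]) auto
        also have "\<dots> \<le> (\<Sum>k. (1 / 2 :: real) ^ k)" by (intro sum_le_suminf summable_geometric) auto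
        also have "\<dots> = 2" by (subst suminf_geometric) auto
        finally show "(\<Sum>k=p..D. (1 / 2 :: real) ^ (k - p)) \<le> 2" .
      qed (use x Spart[of "{..<i}" p] in \<open>auto intro!: mult_nonneg_nonneg sum_nonneg terms\<close>)
      also have "\<dots> \<le> 2 ^ p * (2 * (x ^ p * S p))"
        using x S0[of p] mult_right_mono[of 1 "2 ^ p" "2 * (x ^ p * S p)"] by simp
      finally show ?thesis by (simp add: mult_ac)
    qed
    have C: "norm ((\<Sum>k<p. coeff (q i) k * of_real t ^ k) - (\<Sum>k<p. c k * of_real t ^ k)) \<le> real p * (2 ^ p * S p * x ^ p)"
    proof -
      have "norm ((\<Sum>k<p. coeff (q i) k * of_real t ^ k) - (\<Sum>k<p. c k * of_real t ^ k))
          = norm (\<Sum>k<p. (c k - coeff (q i) k) * of_real t ^ k)"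
        by (simp add: sum_subtractf left_diff_distrib norm_minus_commute)
      also have "\<dots> \<le> (\<Sum>k<p. norm ((c k - coeff (q i) k) * of_real t ^ k))" by (rule norm_sum)
      also have "\<dots> \<le> (\<Sum>k<p. 2 ^ p * S p * x ^ p)"
      proof (rule sum_mono)
        fix k assume k: "k \<in> {..<p}"
        have s1: "(\<lambda>l. a (l + i) k * of_real t ^ k) sums ((c k - coeff (q i) k) * of_real t ^ k)"
          unfolding tele by (intro sums_mult2 sums_split_initial_segment c)
        have s2: "(\<lambda>l. 2 ^ p * x ^ p * (d (l + i) / R (Suc (l + i)) ^ p)) sums
            (2 ^ p * x ^ p * (S p - (\<Sum>l<i. d l / R (Suc l) ^ p)))"
          by (intro sums_mult sums_split_initial_segment[of "\<lambda>l. d l / R (Suc l) ^ p"] sm)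
        have "norm ((c k - coeff (q i) k) * of_real t ^ k) \<le> 2 ^ p * x ^ p * (S p - (\<Sum>l<i. d l / R (Suc l) ^ p))"
        proof (rule norm_sums_le[OF s1 s2])
          fix l
          have "norm (a (l + i) k * of_real t ^ k) \<le> d (l + i) / R (Suc (l + i)) ^ k * x ^ k"
            unfolding norm_mult norm_power norm_of_real x_def[symmetric] using a x by (intro mult_right_mono) auto
          also have "\<dots> \<le> 2 ^ p * x ^ p * (d (l + i) / R (Suc (l + i)) ^ p)" using k by (intro small) auto
          finally show "norm (a (l + i) k * of_real t ^ k) \<le> 2 ^ p * x ^ p * (d (l + i) / R (Suc (l + i)) ^ p)" .
        qed
        also have "\<dots> \<le> 2 ^ p * x ^ p * S p"
          using x sum_nonneg[of "{..<i}" "\<lambda>l. d l / R (Suc l) ^ p"] terms by (intro mult_left_mono) auto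
        finally show "norm ((c k - coeff (q i) k) * of_real t ^ k) \<le> 2 ^ p * S p * x ^ p" by (simp add: mult_ac)
      qed
      finally show ?thesis by simp
    qed
    have "\<psi> t - (\<Sum>k<p. c k * of_real t ^ k) = (\<psi> t - poly (q i) (of_real t))
        + (poly (q i) (of_real t) - (\<Sum>k<p. coeff (q i) k * of_real t ^ k))
        + ((\<Sum>k<p. coeff (q i) k * of_real t ^ k) - (\<Sum>k<p. c k * of_real t ^ k))" by simp
    then have "norm (\<psi> t - (\<Sum>k<p. c k * of_real t ^ k))
        \<le> 2 ^ p * S p * x ^ p + 2 ^ p * (2 * S p * x ^ p) + real p * (2 ^ p * S p * x ^ p)"
      using A B C by (metis (no_types, lifting) add_mono norm_triangle_le norm_triangle_mono)
    then show ?thesis by (simp add: x_def algebra_simps)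
  qed
  \<comment> \<open>No scale \<open>i\<close> belongs to \<open>t = 0\<close>. There the values of
    \<open>q i\<close> are the constant coefficients, which converge both to \<open>c 0\<close> and
    to \<open>\<psi> 0\<close>.\<close>
  have at0: "norm (\<psi> 0 - (\<Sum>k<p. c k * of_real 0 ^ k)) \<le> (3 + real p) * 2 ^ p * S p * \<bar>0\<bar> ^ p" for p
  proof (cases "p = 0")
    case True
    have "norm (\<psi> 0) \<le> d 0" using \<psi>[of 0 0] R(1)[of 0] q0 by simp
    also have "\<dots> \<le> S 0" using Spart[of "{0}" 0] by simp
    finally show ?thesis using True S0[of 0] by simp
  next
    case False
    have "(\<lambda>i. coeff (q i) 0) \<longlonglongrightarrow> c 0" unfolding tele using c[of 0] by (simp add: sums_def)
    then have "(\<lambda>i. norm (\<psi> 0 - coeff (q i) 0)) \<longlonglongrightarrow> norm (\<psi> 0 - c 0)" by (intro tendsto_intros)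
    moreover have "d \<longlonglongrightarrow> 0" using sm[of 0] summable_LIMSEQ_zero[of d] by (auto simp: sums_iff)
    moreover have "norm (\<psi> 0 - coeff (q i) 0) \<le> d i" for i
      using \<psi>[of 0 i] R(1)[of i] by (simp add: poly_0_coeff_0)
    ultimately have "norm (\<psi> 0 - c 0) \<le> 0" by (intro LIMSEQ_le) auto
    moreover have "(\<Sum>k<p. c k * 0 ^ k) = c 0"
      using False by (subst sum.mono_neutral_right[of _ "{0}"]) auto
    ultimately show ?thesis using False by (simp add: power_0_left)
  qed
  have "norm (\<psi> t - (\<Sum>k<p. c k * of_real t ^ k)) \<le> (3 + real p) * 2 ^ p * S p * \<bar>t\<bar> ^ p"
    if t: "\<bar>t\<bar> \<le> R 0 / 2" for p t
    using main[OF t, of p] at0[of p] by (cases "t = 0") (simp_all only: not_False_eq_True)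
  then show ?thesis using c unfolding a_def by blast
qed

section \<open>Mixed differences\<close>

fun mdiff :: "('a::real_normed_vector \<Rightarrow> complex) \<Rightarrow> 'a list \<Rightarrow> 'a \<Rightarrow> complex" where
  "mdiff f [] x = f x"
| "mdiff f (v # vs) x = mdiff f vs (x + v) - mdiff f vs x"

lemma mdiff_zero: "0 \<in> set vs \<Longrightarrow> mdiff f vs x = 0"
  by (induction vs arbitrary: x) auto

lemma mdiff_shift: "mdiff (\<lambda>y. f (y + v) - f y) vs x = mdiff f (v # vs) x"
  by (induction vs arbitrary: x) (simp_all add: add_ac)

text \<open>The weights are binomial coefficients with alternating signs, those of the
  \<open>k\<close>-th forward difference. Passing from \<open>\<alpha>\<close> to
  \<open>\<beta>\<close> tests \<open>\<alpha>\<close> against \<open>(r + 1)^m - r^m\<close>, whose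
  degree is smaller by one.\<close>

lemma alternating_weights:
  "\<exists>\<alpha>::nat \<Rightarrow> real. \<bar>\<alpha> 0\<bar> = 1 \<and> (\<forall>m<k. (\<Sum>r\<le>k. \<alpha> r * real r ^ m) = 0)"
proof (induction k)
  case 0
  show ?case by (intro exI[of _ "\<lambda>_. 1"]) simp
next
  case (Suc k)
  then obtain \<alpha> where \<alpha>: "\<bar>\<alpha> 0\<bar> = 1" "\<And>m. m < k \<Longrightarrow> (\<Sum>r\<le>k. \<alpha> r * real r ^ m) = 0" by blast
  define \<beta> where "\<beta> = (\<lambda>r. (case r of 0 \<Rightarrow> 0 | Suc q \<Rightarrow> \<alpha> q) - (if r \<le> k then \<alpha> r else 0))"
  have "(\<Sum>r\<le>Suc k. \<beta> r * real r ^ m) = 0" if m: "m < Suc k" for m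
  proof -
    have 1: "(\<Sum>r\<le>Suc k. (case r of 0 \<Rightarrow> 0 | Suc q \<Rightarrow> \<alpha> q) * real r ^ m) = (\<Sum>r\<le>k. \<alpha> r * real (Suc r) ^ m)"
      by (subst sum.atMost_Suc_shift) simp
    have 2: "(\<Sum>r\<le>Suc k. (if r \<le> k then \<alpha> r else 0) * real r ^ m) = (\<Sum>r\<le>k. \<alpha> r * real r ^ m)"
      by simp
    have "(\<Sum>r\<le>Suc k. \<beta> r * real r ^ m) = (\<Sum>r\<le>k. \<alpha> r * (real (Suc r) ^ m - real r ^ m))"
      unfolding \<beta>_def left_diff_distrib sum_subtractf 1 2 by (simp only: right_diff_distrib sum_subtractf)
    also have "\<dots> = (\<Sum>r\<le>k. \<Sum>i<m. real (m choose i) * (\<alpha> r * real r ^ i))"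
    proof (intro sum.cong refl)
      fix r
      have "real (Suc r) ^ m = (\<Sum>i\<le>m. real (m choose i) * real r ^ i)"
        using binomial_ring[of "real r" 1 m] by (simp add: add.commute)
      also have "{..m} = insert m {..<m}" by auto
      finally have "real (Suc r) ^ m - real r ^ m = (\<Sum>i<m. real (m choose i) * real r ^ i)" by simp
      then show "\<alpha> r * (real (Suc r) ^ m - real r ^ m) = (\<Sum>i<m. real (m choose i) * (\<alpha> r * real r ^ i))"
        by (simp only: sum_distrib_left mult.left_commute)
    qed
    also have "\<dots> = (\<Sum>i<m. real (m choose i) * (\<Sum>r\<le>k. \<alpha> r * real r ^ i))"
      by (subst sum.swap) (simp only: sum_distrib_left)
    also have "\<dots> = 0" using \<alpha>(2) m by (intro sum.neutral) auto
    finally show ?thesis .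
  qed
  moreover have "\<bar>\<beta> 0\<bar> = 1" using \<alpha>(1) by (simp add: \<beta>_def)
  ultimately show ?case by blast
qed

text \<open>A mixed difference is a signed sum of \<open>2 ^ length ps\<close> values, and when the
  increments are affine in \<open>r\<close>, each of the points moves along a line
  \<open>y + r u\<close>. The moving base point \<open>x + r w\<close> is there for the
  induction.\<close>

lemma mdiff_weighted_bound:
  fixes f :: "'a::real_normed_vector \<Rightarrow> complex"
  assumes "\<And>y u. norm (y - x) \<le> (\<Sum>p\<leftarrow>ps. norm (fst p)) \<Longrightarrow> norm (u - w) \<le> (\<Sum>p\<leftarrow>ps. norm (snd p)) \<Longrightarrow>
    norm (\<Sum>r\<le>k. of_real (\<alpha> r) * f (y + real r *\<^sub>R u)) \<le> E"
  shows "norm (\<Sum>r\<le>k. of_real (\<alpha> r) * mdiff f (map (\<lambda>p. fst p + real r *\<^sub>R snd p) ps) (x + real r *\<^sub>R w)) \<le> 2 ^ length ps * E"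
  using assms
proof (induction ps arbitrary: x w)
  case Nil
  then show ?case by simp
next
  case (Cons p ps)
  let ?M = "\<lambda>r. mdiff f (map (\<lambda>p. fst p + real r *\<^sub>R snd p) ps)"
  have 1: "norm (\<Sum>r\<le>k. of_real (\<alpha> r) * ?M r ((x + fst p) + real r *\<^sub>R (w + snd p))) \<le> 2 ^ length ps * E"
  proof (rule Cons.IH)
    fix y u assume "norm (y - (x + fst p)) \<le> (\<Sum>p\<leftarrow>ps. norm (fst p))" "norm (u - (w + snd p)) \<le> (\<Sum>p\<leftarrow>ps. norm (snd p))"
    then show "norm (\<Sum>r\<le>k. of_real (\<alpha> r) * f (y + real r *\<^sub>R u)) \<le> E"
      using norm_triangle_ineq[of "y - (x + fst p)" "fst p"] norm_triangle_ineq[of "u - (w + snd p)" "snd p"]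
      by (intro Cons.prems) (auto simp: algebra_simps)
  qed
  have 2: "norm (\<Sum>r\<le>k. of_real (\<alpha> r) * ?M r (x + real r *\<^sub>R w)) \<le> 2 ^ length ps * E"
    by (rule Cons.IH, rule Cons.prems) (simp_all add: add_increasing)
  have "(\<Sum>r\<le>k. of_real (\<alpha> r) * mdiff f (map (\<lambda>p. fst p + real r *\<^sub>R snd p) (p # ps)) (x + real r *\<^sub>R w))
      = (\<Sum>r\<le>k. of_real (\<alpha> r) * ?M r ((x + fst p) + real r *\<^sub>R (w + snd p))) - (\<Sum>r\<le>k. of_real (\<alpha> r) * ?M r (x + real r *\<^sub>R w))"
    by (simp add: right_diff_distrib sum_subtractf scaleR_add_right add_ac)
  then show ?case using norm_triangle_le_diff[OF add_mono[OF 1 2]] by (simp add: mult_ac)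
qed

text \<open>As functions of the scale \<open>t\<close>, the \<open>2 ^ length vs\<close> values in
  the difference each run along one line through \<open>x\<close>, so coefficients and errors add
  up. Only the coefficient of index \<open>k\<close> is estimated, because the lower ones will turn
  out to vanish.\<close>

lemma mdiff_polynomial_approx:
  fixes f :: "'a::real_normed_vector \<Rightarrow> complex"
  defines "approx \<equiv> \<lambda>k t0 B E F. \<exists>c. norm (c k) \<le> B \<and>
    (\<forall>t. 0 < t \<and> t \<le> t0 \<longrightarrow> norm (F t - (\<Sum>i\<le>k. c i * of_real t ^ i)) \<le> E t)"
  assumes "\<And>u. norm (u - w) \<le> (\<Sum>v\<leftarrow>vs. norm v) \<Longrightarrow> approx k t0 B E (\<lambda>t. f (x + t *\<^sub>R u))"
  shows "approx k (t0::real) (2 ^ length vs * B) (\<lambda>t. 2 ^ length vs * E t)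
    (\<lambda>t. mdiff f (map (\<lambda>v. t *\<^sub>R v) vs) (x + t *\<^sub>R w))"
  using assms(2)
proof (induction vs arbitrary: w)
  case Nil
  then show ?case by simp
next
  case (Cons v vs)
  let ?m = "\<lambda>w t. mdiff f (map (\<lambda>v. t *\<^sub>R v) vs) (x + t *\<^sub>R w)"
  let ?n = "2 ^ length vs :: real"
  have "approx k t0 (?n * B) (\<lambda>t. ?n * E t) (?m (w + v))"
  proof (rule Cons.IH)
    fix u assume "norm (u - (w + v)) \<le> (\<Sum>v\<leftarrow>vs. norm v)"
    then have "norm (u - w) \<le> (\<Sum>v\<leftarrow>v # vs. norm v)"
      using norm_triangle_ineq[of "u - (w + v)" v] by (simp add: algebra_simps)
    then show "approx k t0 B E (\<lambda>t. f (x + t *\<^sub>R u))" by (rule Cons.prems)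
  qed
  then obtain c1 where c1: "norm (c1 k) \<le> ?n * B" "\<And>t. 0 < t \<Longrightarrow> t \<le> t0 \<Longrightarrow>
      norm (?m (w + v) t - (\<Sum>i\<le>k. c1 i * of_real t ^ i)) \<le> ?n * E t"
    unfolding approx_def by blast
  have "approx k t0 (?n * B) (\<lambda>t. ?n * E t) (?m w)"
    by (rule Cons.IH, rule Cons.prems) (simp add: add_increasing)
  then obtain c2 where c2: "norm (c2 k) \<le> ?n * B" "\<And>t. 0 < t \<Longrightarrow> t \<le> t0 \<Longrightarrow>
      norm (?m w t - (\<Sum>i\<le>k. c2 i * of_real t ^ i)) \<le> ?n * E t"
    unfolding approx_def by blast
  show ?case unfolding approx_def
  proof (intro exI[of _ "\<lambda>i. c1 i - c2 i"] conjI allI impI)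
    show "norm (c1 k - c2 k) \<le> 2 ^ length (v # vs) * B"
      using norm_triangle_le_diff[OF add_mono[OF c1(1) c2(1)]] by (simp add: mult_ac)
  next
    fix t assume t: "0 < t \<and> t \<le> t0"
    let ?p = "mdiff f (map (\<lambda>v. t *\<^sub>R v) (v # vs)) (x + t *\<^sub>R w) - (\<Sum>i\<le>k. (c1 i - c2 i) * of_real t ^ i)"
    have "?p = (?m (w + v) t - (\<Sum>i\<le>k. c1 i * of_real t ^ i)) - (?m w t - (\<Sum>i\<le>k. c2 i * of_real t ^ i))"
      by (simp add: left_diff_distrib sum_subtractf scaleR_add_right add_ac)
    then have "norm ?p \<le> ?n * E t + ?n * E t"
      using norm_triangle_le_diff[OF add_mono[OF c1(2)[of t] c2(2)[of t]]] t by (simp only: simp_thms)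
    then show "norm ?p \<le> 2 ^ length (v # vs) * E t" by (simp add: mult_ac del: mdiff.simps)
  qed
qed

text \<open>Telescoping in every direction. It turns an estimate for tiny increments into one for
  given increments, and in this passage error terms of higher order disappear.\<close>

lemma mdiff_subdivide:
  fixes f :: "'a::real_normed_vector \<Rightarrow> complex"
  assumes "\<And>y. norm (y - x) \<le> (\<Sum>p\<leftarrow>ps. real (fst p) * norm (snd p)) \<Longrightarrow> norm (mdiff f (map snd ps) y) \<le> M"
  shows "norm (mdiff f (map (\<lambda>p. real (fst p) *\<^sub>R snd p) ps) x) \<le> (\<Prod>p\<leftarrow>ps. real (fst p)) * M"
  using assms
proof (induction ps arbitrary: x f)
  case Nil
  then show ?case by simp
next
  case (Cons p ps)
  obtain n v where p: "p = (n, v)" by (cases p)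
  let ?vs = "map (\<lambda>p. real (fst p) *\<^sub>R snd p) ps"
  have tele: "mdiff f ?vs (x + real m *\<^sub>R v) - mdiff f ?vs x
      = (\<Sum>q<m. mdiff f (v # ?vs) (x + real q *\<^sub>R v))" for m
  proof (induction m)
    case (Suc m)
    have e: "x + real (Suc m) *\<^sub>R v = x + real m *\<^sub>R v + v" by (simp add: algebra_simps)
    show ?case
      unfolding sum.lessThan_Suc Suc.IH[symmetric] e
      unfolding mdiff.simps by simp
  qed simp
  have "norm (mdiff f (v # ?vs) (x + real q *\<^sub>R v)) \<le> (\<Prod>p\<leftarrow>ps. real (fst p)) * M" if q: "q < n" for q
    unfolding mdiff_shift[symmetric]
  proof (rule Cons.IH)
    fix y assume y: "norm (y - (x + real q *\<^sub>R v)) \<le> (\<Sum>p\<leftarrow>ps. real (fst p) * norm (snd p))"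
    have "norm (y - x) \<le> norm (y - (x + real q *\<^sub>R v)) + real q * norm v"
      using norm_triangle_ineq[of "y - (x + real q *\<^sub>R v)" "real q *\<^sub>R v"] by (simp add: algebra_simps)
    also have "\<dots> \<le> (\<Sum>p\<leftarrow>ps. real (fst p) * norm (snd p)) + real n * norm v"
      using y q by (intro add_mono mult_right_mono) auto
    finally show "norm (mdiff (\<lambda>y. f (y + v) - f y) (map snd ps) y) \<le> M"
      unfolding mdiff_shift using Cons.prems[of y] by (simp add: p)
  qed
  then have "norm (\<Sum>q<n. mdiff f (v # ?vs) (x + real q *\<^sub>R v)) \<le> (\<Sum>q<n. (\<Prod>p\<leftarrow>ps. real (fst p)) * M)"
    by (intro order_trans[OF norm_sum] sum_mono) auto
  then have "norm (mdiff f ?vs (x + real n *\<^sub>R v) - mdiff f ?vs x) \<le> real n * ((\<Prod>p\<leftarrow>ps. real (fst p)) * M)"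
    unfolding tele by (simp del: mdiff.simps)
  then show ?case by (simp add: p mult.assoc)
qed

text \<open>For smooth \<open>f\<close> this amounts to the bounds \<open>B k\<close> for the norms
  of the \<open>k\<close>-th derivatives in the ball of radius \<open>\<rho>\<close> about
  \<open>z\<close>, but it presupposes no derivative and survives pointwise limits. The condition on
  \<open>x\<close> and \<open>vs\<close> keeps all points of the difference in the ball.\<close>

definition mdiff_bounded :: "'a::real_normed_vector \<Rightarrow> real \<Rightarrow> ('a \<Rightarrow> complex) \<Rightarrow> (nat \<Rightarrow> real) \<Rightarrow> bool" where
  "mdiff_bounded z \<rho> f B \<longleftrightarrow> (\<forall>vs x. norm (x - z) + (\<Sum>v\<leftarrow>vs. norm v) < \<rho> \<longrightarrow>
     norm (mdiff f vs x) \<le> B (length vs) * (\<Prod>v\<leftarrow>vs. norm v))"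

text \<open>Additivity gives homogeneity over the integers. As \<open>n * r\<close> differs from an
  integer by at most 1, \<open>n\<close> times the defect of homogeneity at \<open>r\<close> stays
  bounded in \<open>n\<close>, so the defect is 0.\<close>

lemma additive_bounded_imp_linear:
  fixes L :: "'a::real_normed_vector \<Rightarrow> 'b::real_normed_vector"
  assumes add: "\<And>v w. L (v + w) = L v + L w" and bd: "\<And>v. norm (L v) \<le> K * norm v"
  shows "bounded_linear L"
proof (rule bounded_linear_intro)
  have L0: "L 0 = 0" using add[of 0 0] by simp
  have nat: "L (real n *\<^sub>R v) = real n *\<^sub>R L v" for n v
    by (induction n) (simp_all add: L0 add scaleR_add_left)
  have neg: "L (- v) = - L v" for v using add[of v "- v"] L0 by (simp add: eq_neg_iff_add_eq_0 add.commute)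
  have int: "L (of_int i *\<^sub>R v) = of_int i *\<^sub>R L v" for i v
  proof (cases "i \<ge> 0")
    case True then show ?thesis using nat[of "nat i" v] by simp
  next
    case False then show ?thesis using nat[of "nat (- i)" v] neg[of "real_of_int (- i) *\<^sub>R v"] by simp
  qed
  fix r v
  have "norm (L (r *\<^sub>R v) - r *\<^sub>R L v) * real n \<le> 2 * (\<bar>K\<bar> * norm v)" for n
  proof -
    define e where "e = frac (real n * r)"
    have e: "\<bar>e\<bar> \<le> 1" unfolding e_def using frac_ge_0[of "real n * r"] frac_lt_1[of "real n * r"] by linarith
    have nr: "real n * r = of_int \<lfloor>real n * r\<rfloor> + e" by (simp add: e_def frac_def)
    have "real n *\<^sub>R (L (r *\<^sub>R v) - r *\<^sub>R L v) = L ((real n * r) *\<^sub>R v) - (real n * r) *\<^sub>R L v"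
      using nat[of n "r *\<^sub>R v"] by (simp add: scaleR_diff_right)
    also have "\<dots> = L (e *\<^sub>R v) - e *\<^sub>R L v"
      by (subst (1 2) nr) (simp add: scaleR_add_left add int)
    finally have "norm (L (r *\<^sub>R v) - r *\<^sub>R L v) * real n = norm (L (e *\<^sub>R v) - e *\<^sub>R L v)"
      by (metis abs_of_nat mult.commute norm_scaleR)
    also have "\<dots> \<le> norm (L (e *\<^sub>R v)) + norm (e *\<^sub>R L v)" by (rule norm_triangle_ineq4)
    also have "\<dots> \<le> \<bar>K\<bar> * norm v + \<bar>K\<bar> * norm v"
    proof (intro add_mono)
      have "norm (L (e *\<^sub>R v)) \<le> K * norm (e *\<^sub>R v)" by (rule bd)
      also have "\<dots> \<le> \<bar>K\<bar> * norm (e *\<^sub>R v)" by (intro mult_right_mono) auto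
      also have "\<dots> \<le> \<bar>K\<bar> * norm v" using e by (intro mult_left_mono) (auto simp: mult_left_le_one_le)
      finally show "norm (L (e *\<^sub>R v)) \<le> \<bar>K\<bar> * norm v" .
      have "norm (e *\<^sub>R L v) \<le> norm (L v)" using e by (simp add: mult_left_le_one_le)
      also have "\<dots> \<le> K * norm v" by (rule bd)
      also have "\<dots> \<le> \<bar>K\<bar> * norm v" by (intro mult_right_mono) auto
      finally show "norm (e *\<^sub>R L v) \<le> \<bar>K\<bar> * norm v" .
    qed
    finally show ?thesis by simp
  qed
  then have "norm (L (r *\<^sub>R v) - r *\<^sub>R L v) = 0"
    by (intro real_archimedian_rdiv_eq_0[of _ "2 * (\<bar>K\<bar> * norm v)"]) (simp_all add: mult.commute)
  then show "L (r *\<^sub>R v) = r *\<^sub>R L v" by simp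
next
  show "norm (L v) \<le> norm v * K" for v using bd[of v] by (simp add: mult.commute)
qed (rule add)

text \<open>The bound on second differences does everything: it makes the dyadic difference
  quotients converge geometrically, their limit additive, and the remainder quadratic. The dyadic
  limit is part of the conclusion because the bounds are handed on to the derivative through
  it.\<close>

lemma mdiff_bounded_has_derivative:
  fixes f :: "'a::real_normed_vector \<Rightarrow> complex"
  assumes f: "mdiff_bounded z \<rho> f B" and x: "norm (x - z) < \<rho>"
  shows "\<exists>L. (f has_derivative L) (at x) \<and>
    (\<forall>v. (\<lambda>n. 2 ^ n * (f (x + (1 / 2 ^ n) *\<^sub>R v) - f x)) \<longlonglongrightarrow> L v)"
proof -
  define \<delta> where "\<delta> = \<rho> - norm (x - z)"
  have \<delta>: "\<delta> > 0" using x by (simp add: \<delta>_def)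
  have lip: "norm (f (x + u) - f x) \<le> B 1 * norm u" if "norm u < \<delta>" for u
    using f[unfolded mdiff_bounded_def, rule_format, of x "[u]"] that by (simp add: \<delta>_def)
  have sec: "norm (f (x + u + w) - f (x + u) - (f (x + w) - f x)) \<le> B 2 * (norm u * norm w)" if "norm u + norm w < \<delta>" for u w
    using f[unfolded mdiff_bounded_def, rule_format, of x "[u, w]"] that by (simp add: \<delta>_def numeral_2_eq_2)
  define q where "q = (\<lambda>n v. 2 ^ n * (f (x + (1 / 2 ^ n) *\<^sub>R v) - f x))"
  have step: "norm (q (Suc n) v - q n v) \<le> B 2 * (norm v)\<^sup>2 / 4 * (1 / 2) ^ n" if v: "norm v < \<delta>" for n v
  proof -
    define u where "u = (1 / 2 ^ Suc n) *\<^sub>R v"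
    have uu: "(1 / 2 ^ n) *\<^sub>R v = u + u" by (simp add: u_def flip: scaleR_add_left)
    have nu: "norm u = norm v / 2 ^ Suc n" by (simp add: u_def)
    have "norm u + norm u = norm v / 2 ^ n" by (simp add: nu)
    also have "\<dots> \<le> norm v" by (simp add: divide_le_eq mult_left_le[of 1 "2 ^ n", simplified] mult_le_cancel_left1)
    finally have "norm u + norm u < \<delta>" using v by simp
    from sec[OF this] have s: "norm (f (x + (u + u)) - f (x + u) - (f (x + u) - f x)) \<le> B 2 * (norm u * norm u)"
      by (simp add: add_ac)
    have "q (Suc n) v - q n v = - (2 ^ n * (f (x + (u + u)) - f (x + u) - (f (x + u) - f x)))"
      unfolding q_def uu u_def[symmetric] by (simp add: algebra_simps)
    then have "norm (q (Suc n) v - q n v) \<le> 2 ^ n * (B 2 * (norm u * norm u))"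
      using s by (simp add: norm_mult norm_power)
    also have "\<dots> = B 2 * (norm v)\<^sup>2 / 4 * (1 / 2) ^ n"
      by (simp add: nu power2_eq_square field_simps)
    finally show ?thesis .
  qed
  have lim: "\<exists>l. (\<lambda>n. q n v) \<longlonglongrightarrow> l \<and> norm (l - q 0 v) \<le> B 2 * (norm v)\<^sup>2 / 2" if v: "norm v < \<delta>" for v
  proof -
    have g: "(\<lambda>n. B 2 * (norm v)\<^sup>2 / 4 * (1 / 2) ^ n) sums (B 2 * (norm v)\<^sup>2 / 4 * (1 / (1 - 1 / 2)))"
      by (intro sums_mult geometric_sums) simp
    have sm: "summable (\<lambda>n. q (Suc n) v - q n v)"
      by (rule summable_comparison_test'[OF sums_summable[OF g], of 0]) (rule step[OF v])
    define l where "l = q 0 v + (\<Sum>n. q (Suc n) v - q n v)"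
    have "(\<lambda>n. q 0 v + (\<Sum>i<n. q (Suc i) v - q i v)) \<longlonglongrightarrow> l"
      unfolding l_def using summable_LIMSEQ[OF sm] by (intro tendsto_intros)
    then have "(\<lambda>n. q n v) \<longlonglongrightarrow> l" unfolding sum_lessThan_telescope[of "\<lambda>i. q i v"] by simp
    moreover have "norm (l - q 0 v) \<le> B 2 * (norm v)\<^sup>2 / 4 * (1 / (1 - 1 / 2))"
      unfolding l_def using norm_sums_le[OF summable_sums[OF sm] g step[OF v]] by simp
    ultimately show ?thesis by (intro exI[of _ l]) simp
  qed
  \<comment> \<open>The geometric estimate covers only short \<open>v\<close>; this identity carries
    convergence over to all \<open>v\<close>.\<close>
  have q_scale: "q (n + m) v = 2 ^ m * q n ((1 / 2 ^ m) *\<^sub>R v)" for n m v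
    by (simp add: q_def power_add mult_ac)
  have "\<exists>l. (\<lambda>n. q n v) \<longlonglongrightarrow> l" for v
  proof -
    obtain m where m: "norm v / \<delta> < 2 ^ m" using real_arch_pow[of 2 "norm v / \<delta>"] by auto
    then have "norm ((1 / 2 ^ m) *\<^sub>R v) < \<delta>" using \<delta> by (simp add: field_simps)
    then obtain l where "(\<lambda>n. q n ((1 / 2 ^ m) *\<^sub>R v)) \<longlonglongrightarrow> l" using lim by blast
    then have "(\<lambda>n. q (n + m) v) \<longlonglongrightarrow> 2 ^ m * l" unfolding q_scale by (intro tendsto_intros)
    then show ?thesis by (intro exI) (rule LIMSEQ_offset)
  qed
  then obtain L where L: "\<And>v. (\<lambda>n. q n v) \<longlonglongrightarrow> L v" by metis
  have small: "eventually (\<lambda>n. norm ((1 / 2 ^ n) *\<^sub>R v) < r) sequentially" if "r > 0" for v :: 'a and r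
  proof -
    have "(\<lambda>n. norm v * (1 / 2) ^ n) \<longlonglongrightarrow> norm v * 0" by (intro tendsto_intros) simp
    then have "eventually (\<lambda>n. norm v * (1 / 2) ^ n < r) sequentially" using that by (intro order_tendstoD) simp_all
    moreover have "norm ((1 / 2 ^ n) *\<^sub>R v) = norm v * (1 / 2) ^ n" for n by (simp add: power_one_over)
    ultimately show ?thesis by (simp only:)
  qed
  have "bounded_linear L"
  proof (rule additive_bounded_imp_linear)
    fix v w
    have ev: "eventually (\<lambda>n. norm (q n (v + w) - q n v - q n w) \<le> B 2 * (norm v * norm w) * (1 / 2) ^ n) sequentially"
      using small[OF half_gt_zero[OF \<delta>], of v] small[OF half_gt_zero[OF \<delta>], of w]
    proof eventually_elim
      case (elim n)
      let ?v = "(1 / 2 ^ n) *\<^sub>R v" and ?w = "(1 / 2 ^ n) *\<^sub>R w"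
      have "norm ?v + norm ?w < \<delta>" using elim \<delta> by linarith
      note s = sec[OF this]
      have "q n (v + w) - q n v - q n w = 2 ^ n * (f (x + ?v + ?w) - f (x + ?v) - (f (x + ?w) - f x))"
        by (simp add: q_def algebra_simps)
      then have "norm (q n (v + w) - q n v - q n w)
          = 2 ^ n * norm (f (x + ?v + ?w) - f (x + ?v) - (f (x + ?w) - f x))"
        by (simp only: norm_mult norm_power norm_numeral)
      also have "\<dots> \<le> 2 ^ n * (B 2 * (norm ?v * norm ?w))" using s by (intro mult_left_mono) auto
      also have "\<dots> = B 2 * (norm v * norm w) * (1 / 2) ^ n" by (simp add: power_one_over)
      finally show ?case .
    qed
    have "(\<lambda>n. norm (q n (v + w) - q n v - q n w)) \<longlonglongrightarrow> norm (L (v + w) - L v - L w)"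
      by (intro tendsto_intros L)
    moreover have "(\<lambda>n. B 2 * (norm v * norm w) * (1 / 2) ^ n) \<longlonglongrightarrow> B 2 * (norm v * norm w) * 0"
      by (intro tendsto_intros) simp
    ultimately have "norm (L (v + w) - L v - L w) \<le> B 2 * (norm v * norm w) * 0"
      using ev by (intro tendsto_le[OF sequentially_bot])
    then show "L (v + w) = L v + L w" by (simp add: algebra_simps)
  next
    fix v
    have ev: "eventually (\<lambda>n. norm (q n v) \<le> B 1 * norm v) sequentially"
      using small[OF \<delta>, of v]
    proof eventually_elim
      case (elim n)
      have "norm (q n v) = 2 ^ n * norm (f (x + (1 / 2 ^ n) *\<^sub>R v) - f x)" by (simp add: q_def norm_mult norm_power)
      also have "\<dots> \<le> 2 ^ n * (B 1 * norm ((1 / 2 ^ n) *\<^sub>R v))" using lip[OF elim] by (intro mult_left_mono) auto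
      finally show ?case by simp
    qed
    show "norm (L v) \<le> B 1 * norm v"
      by (rule tendsto_upperbound[OF tendsto_norm[OF L] ev]) simp
  qed
  have quad: "norm (f (x + h) - f x - L h) \<le> B 2 * (norm h)\<^sup>2 / 2" if "norm h < \<delta>" for h
  proof -
    obtain l where "(\<lambda>n. q n h) \<longlonglongrightarrow> l" "norm (l - q 0 h) \<le> B 2 * (norm h)\<^sup>2 / 2" using lim \<open>norm h < \<delta>\<close> by blast
    moreover have "l = L h" using LIMSEQ_unique[OF L calculation(1)] by simp
    ultimately show ?thesis by (simp add: q_def norm_minus_commute)
  qed
  have "(f has_derivative L) (at x)"
    unfolding has_derivative_at
  proof
    have "eventually (\<lambda>h. h \<in> ball 0 \<delta>) (at (0::'a))" using \<delta> by (intro eventually_at_in_open') auto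
    then have "eventually (\<lambda>h. norm (f (x + h) - f x - L h) / norm h \<le> \<bar>B 2\<bar> * norm h / 2) (at 0)"
    proof eventually_elim
      case (elim h)
      have "norm (f (x + h) - f x - L h) \<le> B 2 * (norm h)\<^sup>2 / 2" using elim by (intro quad) simp
      also have "\<dots> \<le> \<bar>B 2\<bar> * (norm h)\<^sup>2 / 2" by (intro divide_right_mono mult_right_mono) auto
      finally show ?case by (cases "h = 0") (auto simp: divide_le_eq power2_eq_square)
    qed
    then have "eventually (\<lambda>h. norm (norm (f (x + h) - f x - L h) / norm h) \<le> \<bar>B 2\<bar> * norm h / 2) (at 0)"
      by (rule eventually_mono) simp
    moreover have "((\<lambda>h::'a. \<bar>B 2\<bar> * norm h / 2) \<longlongrightarrow> \<bar>B 2\<bar> * norm (0::'a) / 2) (at 0)" by (intro tendsto_intros) auto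
    then have "((\<lambda>h::'a. \<bar>B 2\<bar> * norm h / 2) \<longlongrightarrow> 0) (at 0)" by simp
    ultimately show "((\<lambda>h. norm (f (x + h) - f x - L h) / norm h) \<longlongrightarrow> 0) (at 0)"
      by (rule Lim_null_comparison)
  qed fact
  then show ?thesis using L unfolding q_def by blast
qed

text \<open>Differences of the derivative are limits of rescaled differences of \<open>f\<close>
  with one more increment \<open>w / 2 ^ n\<close>. The strict inequality for \<open>x\<close> and
  \<open>vs\<close> leaves room for this increment when \<open>n\<close> is large, so the ball does
  not shrink.\<close>

lemma mdiff_bounded_frechet_derivative:
  fixes f :: "'a::real_normed_vector \<Rightarrow> complex"
  assumes f: "mdiff_bounded z \<rho> f B"
  shows "mdiff_bounded z \<rho> (\<lambda>x. frechet_derivative f (at x) w) (\<lambda>k. B (Suc k) * norm w)"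
  unfolding mdiff_bounded_def
proof (intro allI impI)
  fix vs :: "'a list" and x assume reg: "norm (x - z) + (\<Sum>v\<leftarrow>vs. norm v) < \<rho>"
  have lim: "(\<lambda>n. 2 ^ n * (mdiff f vs (x + (1 / 2 ^ n) *\<^sub>R w) - mdiff f vs x))
      \<longlonglongrightarrow> mdiff (\<lambda>x. frechet_derivative f (at x) w) vs x"
    if "norm (x - z) + (\<Sum>v\<leftarrow>vs. norm v) < \<rho>" for vs x
    using that
  proof (induction vs arbitrary: x)
    case Nil
    then obtain L where L: "(f has_derivative L) (at x)"
      "\<And>v. (\<lambda>n. 2 ^ n * (f (x + (1 / 2 ^ n) *\<^sub>R v) - f x)) \<longlonglongrightarrow> L v"
      using mdiff_bounded_has_derivative[OF f, of x] by auto
    then show ?case using frechet_derivative_at[OF L(1)] by simp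
  next
    case (Cons v vs)
    have 1: "norm (x + v - z) + (\<Sum>v\<leftarrow>vs. norm v) < \<rho>"
      using Cons.prems norm_triangle_ineq[of "x - z" v] by (simp add: algebra_simps)
    have 2: "norm (x - z) + (\<Sum>v\<leftarrow>vs. norm v) < \<rho>"
    proof -
      have "norm (x - z) + (norm v + (\<Sum>v\<leftarrow>vs. norm v)) < \<rho>" using Cons.prems by simp
      then show ?thesis using norm_ge_zero[of v] by linarith
    qed
    show ?case using tendsto_diff[OF Cons.IH[OF 1] Cons.IH[OF 2]] by (simp add: algebra_simps)
  qed
  define \<delta> where "\<delta> = \<rho> - (norm (x - z) + (\<Sum>v\<leftarrow>vs. norm v))"
  have \<delta>: "\<delta> > 0" unfolding \<delta>_def using reg by linarith
  have "(\<lambda>n. norm w * (1 / 2) ^ n) \<longlonglongrightarrow> norm w * 0" by (intro tendsto_intros) simp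
  then have "eventually (\<lambda>n. norm w * (1 / 2) ^ n < \<delta>) sequentially"
    using \<delta> by (intro order_tendstoD) simp_all
  then have "eventually (\<lambda>n. norm (2 ^ n * (mdiff f vs (x + (1 / 2 ^ n) *\<^sub>R w) - mdiff f vs x))
      \<le> B (Suc (length vs)) * norm w * (\<Prod>v\<leftarrow>vs. norm v)) sequentially"
  proof eventually_elim
    case (elim n)
    let ?w = "(1 / 2 ^ n) *\<^sub>R w"
    have "norm ?w = norm w * (1 / 2) ^ n" by (simp add: power_one_over)
    then have "norm (mdiff f (?w # vs) x) \<le> B (length (?w # vs)) * (\<Prod>v\<leftarrow>?w # vs. norm v)"
      using f[unfolded mdiff_bounded_def, rule_format, of x "?w # vs"] elim by (simp add: \<delta>_def)
    then have "2 ^ n * norm (mdiff f (?w # vs) x) \<le> 2 ^ n * (B (length (?w # vs)) * (\<Prod>v\<leftarrow>?w # vs. norm v))"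
      by (intro mult_left_mono) auto
    then show ?case by (simp add: norm_mult norm_power mult_ac)
  qed
  then show "norm (mdiff (\<lambda>x. frechet_derivative f (at x) w) vs x) \<le> B (Suc (length vs)) * norm w * (\<Prod>v\<leftarrow>vs. norm v)"
    by (intro tendsto_upperbound[OF tendsto_norm[OF lim[OF reg]]]) auto
qed

lemma mdiff_bounded_iter_frechet:
  fixes f :: "'a::euclidean_space \<Rightarrow> complex"
  assumes f: "mdiff_bounded z \<rho> f B"
  shows "mdiff_bounded z \<rho> (iter_frechet f ws) (\<lambda>k. B (length ws + k) * (\<Prod>w\<leftarrow>ws. norm w))"
proof (induction ws)
  case Nil
  have "iter_frechet f [] = f" by (rule ext) simp
  then show ?case using f by simp
next
  case (Cons w ws)
  have "iter_frechet f (w # ws) = (\<lambda>x. frechet_derivative (iter_frechet f ws) (at x) w)" by (rule ext) simp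
  then show ?case using mdiff_bounded_frechet_derivative[OF Cons.IH, of w] by (simp add: mult_ac)
qed

text \<open>This is Djokovic's reduction of mixed differences to pure ones: with the increments \<open>h\<^sub>i\<close> replaced by
  \<open>(1 - r / i) h\<^sub>i\<close>, the mixed difference vanishes for \<open>1 \<le> r \<le> k\<close>, so that its weighted sum over \<open>r\<close>
  reduces to the term \<open>r = 0\<close>; on the other hand, the sum consists of pure differences in \<open>r\<close>.\<close>

lemma mdiff_isotropic_bound:
  fixes f :: "'a::real_normed_vector \<Rightarrow> complex"
  assumes t0: "t0 > 0"
    and expn: "\<And>x v. norm (x - z) < \<rho> \<Longrightarrow> norm v \<le> 1 \<Longrightarrow> \<exists>c. \<forall>p t. \<bar>t\<bar> \<le> t0 \<longrightarrow>
      norm (f (x + t *\<^sub>R v) - (\<Sum>k<p. c k * of_real t ^ k)) \<le> C p * \<bar>t\<bar> ^ p"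
    and k: "k \<ge> 1"
  shows "\<exists>K. \<forall>hs x h. length hs = k \<and> (\<forall>v\<in>set hs. norm v \<le> h) \<and> 0 < h \<and> (real k)\<^sup>2 * h \<le> t0 \<and>
    norm (x - z) + real k * h < \<rho> \<longrightarrow> norm (mdiff f hs x) \<le> K * h ^ k"
proof -
  obtain \<alpha> where \<alpha>: "\<bar>\<alpha> 0\<bar> = 1" "\<And>m. m < k \<Longrightarrow> (\<Sum>r\<le>k. \<alpha> r * real r ^ m) = 0"
    using alternating_weights[of k] by blast
  define A where "A = (\<Sum>r\<le>k. \<bar>\<alpha> r\<bar>)"
  have "norm (mdiff f hs x) \<le> 2 ^ k * (A * \<bar>C k\<bar> * ((real k)\<^sup>2 * h) ^ k)"
    if hs: "length hs = k" "\<And>v. v \<in> set hs \<Longrightarrow> norm v \<le> h" and h: "0 < h" "(real k)\<^sup>2 * h \<le> t0"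
      and x: "norm (x - z) + real k * h < \<rho>" for hs x h
  proof -
    \<comment> \<open>Positions in \<open>hs\<close> count from 0, so \<open>Suc i\<close> plays the
      part of the index: at \<open>r = Suc i\<close> the increment at position \<open>i\<close>
      becomes 0.\<close>
    define ps where "ps = map (\<lambda>i. (hs ! i, - (1 / real (Suc i)) *\<^sub>R hs ! i)) [0..<k]"
    have hi: "norm (hs ! i) \<le> h" if "i < k" for i using hs that by auto
    have fst_sum: "(\<Sum>p\<leftarrow>ps. norm (fst p)) \<le> real k * h"
    proof -
      have "(\<Sum>p\<leftarrow>ps. norm (fst p)) = (\<Sum>i<k. norm (hs ! i))"
        by (simp add: ps_def o_def interv_sum_list_conv_sum_set_nat atLeast0LessThan)
      also have "\<dots> \<le> (\<Sum>i<k. h)" by (intro sum_mono hi) auto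
      finally show ?thesis by simp
    qed
    have snd_sum: "(\<Sum>p\<leftarrow>ps. norm (snd p)) \<le> real k * h"
    proof -
      have "(\<Sum>p\<leftarrow>ps. norm (snd p)) = (\<Sum>i<k. norm (- (1 / real (Suc i)) *\<^sub>R hs ! i))"
        by (simp add: ps_def o_def interv_sum_list_conv_sum_set_nat atLeast0LessThan del: of_nat_Suc)
      also have "\<dots> \<le> (\<Sum>i<k. h)"
      proof (intro sum_mono)
        fix i assume "i \<in> {..<k}"
        have "norm (- (1 / real (Suc i)) *\<^sub>R hs ! i) = norm (hs ! i) / real (Suc i)" by simp
        also have "\<dots> \<le> norm (hs ! i)" by (simp add: divide_le_eq mult_le_cancel_left1)
        also have "\<dots> \<le> h" using hi \<open>i \<in> {..<k}\<close> by simp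
        finally show "norm (- (1 / real (Suc i)) *\<^sub>R hs ! i) \<le> h" .
      qed
      finally show ?thesis by simp
    qed
    have "norm (\<Sum>r\<le>k. of_real (\<alpha> r) * mdiff f (map (\<lambda>p. fst p + real r *\<^sub>R snd p) ps) (x + real r *\<^sub>R 0))
        \<le> 2 ^ length ps * (A * \<bar>C k\<bar> * ((real k)\<^sup>2 * h) ^ k)"
    proof (rule mdiff_weighted_bound)
      fix y u :: 'a assume y: "norm (y - x) \<le> (\<Sum>p\<leftarrow>ps. norm (fst p))" and u: "norm (u - 0) \<le> (\<Sum>p\<leftarrow>ps. norm (snd p))"
      \<comment> \<open>Directions have length at most \<open>k * h\<close> and \<open>r\<close> is
        at most \<open>k\<close>; hence the hypothesis on
        \<open>(real k)\<^sup>2 * h\<close>.\<close>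
      define v where "v = (1 / (real k * h)) *\<^sub>R u"
      have kh: "real k * h > 0" using k h by simp
      have v1: "norm v \<le> 1" using u snd_sum kh by (simp add: v_def divide_le_eq)
      have uv: "u = (real k * h) *\<^sub>R v" using k h by (simp add: v_def)
      have "norm (y - z) < \<rho>" using y fst_sum x norm_triangle_ineq[of "y - x" "x - z"] by simp
      then obtain c where c: "\<And>p t. \<bar>t\<bar> \<le> t0 \<Longrightarrow>
          norm (f (y + t *\<^sub>R v) - (\<Sum>i<p. c i * of_real t ^ i)) \<le> C p * \<bar>t\<bar> ^ p"
        using expn v1 by blast
      let ?t = "\<lambda>r. real r * (real k * h)"
      have zero: "(\<Sum>r\<le>k. of_real (\<alpha> r) * (\<Sum>i<k. c i * of_real (?t r) ^ i)) = (0::complex)"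
      proof -
        have "(\<Sum>r\<le>k. of_real (\<alpha> r) * (\<Sum>i<k. c i * of_real (?t r) ^ i))
            = (\<Sum>i<k. \<Sum>r\<le>k. of_real (\<alpha> r) * (c i * of_real (?t r) ^ i))"
          unfolding sum_distrib_left by (rule sum.swap)
        also have "\<dots> = (\<Sum>i<k. c i * of_real ((real k * h) ^ i) * of_real (\<Sum>r\<le>k. \<alpha> r * real r ^ i))"
          by (simp add: sum_distrib_left power_mult_distrib mult_ac)
        also have "\<dots> = 0" using \<alpha>(2) by (intro sum.neutral) simp
        finally show ?thesis .
      qed
      have "norm (\<Sum>r\<le>k. of_real (\<alpha> r) * f (y + real r *\<^sub>R u))
          = norm (\<Sum>r\<le>k. of_real (\<alpha> r) * (f (y + ?t r *\<^sub>R v) - (\<Sum>i<k. c i * of_real (?t r) ^ i)))"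
        unfolding right_diff_distrib sum_subtractf zero uv by simp
      also have "\<dots> \<le> (\<Sum>r\<le>k. \<bar>\<alpha> r\<bar> * (\<bar>C k\<bar> * ((real k)\<^sup>2 * h) ^ k))"
      proof (intro order_trans[OF norm_sum] sum_mono)
        fix r assume r: "r \<in> {..k}"
        have "\<bar>?t r\<bar> = real r * (real k * h)" using h by simp
        also have "\<dots> \<le> real k * (real k * h)" using r kh by (intro mult_right_mono) auto
        finally have tr: "\<bar>?t r\<bar> \<le> (real k)\<^sup>2 * h" by (simp add: power2_eq_square)
        have "norm (f (y + ?t r *\<^sub>R v) - (\<Sum>i<k. c i * of_real (?t r) ^ i)) \<le> C k * \<bar>?t r\<bar> ^ k"
          using tr h(2) by (intro c) linarith
        also have "\<dots> \<le> \<bar>C k\<bar> * ((real k)\<^sup>2 * h) ^ k"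
          using tr by (intro mult_mono power_mono) auto
        finally show "norm (of_real (\<alpha> r) * (f (y + ?t r *\<^sub>R v) - (\<Sum>i<k. c i * of_real (?t r) ^ i)))
            \<le> \<bar>\<alpha> r\<bar> * (\<bar>C k\<bar> * ((real k)\<^sup>2 * h) ^ k)"
          unfolding norm_mult norm_of_real by (intro mult_left_mono) auto
      qed
      also have "\<dots> = A * \<bar>C k\<bar> * ((real k)\<^sup>2 * h) ^ k" by (simp only: A_def sum_distrib_right mult.assoc)
      finally show "norm (\<Sum>r\<le>k. of_real (\<alpha> r) * f (y + real r *\<^sub>R u)) \<le> A * \<bar>C k\<bar> * ((real k)\<^sup>2 * h) ^ k" .
    qed
    moreover have "(\<Sum>r\<le>k. of_real (\<alpha> r) * mdiff f (map (\<lambda>p. fst p + real r *\<^sub>R snd p) ps) (x + real r *\<^sub>R 0))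
        = (\<Sum>r\<le>k. if r = 0 then of_real (\<alpha> 0) * mdiff f hs x else 0)"
    proof (intro sum.cong refl)
      fix r assume r: "r \<in> {..k}"
      show "of_real (\<alpha> r) * mdiff f (map (\<lambda>p. fst p + real r *\<^sub>R snd p) ps) (x + real r *\<^sub>R 0)
          = (if r = 0 then of_real (\<alpha> 0) * mdiff f hs x else 0)"
      proof (cases r)
        case 0
        have "map (\<lambda>p. fst p + real 0 *\<^sub>R snd p) ps = hs"
          unfolding ps_def map_map o_def using hs(1) map_nth[of hs] by simp
        then show ?thesis using 0 by simp
      next
        case (Suc i)
        have "hs ! i + real (Suc i) *\<^sub>R (- (1 / real (Suc i)) *\<^sub>R hs ! i) = 0" by (simp del: of_nat_Suc)
        then have "0 \<in> set (map (\<lambda>p. fst p + real r *\<^sub>R snd p) ps)"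
          using r Suc unfolding ps_def by (auto simp del: of_nat_Suc intro!: image_eqI[of _ _ i])
        then show ?thesis using Suc by (simp only: mdiff_zero) simp
      qed
    qed
    ultimately have "norm (of_real (\<alpha> 0) * mdiff f hs x) \<le> 2 ^ length ps * (A * \<bar>C k\<bar> * ((real k)\<^sup>2 * h) ^ k)"
      by simp
    then show ?thesis using \<alpha>(1) by (simp add: norm_mult ps_def)
  qed
  then show ?thesis
    by (intro exI[of _ "2 ^ k * (A * \<bar>C k\<bar> * ((real k)\<^sup>2) ^ k)"]) (simp add: power_mult_distrib mult.assoc)
qed

text \<open>The bounds depend on the coefficients only, not on the remainder constants
  \<open>C\<close>. With increments \<open>t * w\<close> the mixed difference is a polynomial in
  \<open>t\<close> of degree at most \<open>k\<close> plus \<open>O(t^(k+1))\<close>, and the crude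
  order \<open>t^k\<close> from \<open>mdiff_isotropic_bound\<close> kills all coefficients below
  \<open>k\<close>. Cutting the given increments into pieces of length at most \<open>1 / N\<close>
  and letting \<open>N\<close> tend to infinity removes the error. In \<open>(2 * k)^k\<close>, the
  \<open>2^k\<close> counts the values in a difference and the \<open>k^k\<close> comes from
  directions of length up to \<open>k\<close>.\<close>

lemma mdiff_bounded_of_expansions:
  fixes f :: "'a::real_normed_vector \<Rightarrow> complex"
  assumes t0: "t0 > 0"
    and expn: "\<And>x v. norm (x - z) < \<rho> \<Longrightarrow> norm v \<le> 1 \<Longrightarrow> \<exists>c. (\<forall>k. norm (c k) \<le> B k) \<and> (\<forall>p t. \<bar>t\<bar> \<le> t0 \<longrightarrow>
      norm (f (x + t *\<^sub>R v) - (\<Sum>k<p. c k * of_real t ^ k)) \<le> C p * \<bar>t\<bar> ^ p)"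
  shows "mdiff_bounded z \<rho> f (\<lambda>k. (2 * real k) ^ k * B k)"
  unfolding mdiff_bounded_def
proof (intro allI impI)
  fix vs :: "'a list" and x assume reg: "norm (x - z) + (\<Sum>v\<leftarrow>vs. norm v) < \<rho>"
  show "norm (mdiff f vs x) \<le> (2 * real (length vs)) ^ length vs * B (length vs) * (\<Prod>v\<leftarrow>vs. norm v)"
  proof (cases "vs = []")
    case True
    then obtain c where "norm (c 0) \<le> B 0" "\<And>p t. \<bar>t\<bar> \<le> t0 \<Longrightarrow>
      norm (f (x + t *\<^sub>R 0) - (\<Sum>k<p. c k * of_real t ^ k)) \<le> C p * \<bar>t\<bar> ^ p"
      using expn[of x 0] reg by auto
    from this(1) this(2)[of 0 1] show ?thesis using True t0 by simp
  next
    case False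
    define k where "k = length vs"
    have k: "k \<ge> 1" using False by (simp add: k_def Suc_le_eq)
    obtain K where K: "\<And>hs x h. length hs = k \<Longrightarrow> (\<And>v. v \<in> set hs \<Longrightarrow> norm v \<le> h) \<Longrightarrow> 0 < h \<Longrightarrow> (real k)\<^sup>2 * h \<le> t0 \<Longrightarrow>
        norm (x - z) + real k * h < \<rho> \<Longrightarrow> norm (mdiff f hs x) \<le> K * h ^ k"
      using mdiff_isotropic_bound[OF t0 _ k, of z \<rho> f C] expn by blast
    define b where "b = 2 ^ k * (real k ^ k * B k)"
    define E where "E = (\<lambda>t. C (Suc k) * (real k * t) ^ Suc k)"
    have sharp: "norm (mdiff f (map (\<lambda>v. t *\<^sub>R v) ws) y) \<le> b * t ^ k + 2 ^ k * E t"
      if y: "norm (y - z) < \<rho>" and ws: "length ws = k" "\<And>w. w \<in> set ws \<Longrightarrow> norm w \<le> 1"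
        and t: "0 < t" "t \<le> t0 / real k" for y ws t
    proof -
      have ws_sum: "(\<Sum>w\<leftarrow>ws. norm w) \<le> real k"
        using sum_list_mono[of ws norm "\<lambda>_. 1"] ws by (simp add: sum_list_triv)
      have "\<exists>c. norm (c k) \<le> 2 ^ length ws * (real k ^ k * B k) \<and> (\<forall>t. 0 < t \<and> t \<le> t0 / real k \<longrightarrow>
        norm (mdiff f (map (\<lambda>v. t *\<^sub>R v) ws) (y + t *\<^sub>R 0) - (\<Sum>i\<le>k. c i * of_real t ^ i)) \<le> 2 ^ length ws * E t)"
      proof (rule mdiff_polynomial_approx)
        fix u :: 'a assume u: "norm (u - 0) \<le> (\<Sum>w\<leftarrow>ws. norm w)"
        define v where "v = (1 / real k) *\<^sub>R u"
        have "norm v \<le> 1" using u ws_sum k by (simp add: v_def)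
        then obtain c where c: "norm (c k) \<le> B k" "\<And>p t. \<bar>t\<bar> \<le> t0 \<Longrightarrow>
            norm (f (y + t *\<^sub>R v) - (\<Sum>i<p. c i * of_real t ^ i)) \<le> C p * \<bar>t\<bar> ^ p"
          using expn[OF y] by blast
        show "\<exists>c. norm (c k) \<le> real k ^ k * B k \<and> (\<forall>t. 0 < t \<and> t \<le> t0 / real k \<longrightarrow>
            norm (f (y + t *\<^sub>R u) - (\<Sum>i\<le>k. c i * of_real t ^ i)) \<le> E t)"
        proof (intro exI[of _ "\<lambda>i. of_nat k ^ i * c i"] conjI allI impI)
          show "norm (of_nat k ^ k * c k) \<le> real k ^ k * B k"
            using c(1) by (simp add: norm_mult norm_power mult_left_mono)
          fix t assume t: "0 < t \<and> t \<le> t0 / real k"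
          have "norm (f (y + (real k * t) *\<^sub>R v) - (\<Sum>i<Suc k. c i * of_real (real k * t) ^ i)) \<le> C (Suc k) * \<bar>real k * t\<bar> ^ Suc k"
            using t k by (intro c) (simp add: field_simps)
          moreover have "(real k * t) *\<^sub>R v = t *\<^sub>R u" using k by (simp add: v_def)
          moreover have "(\<Sum>i<Suc k. c i * of_real (real k * t) ^ i) = (\<Sum>i\<le>k. of_nat k ^ i * c i * of_real t ^ i)"
            unfolding lessThan_Suc_atMost by (intro sum.cong refl) (simp add: power_mult_distrib)
          ultimately show "norm (f (y + t *\<^sub>R u) - (\<Sum>i\<le>k. of_nat k ^ i * c i * of_real t ^ i)) \<le> E t"
            using t by (simp only: E_def) simp
        qed
      qed
      then obtain c where c: "norm (c k) \<le> b" "\<And>t. 0 < t \<Longrightarrow> t \<le> t0 / real k \<Longrightarrow>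
        norm (mdiff f (map (\<lambda>v. t *\<^sub>R v) ws) y - (\<Sum>i\<le>k. c i * of_real t ^ i)) \<le> 2 ^ k * E t"
        using ws(1) by (auto simp: b_def)
      define p where "p = (\<Sum>i\<le>k. monom (c i) i)"
      have p: "poly p w = (\<Sum>i\<le>k. c i * w ^ i)" for w by (simp add: p_def poly_sum poly_monom)
      define r where "r = min (min 1 (t0 / (real k)\<^sup>2)) (min (t0 / real k) ((\<rho> - norm (y - z)) / (2 * real k)))"
      have r0: "r > 0" using t0 k y by (simp add: r_def)
      have "monom 1 k dvd p"
      proof (rule monom_dvd_poly[OF r0])
        fix \<tau> :: real assume \<tau>: "0 < \<tau>" "\<tau> \<le> r"
        have \<tau>b: "\<tau> \<le> 1" "\<tau> \<le> t0 / (real k)\<^sup>2" "\<tau> \<le> t0 / real k" "\<tau> \<le> (\<rho> - norm (y - z)) / (2 * real k)"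
          using \<tau> by (auto simp: r_def)
        have "2 * (real k * \<tau>) \<le> \<rho> - norm (y - z)" using \<tau>b(4) k by (simp add: field_simps)
        then have reg': "norm (y - z) + real k * \<tau> < \<rho>" using \<tau> k y by (smt (verit) mult_pos_pos of_nat_0_less_iff Suc_le_eq One_nat_def)
        have "norm (mdiff f (map (\<lambda>v. \<tau> *\<^sub>R v) ws) y) \<le> K * \<tau> ^ k"
        proof (rule K)
          show "(real k)\<^sup>2 * \<tau> \<le> t0" using \<tau>b(2) k by (simp add: field_simps)
        qed (use ws \<tau> reg' in \<open>auto simp: mult_left_le\<close>)
        moreover have "norm (mdiff f (map (\<lambda>v. \<tau> *\<^sub>R v) ws) y - poly p (of_real \<tau>)) \<le> 2 ^ k * E \<tau>"
          unfolding p using \<tau> \<tau>b by (intro c)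
        moreover have "2 ^ k * E \<tau> \<le> 2 ^ k * (\<bar>C (Suc k)\<bar> * real k ^ Suc k * \<tau> ^ k)"
        proof (intro mult_left_mono)
          have "E \<tau> \<le> \<bar>C (Suc k)\<bar> * (real k * \<tau>) ^ Suc k"
            unfolding E_def using \<tau> by (intro mult_right_mono) auto
          also have "\<dots> = \<bar>C (Suc k)\<bar> * real k ^ Suc k * \<tau> ^ k * \<tau>" by (simp add: power_mult_distrib)
          also have "\<dots> \<le> \<bar>C (Suc k)\<bar> * real k ^ Suc k * \<tau> ^ k * 1" using \<tau> \<tau>b by (intro mult_left_mono) auto
          finally show "E \<tau> \<le> \<bar>C (Suc k)\<bar> * real k ^ Suc k * \<tau> ^ k" by simp
        qed auto
        ultimately have "norm (poly p (of_real \<tau>)) \<le> K * \<tau> ^ k + 2 ^ k * (\<bar>C (Suc k)\<bar> * real k ^ Suc k * \<tau> ^ k)"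
          using norm_triangle_ineq4[of "mdiff f (map (\<lambda>v. \<tau> *\<^sub>R v) ws) y" "mdiff f (map (\<lambda>v. \<tau> *\<^sub>R v) ws) y - poly p (of_real \<tau>)"]
          unfolding diff_diff_eq2 add_diff_cancel_left' by linarith
        then show "norm (poly p (of_real \<tau>)) \<le> (K + 2 ^ k * (\<bar>C (Suc k)\<bar> * real k ^ Suc k)) * \<tau> ^ k"
          by (simp only: distrib_right mult.assoc)
      qed
      then obtain q where q: "p = monom 1 k * q" by (auto elim: dvdE)
      have "c i = 0" if "i < k" for i
      proof -
        have "coeff p i = 0" using that unfolding q by (simp add: coeff_monom_mult)
        moreover have "coeff p i = c i" using that by (simp add: p_def coeff_sum)
        ultimately show ?thesis by simp
      qed
      then have "(\<Sum>i\<le>k. c i * of_real t ^ i) = c k * of_real t ^ k"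
        by (subst sum.mono_neutral_right[of _ "{k}"]) auto
      then have "norm (mdiff f (map (\<lambda>v. t *\<^sub>R v) ws) y - c k * of_real t ^ k) \<le> 2 ^ k * E t" using c(2)[OF t] by simp
      moreover have "norm (c k * of_real t ^ k) \<le> b * t ^ k"
        using c(1) t by (simp add: norm_mult norm_power mult_right_mono)
      ultimately show ?thesis
        using norm_triangle_ineq2[of "mdiff f (map (\<lambda>v. t *\<^sub>R v) ws) y" "c k * of_real t ^ k"] by linarith
    qed
    define C' where "C' = 2 ^ k * (C (Suc k) * real k ^ Suc k)"
    have ev: "norm (mdiff f vs x) \<le> (\<Prod>v\<leftarrow>vs. norm v + 1 / real N) * (b + C' * (1 / real N))"
      if N: "N \<ge> 1" "1 / real N \<le> t0 / real k" for N :: nat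
    proof -
      \<comment> \<open>The \<open>+ 1\<close> makes the number of pieces positive even for
        \<open>v = 0\<close>, and every piece of \<open>v\<close> at most \<open>1 / N\<close>
        long.\<close>
      define n where "n = (\<lambda>v::'a. nat \<lfloor>norm v * real N\<rfloor> + 1)"
      have "n v > 0" for v by (simp add: n_def)
      then have n1: "real (n v) > 0" for v by simp
      have n2: "norm v * real N \<le> real (n v)" "real (n v) \<le> norm v * real N + 1" for v
        unfolding n_def by (simp_all add: of_nat_nat) linarith+
      define ps where "ps = map (\<lambda>v. (n v, (1 / real (n v)) *\<^sub>R v)) vs"
      define ws where "ws = map (\<lambda>v. (real N / real (n v)) *\<^sub>R v) vs"
      have ps1: "map (\<lambda>p. real (fst p) *\<^sub>R snd p) ps = vs"
        using n1 by (simp add: ps_def o_def less_imp_neq[symmetric] map_idI)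
      have ps2: "map snd ps = map (\<lambda>v. (1 / real N) *\<^sub>R v) ws" using N by (simp add: ps_def ws_def)
      have ps3: "(\<Sum>p\<leftarrow>ps. real (fst p) * norm (snd p)) = (\<Sum>v\<leftarrow>vs. norm v)"
        using n1 by (simp add: ps_def o_def less_imp_neq[symmetric])
      have ps4: "(\<Prod>p\<leftarrow>ps. real (fst p)) \<le> real N ^ k * (\<Prod>v\<leftarrow>vs. norm v + 1 / real N)"
        unfolding ps_def k_def
      proof (induction vs)
        case (Cons v vs)
        have "real (n v) \<le> real N * (norm v + 1 / real N)" using n2[of v] N by (simp add: algebra_simps)
        then have "real (n v) * (\<Prod>p\<leftarrow>map (\<lambda>v. (n v, (1 / real (n v)) *\<^sub>R v)) vs. real (fst p))
          \<le> real N * (norm v + 1 / real N) * (real N ^ length vs * (\<Prod>v\<leftarrow>vs. norm v + 1 / real N))"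
          using Cons by (intro mult_mono) (auto intro!: prod_list_nonneg add_nonneg_nonneg mult_nonneg_nonneg)
        then show ?case by (simp add: mult_ac)
      qed simp
      define M where "M = b * (1 / real N) ^ k + 2 ^ k * E (1 / real N)"
      have bd: "norm (mdiff f (map snd ps) y) \<le> M" if "norm (y - x) \<le> (\<Sum>v\<leftarrow>vs. norm v)" for y
        unfolding ps2 M_def
      proof (rule sharp)
        show "norm (y - z) < \<rho>" using that reg norm_triangle_ineq[of "y - x" "x - z"] by simp
        show "length ws = k" by (simp add: ws_def k_def)
        show "norm w \<le> 1" if "w \<in> set ws" for w
          using that n1 n2 by (auto simp: ws_def divide_le_eq mult.commute)
      qed (use N in auto)
      have "norm (mdiff f vs x) \<le> (\<Prod>p\<leftarrow>ps. real (fst p)) * M"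
        using mdiff_subdivide[of x ps f M] bd unfolding ps1 ps3 by blast
      also have "M \<ge> 0" using bd[of x] reg norm_ge_zero order_trans
        by (metis cancel_comm_monoid_add_class.diff_cancel norm_zero sum_list_nonneg norm_ge_zero image_iff list.set_map)
      then have "(\<Prod>p\<leftarrow>ps. real (fst p)) * M \<le> real N ^ k * (\<Prod>v\<leftarrow>vs. norm v + 1 / real N) * M"
        by (intro mult_right_mono ps4)
      also have "\<dots> = (\<Prod>v\<leftarrow>vs. norm v + 1 / real N) * (real N ^ k * M)" by (simp only: mult_ac)
      also have "real N ^ k * M = b + C' * (1 / real N)"
        using N by (simp add: M_def E_def C'_def power_mult_distrib power_one_over field_simps)
      finally show ?thesis .
    qed
    have inv0: "(\<lambda>N. 1 / real N) \<longlonglongrightarrow> 0" by (rule lim_1_over_n)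
    have "eventually (\<lambda>N. 1 / real N < t0 / real k) sequentially"
      using inv0 t0 k by (intro order_tendstoD) auto
    then have "eventually (\<lambda>N. norm (mdiff f vs x) \<le> (\<Prod>v\<leftarrow>vs. norm v + 1 / real N) * (b + C' * (1 / real N))) sequentially"
      using eventually_ge_at_top[of 1] by eventually_elim (intro ev, auto)
    moreover have "(\<lambda>N. (\<Prod>v\<leftarrow>vs. norm v + 1 / real N)) \<longlonglongrightarrow> (\<Prod>v\<leftarrow>vs. norm v)"
    proof (induction vs)
      case (Cons v vs)
      have "(\<lambda>N. (norm v + 1 / real N) * (\<Prod>v\<leftarrow>vs. norm v + 1 / real N)) \<longlonglongrightarrow> (norm v + 0) * (\<Prod>v\<leftarrow>vs. norm v)"
        by (intro tendsto_intros inv0 Cons)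
      then show ?case by simp
    qed simp
    then have "(\<lambda>N. (\<Prod>v\<leftarrow>vs. norm v + 1 / real N) * (b + C' * (1 / real N))) \<longlonglongrightarrow> (\<Prod>v\<leftarrow>vs. norm v) * (b + C' * 0)"
      by (intro tendsto_intros inv0)
    ultimately have "norm (mdiff f vs x) \<le> (\<Prod>v\<leftarrow>vs. norm v) * (b + C' * 0)"
      by (intro tendsto_lowerbound[where F = sequentially]) auto
    then show ?thesis by (simp add: b_def k_def power_mult_distrib mult_ac)
  qed
qed

section \<open>Concave weights\<close>

locale concave_weight =
  fixes \<omega> :: "real \<Rightarrow> real"
  assumes weight: "weight_function \<omega>" and concave: "concave_on {0..} \<omega>"
begin

text \<open>With \<open>x = ln s\<close> in the conjugate this is the supremum of
  \<open>s ^ k * exp (- \<omega> s / \<rho>)\<close> over \<open>s \<ge> 1\<close>, the weight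
  sequence attached to \<open>\<omega>\<close> and \<open>\<rho>\<close>.\<close>

definition W :: "real \<Rightarrow> nat \<Rightarrow> real" where
  "W \<rho> k = exp (1 / \<rho> * young_conjugate \<omega> (\<rho> * real k))"

lemma W_pos [simp]: "W \<rho> k > 0"
  by (simp add: W_def)

lemma nonneg: "t \<ge> 0 \<Longrightarrow> \<omega> t \<ge> 0"
  using weight by (auto simp: weight_function_def)

lemma mono: "0 \<le> s \<Longrightarrow> s \<le> t \<Longrightarrow> \<omega> s \<le> \<omega> t"
  using weight by (auto simp: weight_function_def mono_on_def)

text \<open>Concavity acts through this inequality alone. It lets \<open>W\<close> absorb geometric
  factors, bounds the truncation order in \<open>W_truncation\<close>, and makes
  \<open>\<nu>\<close> comparable at consecutive dyadic scales.\<close>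

lemma scale_le:
  assumes "C \<ge> 1" "s \<ge> 0" shows "\<omega> (C * s) \<le> C * \<omega> s"
proof -
  have "(1 - 1 / C) * \<omega> 0 + 1 / C * \<omega> (C * s) \<le> \<omega> ((1 - 1 / C) * 0 + 1 / C * (C * s))"
    using concave_onD[OF concave, of "1 / C" 0 "C * s"] assms by simp
  moreover have "(1 - 1 / C) * \<omega> 0 \<ge> 0" using assms nonneg[of 0] by (intro mult_nonneg_nonneg) auto
  ultimately have "1 / C * \<omega> (C * s) \<le> \<omega> s" using assms by simp
  then show ?thesis using assms by (simp add: field_simps)
qed

lemma W_ge:
  assumes "\<rho> > 0" "s \<ge> 1"
  shows "s ^ k * exp (- \<omega> s / \<rho>) \<le> W \<rho> k"
proof -
  have "ln s * (\<rho> * real k) - \<omega> (exp (ln s)) \<le> young_conjugate \<omega> (\<rho> * real k)"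
    unfolding young_conjugate_def using assms young_conjugate_bdd_above[OF weight, of "\<rho> * real k"]
    by (intro cSUP_upper) auto
  then have "(ln s * (\<rho> * real k) - \<omega> s) / \<rho> \<le> 1 / \<rho> * young_conjugate \<omega> (\<rho> * real k)"
    using assms by (simp add: divide_right_mono)
  moreover have "(ln s * (\<rho> * real k) - \<omega> s) / \<rho> = real k * ln s + - \<omega> s / \<rho>"
    using assms by (simp add: field_simps)
  ultimately have "exp (real k * ln s + - \<omega> s / \<rho>) \<le> W \<rho> k" by (simp add: W_def)
  moreover have "exp (real k * ln s) = s ^ k" using assms by (simp add: exp_of_nat_mult)
  ultimately show ?thesis by (simp only: exp_add)
qed

lemma W_le:
  assumes "\<rho> > 0" and M: "\<And>x. x \<ge> 0 \<Longrightarrow> real k * x - \<omega> (exp x) / \<rho> \<le> M"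
  shows "W \<rho> k \<le> exp M"
proof -
  have "young_conjugate \<omega> (\<rho> * real k) \<le> \<rho> * M"
    unfolding young_conjugate_def
  proof (intro cSUP_least)
    fix x :: real assume "x \<in> {0..}"
    then show "x * (\<rho> * real k) - \<omega> (exp x) \<le> \<rho> * M"
      using mult_left_mono[OF M[of x], of \<rho>] assms(1) by (simp add: algebra_simps)
  qed auto
  then show ?thesis using assms(1) by (simp add: W_def field_simps)
qed

text \<open>Replace \<open>s\<close> by \<open>C * s\<close> in the supremum that defines
  \<open>W\<close>. A geometric factor thus costs a proportional change of \<open>\<rho>\<close>,
  which both kinds of classes tolerate.\<close>

lemma W_scale:
  assumes "\<rho> > 0" "C \<ge> 1"
  shows "C ^ k * W \<rho> k \<le> W (C * \<rho>) k"
proof -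
  have "W \<rho> k \<le> exp (ln (W (C * \<rho>) k / C ^ k))"
  proof (rule W_le[OF assms(1)])
    fix x :: real assume x: "x \<ge> 0"
    have "(C * exp x) ^ k * exp (- \<omega> (C * exp x) / (C * \<rho>)) \<le> W (C * \<rho>) k"
      using assms x mult_mono[of 1 C 1 "exp x"] by (intro W_ge) auto
    moreover have "- \<omega> (exp x) / \<rho> \<le> - \<omega> (C * exp x) / (C * \<rho>)"
      using scale_le[of C "exp x"] assms by (simp add: field_simps)
    ultimately have "(C * exp x) ^ k * exp (- \<omega> (exp x) / \<rho>) \<le> W (C * \<rho>) k"
      using assms by (elim order_trans[rotated]) (intro mult_left_mono, auto)
    then have "exp x ^ k * exp (- \<omega> (exp x) / \<rho>) \<le> W (C * \<rho>) k / C ^ k"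
      using assms by (simp add: field_simps power_mult_distrib)
    then have "exp (real k * x - \<omega> (exp x) / \<rho>) \<le> W (C * \<rho>) k / C ^ k"
      by (simp add: exp_diff exp_minus exp_of_nat_mult divide_inverse)
    then show "real k * x - \<omega> (exp x) / \<rho> \<le> ln (W (C * \<rho>) k / C ^ k)"
      using assms by (simp add: ln_ge_iff)
  qed
  then show ?thesis using assms by (simp add: field_simps)
qed

lemma ln_le_eventually:
  assumes "c > 0"
  shows "eventually (\<lambda>s. ln s \<le> c * \<omega> s) at_top"
proof -
  have o: "ln \<in> o[at_top](\<omega>)" using weight by (simp add: weight_function_def)
  show ?thesis using landau_o.smallD[OF o assms] eventually_ge_at_top[of 0]
    by eventually_elim (use nonneg in force)
qed

lemma le_linear_eventually:
  assumes "c > 0"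
  shows "eventually (\<lambda>s. \<omega> s \<le> c * s) at_top"
proof -
  have o: "\<omega> \<in> o[at_top](\<lambda>t. t)" using weight by (simp add: weight_function_def)
  show ?thesis using landau_o.smallD[OF o assms] eventually_ge_at_top[of 0]
    by eventually_elim (use nonneg in force)
qed

lemma ge_eventually: "eventually (\<lambda>s. \<omega> s \<ge> M) at_top"
proof -
  have "eventually (\<lambda>s::real. ln s \<ge> M) at_top"
    using ln_at_top unfolding filterlim_at_top by blast
  then show ?thesis using ln_le_eventually[of 1] by (auto elim: eventually_elim2)
qed

text \<open>Here \<open>n\<close> is the integer part of \<open>y / \<rho>\<close>, where \<open>y\<close> is the slope of a supporting line of \<open>\<omega> \<circ> exp\<close> at
  \<open>ln s\<close>. Concavity of \<open>\<omega>\<close> is what bounds \<open>n\<close> in terms of \<open>\<omega> s\<close>.\<close>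

lemma W_truncation:
  assumes \<rho>: "\<rho> > 0"
  shows "eventually (\<lambda>s. \<exists>n\<ge>1. real n * ln 2 \<le> \<omega> s / \<rho> \<and>
    (\<forall>k\<le>n. W \<rho> k \<le> s ^ k * exp (- (real k / real n) * (\<omega> s / \<rho> / 2)))) at_top"
proof -
  have "eventually (\<lambda>s. \<omega> s \<ge> 2 * \<omega> 1) at_top" by (rule ge_eventually)
  moreover have "eventually (\<lambda>s. ln s \<le> 1 / (2 * \<rho>) * \<omega> s) at_top" using \<rho> by (intro ln_le_eventually) auto
  moreover have "eventually (\<lambda>s::real. s \<ge> 2) at_top" by (rule eventually_ge_at_top)
  ultimately show ?thesis
  proof eventually_elim
    case (elim s)
    define x where "x = ln s"
    define \<nu> where "\<nu> = \<omega> s / \<rho>"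
    have x: "x > 0" "exp x = s" using elim(3) by (simp_all add: x_def)
    have x\<nu>: "x \<le> \<nu> / 2" using elim(2) by (simp add: x_def \<nu>_def)
    define y where "y = Inf ((\<lambda>t. (\<omega> (exp x) - \<omega> (exp t)) / (x - t)) ` ({x<..} \<inter> {0..}))"
    have conv: "convex_on {0..} (\<lambda>t. \<omega> (exp t))" using weight by (simp add: weight_function_def)
    have slope: "\<omega> (exp t) \<ge> \<omega> s + y * (t - x)" if "t \<ge> 0" for t
      using convex_le_Inf_differential[OF conv, of x t] that x by (simp add: y_def)
    \<comment> \<open>Going \<open>ln 2\<close> along the supporting line means doubling
      \<open>s\<close>, and \<open>\<omega>\<close> at most doubles then. So \<open>y * ln 2\<close>
      is at most \<open>\<omega> s\<close>.\<close>
    have "\<omega> (exp (x + ln 2)) \<le> 2 * \<omega> s"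
      using scale_le[of 2 s] elim(3) x by (simp add: exp_add mult.commute)
    then have y1: "y * ln 2 \<le> \<omega> s" using slope[of "x + ln 2"] x by simp
    have "y * x \<ge> \<omega> s - \<omega> 1" using slope[of 0] by simp
    also have "\<omega> s - \<omega> 1 \<ge> \<omega> s / 2" using elim(1) by simp
    also have "\<omega> s / 2 \<ge> \<rho> * x" using x\<nu> \<rho> by (simp add: \<nu>_def field_simps)
    finally have y2: "y \<ge> \<rho>" using x by simp
    define n where "n = nat \<lfloor>y / \<rho>\<rfloor>"
    have "1 \<le> y / \<rho>" using y2 \<rho> by simp
    then have n1: "n \<ge> 1" and n: "real n \<le> y / \<rho>" "y / \<rho> \<le> real n + 1"
      unfolding n_def by linarith+
    have "real n * ln 2 \<le> y / \<rho> * ln 2" using n by (intro mult_right_mono) auto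
    also have "\<dots> \<le> \<nu>" using y1 \<rho> by (simp add: \<nu>_def divide_right_mono)
    finally have n2: "real n * ln 2 \<le> \<nu>" .
    have "W \<rho> k \<le> s ^ k * exp (- (real k / real n) * (\<nu> / 2))" if k: "k \<le> n" for k
    proof -
      have "W \<rho> k \<le> exp (real k * x - (real k / real n) * (\<nu> / 2))"
      proof (rule W_le[OF \<rho>])
        fix t :: real assume t: "t \<ge> 0"
        \<comment> \<open>Interpolation between \<open>k = 0\<close> and \<open>k = n\<close>:
          because \<open>\<omega> \<ge> 0\<close> and \<open>q \<le> 1\<close>, the exponent for
          \<open>k\<close> is at most \<open>q\<close> times the one for \<open>n\<close>, which the
          supporting line controls. Rounding \<open>y / \<rho>\<close> to \<open>n\<close> costs at
          most \<open>x \<le> \<nu> / 2\<close>, and this is why only half of \<open>\<nu>\<close>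
          survives.\<close>
        define q where "q = real k / real n"
        have q: "0 \<le> q" "q \<le> 1" "real k = q * real n" using k n1 by (auto simp: q_def)
        have "q * (\<omega> (exp t) / \<rho>) \<le> \<omega> (exp t) / \<rho>"
          using q nonneg[of "exp t"] \<rho> by (intro mult_left_le_one_le) auto
        then have "real k * t - \<omega> (exp t) / \<rho> \<le> q * (real n * t - \<omega> (exp t) / \<rho>)"
          unfolding q(3) by (simp add: algebra_simps)
        also have "\<dots> \<le> q * ((real n + 1) * x - \<nu>)"
        proof (intro mult_left_mono q)
          have "\<nu> + y / \<rho> * (t - x) \<le> \<omega> (exp t) / \<rho>"
            using divide_right_mono[OF slope[OF t], of \<rho>] \<rho> by (simp add: \<nu>_def add_divide_distrib)
          moreover have "real n * t \<le> y / \<rho> * t" "y / \<rho> * x \<le> (real n + 1) * x"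
            using n t x by (auto intro!: mult_right_mono simp del: times_divide_eq_left)
          ultimately show "real n * t - \<omega> (exp t) / \<rho> \<le> (real n + 1) * x - \<nu>"
            by (simp only: right_diff_distrib)
        qed
        also have "\<dots> = real k * x + q * (x - \<nu>)" unfolding q(3) by (simp add: algebra_simps)
        also have "\<dots> \<le> real k * x + q * (- (\<nu> / 2))" using q x\<nu> by (intro add_left_mono mult_left_mono) auto
        finally show "real k * t - \<omega> (exp t) / \<rho> \<le> real k * x - real k / real n * (\<nu> / 2)"
          by (simp add: q_def)
      qed
      also have "\<dots> = s ^ k * exp (- (real k / real n) * (\<nu> / 2))"
        unfolding x(2)[symmetric] exp_of_nat_mult[symmetric] mult_exp_exp by simp
      finally show ?thesis .
    qed
    then show ?case using n1 n2 unfolding \<nu>_def by blast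
  qed
qed

end

section \<open>Seminorms as pointwise bounds on derivatives\<close>

context concave_weight
begin

lemma W_mono:
  assumes "0 < \<rho>" "\<rho> \<le> \<rho>'"
  shows "W \<rho> k \<le> W \<rho>' k"
proof -
  have "1 * W \<rho> k \<le> (\<rho>' / \<rho>) ^ k * W \<rho> k"
    using assms by (intro mult_right_mono one_le_power) (auto simp: less_imp_le)
  also have "\<dots> \<le> W (\<rho>' / \<rho> * \<rho>) k" using assms by (intro W_scale) auto
  finally show ?thesis using assms by simp
qed

definition deriv_bounded :: "'a::euclidean_space set \<Rightarrow> real \<Rightarrow> real \<Rightarrow> ('a \<Rightarrow> complex) \<Rightarrow> bool" where
  "deriv_bounded K C \<rho> f \<longleftrightarrow> (\<forall>x\<in>K. \<forall>vs. (\<forall>v\<in>set vs. norm v \<le> 1) \<longrightarrow>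
     norm (iter_frechet f vs x) \<le> C * W \<rho> (length vs))"

lemma deriv_boundedD:
  "deriv_bounded K C \<rho> f \<Longrightarrow> x \<in> K \<Longrightarrow> \<forall>v\<in>set vs. norm v \<le> 1 \<Longrightarrow>
    norm (iter_frechet f vs x) \<le> C * W \<rho> (length vs)"
  by (simp add: deriv_bounded_def)

lemma deriv_bounded_mono:
  assumes "deriv_bounded K C \<rho> f" "0 < \<rho>" "\<rho> \<le> \<rho>'" "0 \<le> C" "C \<le> C'"
  shows "deriv_bounded K C' \<rho>' f"
proof -
  have "C * W \<rho> k \<le> C' * W \<rho>' k" for k
    using assms W_mono[OF assms(2,3)] by (intro mult_mono) (auto simp: less_imp_le)
  then show ?thesis using assms(1) unfolding deriv_bounded_def by (meson order_trans)
qed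

lemma BMT_seminorm_bound:
  assumes "BMT_seminorm \<omega> K \<rho> f < \<infinity>"
  shows "\<exists>C\<ge>1. deriv_bounded K C \<rho> f"
proof -
  define c where "c = enn2real (BMT_seminorm \<omega> K \<rho> f)"
  have c: "BMT_seminorm \<omega> K \<rho> f = ennreal c" "c \<ge> 0"
    using assms by (simp_all add: c_def)
  have "norm (iter_frechet f vs x) \<le> max 1 c * W \<rho> (length vs)"
    if x: "x \<in> K" and vs: "\<forall>v\<in>set vs. norm v \<le> 1" for x vs
  proof -
    let ?k = "length vs"
    have "ennreal (norm (iter_frechet f vs x)) \<le> multilinear_norm ?k (\<lambda>vs. iter_frechet f vs x)"
      unfolding multilinear_norm_def by (rule SUP_upper) (use vs in auto)
    then have "ennreal (norm (iter_frechet f vs x)) * ennreal (1 / W \<rho> ?k)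
        \<le> multilinear_norm ?k (\<lambda>vs. iter_frechet f vs x) * ennreal (1 / W \<rho> ?k)"
      by (rule mult_right_mono) simp
    also have "1 / W \<rho> ?k = exp (- (1 / \<rho>) * young_conjugate \<omega> (\<rho> * real ?k))"
      by (simp add: W_def exp_minus inverse_eq_divide)
    also have "multilinear_norm ?k (\<lambda>vs. iter_frechet f vs x) * ennreal \<dots> \<le> BMT_seminorm \<omega> K \<rho> f"
      unfolding BMT_seminorm_def by (rule SUP_upper2[OF x], rule SUP_upper2[of ?k]) auto
    finally have "norm (iter_frechet f vs x) / W \<rho> ?k \<le> c"
      using c by (simp add: W_def exp_minus divide_inverse less_imp_le flip: ennreal_mult)
    then have "norm (iter_frechet f vs x) \<le> c * W \<rho> ?k" by (simp add: divide_le_eq)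
    also have "\<dots> \<le> max 1 c * W \<rho> ?k" by (intro mult_right_mono) (auto simp: less_imp_le)
    finally show ?thesis .
  qed
  then show ?thesis by (intro exI[of _ "max 1 c"]) (auto simp: deriv_bounded_def)
qed

lemma BMT_seminorm_finite:
  assumes "deriv_bounded K C \<rho> f"
  shows "BMT_seminorm \<omega> K \<rho> f < \<infinity>"
proof -
  have "BMT_seminorm \<omega> K \<rho> f \<le> ennreal C"
    unfolding BMT_seminorm_def
  proof (intro SUP_least)
    fix x k assume x: "x \<in> K"
    have "multilinear_norm k (\<lambda>vs. iter_frechet f vs x) \<le> ennreal (C * W \<rho> k)"
      unfolding multilinear_norm_def using deriv_boundedD[OF assms x] by (intro SUP_least ennreal_leI) auto
    then have "multilinear_norm k (\<lambda>vs. iter_frechet f vs x) * ennreal (1 / W \<rho> k)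
        \<le> ennreal (C * W \<rho> k) * ennreal (1 / W \<rho> k)"
      by (rule mult_right_mono) simp
    also have "\<dots> = ennreal (C * W \<rho> k * (1 / W \<rho> k))"
      by (rule ennreal_mult''[symmetric]) (simp add: less_imp_le)
    also have "C * W \<rho> k * (1 / W \<rho> k) = C" using less_imp_neq[OF W_pos[of \<rho> k]] by simp
    finally show "multilinear_norm k (\<lambda>vs. iter_frechet f vs x)
        * ennreal (exp (- (1 / \<rho>) * young_conjugate \<omega> (\<rho> * real k))) \<le> ennreal C"
      by (simp add: W_def exp_minus inverse_eq_divide)
  qed
  then show ?thesis by (rule le_less_trans) simp
qed

end

text \<open>Lagrange's form of the remainder holds for real functions only. A unimodular factor
  \<open>u\<close> makes the complex remainder real and nonnegative, and taking real parts then
  loses no constant.\<close>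

lemma Taylor_line:
  assumes smooth: "smooth_on U g" and U: "\<And>t. \<bar>t\<bar> \<le> \<bar>\<tau>\<bar> \<Longrightarrow> x + t *\<^sub>R v \<in> U"
    and M: "\<And>t. \<bar>t\<bar> \<le> \<bar>\<tau>\<bar> \<Longrightarrow> norm (iter_frechet g (replicate n v) (x + t *\<^sub>R v)) \<le> M"
  shows "norm (g (x + \<tau> *\<^sub>R v) - (\<Sum>k<n. iter_frechet g (replicate k v) x / fact k * of_real \<tau> ^ k))
    \<le> M * \<bar>\<tau>\<bar> ^ n / fact n"
proof -
  define R where "R = g (x + \<tau> *\<^sub>R v) - (\<Sum>k<n. iter_frechet g (replicate k v) x / fact k * of_real \<tau> ^ k)"
  define u where "u = (if R = 0 then 1 else cnj R / of_real (norm R))"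
  have uR: "u * R = of_real (norm R)"
  proof (cases "R = 0")
    case False
    have "u * R = of_real ((norm R)\<^sup>2) / of_real (norm R)"
      unfolding complex_norm_square using False by (simp add: u_def mult.commute)
    also have "\<dots> = of_real (norm R)" using False by (simp add: power2_eq_square)
    finally show ?thesis .
  qed simp
  have u: "norm u = 1" "Re (u * R) = norm R"
    by (auto simp: uR) (auto simp: u_def norm_divide)
  define D where "D = (\<lambda>m t. Re (u * iter_frechet g (replicate m v) (x + t *\<^sub>R v)))"
  have "\<exists>t. \<bar>t\<bar> \<le> \<bar>\<tau>\<bar> \<and> D 0 \<tau> = (\<Sum>m<n. D m 0 / fact m * \<tau> ^ m) + D n t / fact n * \<tau> ^ n"
  proof (intro Maclaurin_bi_le allI impI refl)
    fix m t assume t: "m < n \<and> \<bar>t\<bar> \<le> \<bar>\<tau>\<bar>"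
    have "(iter_frechet g (replicate m v) has_derivative frechet_derivative (iter_frechet g (replicate m v)) (at (x + t *\<^sub>R v)))
        (at (x + t *\<^sub>R v))"
      using smooth U[of t] t by (auto simp: smooth_on_def simp flip: frechet_derivative_works)
    then have "((\<lambda>t. iter_frechet g (replicate m v) (x + t *\<^sub>R v)) has_derivative
        (\<lambda>h. frechet_derivative (iter_frechet g (replicate m v)) (at (x + t *\<^sub>R v)) (h *\<^sub>R v))) (at t)"
      by (rule has_derivative_compose[rotated]) (auto intro!: derivative_eq_intros)
    then have "((\<lambda>t. Re (u * iter_frechet g (replicate m v) (x + t *\<^sub>R v))) has_derivative
        (\<lambda>h. Re (u * frechet_derivative (iter_frechet g (replicate m v)) (at (x + t *\<^sub>R v)) (h *\<^sub>R v)))) (at t)"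
      by (intro has_derivative_Re has_derivative_mult_right)
    moreover have "linear (frechet_derivative (iter_frechet g (replicate m v)) (at (x + t *\<^sub>R v)))"
      using smooth U[of t] t by (intro linear_frechet_derivative) (auto simp: smooth_on_def)
    ultimately show "(D m has_real_derivative D (Suc m) t) (at t)"
      unfolding D_def by (elim has_derivative_imp_has_field_derivative) (simp add: linear_scale algebra_simps)
  qed
  then obtain t where t: "\<bar>t\<bar> \<le> \<bar>\<tau>\<bar>"
    "D 0 \<tau> = (\<Sum>m<n. D m 0 / fact m * \<tau> ^ m) + D n t / fact n * \<tau> ^ n" by blast
  have "Re (u * R) = D 0 \<tau> - (\<Sum>m<n. D m 0 / fact m * \<tau> ^ m)"
  proof -
    have "Re (u * (iter_frechet g (replicate k v) x / fact k * of_real \<tau> ^ k)) = D k 0 / fact k * \<tau> ^ k" for k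
    proof -
      have "u * (iter_frechet g (replicate k v) x / fact k * of_real \<tau> ^ k)
          = of_real (\<tau> ^ k / fact k) * (u * iter_frechet g (replicate k v) x)" by simp
      then show ?thesis unfolding D_def by (simp only: times_complex.sel Re_complex_of_real Im_complex_of_real) simp
    qed
    then show ?thesis by (simp only: R_def right_diff_distrib sum_distrib_left minus_complex.sel Re_sum) (simp add: D_def)
  qed
  then have "norm R = D n t / fact n * \<tau> ^ n" using t u by simp
  also have "\<dots> \<le> \<bar>D n t\<bar> / fact n * \<bar>\<tau>\<bar> ^ n"
    by (rule order_trans[OF abs_ge_self]) (simp add: abs_mult power_abs)
  also have "\<dots> \<le> M / fact n * \<bar>\<tau>\<bar> ^ n"
  proof (intro mult_right_mono divide_right_mono)
    have "\<bar>D n t\<bar> \<le> norm (u * iter_frechet g (replicate n v) (x + t *\<^sub>R v))"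
      unfolding D_def by (rule abs_Re_le_cmod)
    also have "\<dots> \<le> M" using M[OF t(1)] u by (simp add: norm_mult)
    finally show "\<bar>D n t\<bar> \<le> M" .
  qed auto
  finally show ?thesis by (simp add: R_def)
qed

section \<open>Expansions of \<open>f\<close> along lines, uniform in the base point and the
  direction\<close>

context concave_weight
begin

text \<open>Bookkeeping of exponents: the approximation at scale \<open>s l\<close> has error of
  order \<open>exp (- (b * \<nu>))\<close>, comparison of neighbouring scales leaves half of the
  exponent, and passing to coefficients costs \<open>6 ^ N l \<le> exp (b / 4 * \<nu>)\<close>, so
  \<open>b / 4\<close> remains in \<open>d\<close>. Half of that serves summation over the scales,
  and the remaining \<open>b / 8\<close> appears as the parameter \<open>8 * \<rho> / b\<close>. The
  factor \<open>1 / fact k\<close> comes from \<open>1 / R (Suc l) = H * s l / \<nu> (s l)\<close>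
  and the degree bound: coefficients occur for \<open>k \<le> \<nu> (s l)\<close> only, where
  \<open>\<nu> (s l) ^ k\<close> is at least \<open>fact k\<close>.\<close>

lemma root_expansion:
  fixes f :: "'a::euclidean_space \<Rightarrow> complex"
  assumes j: "j \<ge> 1" and m: "m = 2 * j\<^sup>2 * (j + 1)" and b: "b = 1 / (8 * real m)"
    and \<theta>: "\<theta> = b / 2" and \<kappa>: "\<kappa> = (1 / 288) ^ m" and \<sigma>: "\<sigma> = exp (- (24 / b)) / 4"
    and H: "H = 1 / (\<sigma> * \<kappa> * \<theta>)"
    and \<rho>: "\<rho> > 0" and A: "A \<ge> 1" and t1: "t1 > 0"
    and smooth: "smooth_on U (\<lambda>x. f x ^ j)" "smooth_on U (\<lambda>x. f x ^ (j + 1))"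
    and KU: "K \<subseteq> U" and X: "\<And>x v t. x \<in> X \<Longrightarrow> norm v \<le> 1 \<Longrightarrow> \<bar>t\<bar> \<le> t1 \<Longrightarrow> x + t *\<^sub>R v \<in> K"
    and bd: "deriv_bounded K A \<rho> (\<lambda>x. f x ^ j)" "deriv_bounded K A \<rho> (\<lambda>x. f x ^ (j + 1))"
  shows "\<exists>D t0 C. t0 > 0 \<and> D \<ge> 0 \<and> (\<forall>x v. x \<in> X \<and> norm v \<le> 1 \<longrightarrow>
    (\<exists>c. (\<forall>k. norm (c k) \<le> D * H ^ k * W (8 * \<rho> / b) k / fact k) \<and>
      (\<forall>p t. \<bar>t\<bar> \<le> t0 \<longrightarrow> norm (f (x + t *\<^sub>R v) - (\<Sum>k<p. c k * of_real t ^ k)) \<le> C p * \<bar>t\<bar> ^ p)))"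
proof -
  define \<nu> where "\<nu> = (\<lambda>s. \<omega> s / \<rho>)"
  define r where "r = (\<lambda>s. \<kappa> * \<theta> * \<nu> s / s)"
  define C1 where "C1 = 2 * A ^ (j + 1)"
  have "m \<ge> 1" using j by (simp add: m Suc_le_eq)
  then have b0: "b > 0" by (simp add: b)
  have \<theta>0: "\<theta> > 0" and \<kappa>0: "\<kappa> > 0" and \<sigma>0: "\<sigma> > 0" using b0 by (simp_all add: \<theta> \<kappa> \<sigma>)
  then have H0: "H > 0" by (simp add: H)
  have C10: "C1 > 0" using A by (simp add: C1_def)
  \<comment> \<open>Besides the truncation data: \<open>r s \<le> t1\<close>, so that the lines stay
    in \<open>K\<close>; \<open>\<nu> s \<ge> 1\<close> and
    \<open>C1 * exp (- (2 * b * \<nu> s)) \<le> 1 / 2\<close>; and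
    \<open>s \<le> exp (b / 8 * \<nu> s)\<close>, which makes the dyadic scales summable.\<close>
  define good where "good = (\<lambda>s. (\<exists>n\<ge>1. real n * ln 2 \<le> \<nu> s \<and>
      (\<forall>k\<le>n. W \<rho> k \<le> s ^ k * exp (- (real k / real n) * (\<nu> s / 2)))) \<and>
      \<omega> s \<le> t1 * \<rho> / (\<kappa> * \<theta>) * s \<and> \<omega> s \<ge> \<rho> * max 1 (ln (2 * C1) / (2 * b)) \<and> ln s \<le> b / 8 / \<rho> * \<omega> s)"
  have "eventually (\<lambda>s. \<exists>n\<ge>1. real n * ln 2 \<le> \<nu> s \<and>
      (\<forall>k\<le>n. W \<rho> k \<le> s ^ k * exp (- (real k / real n) * (\<nu> s / 2)))) at_top"
    unfolding \<nu>_def by (rule W_truncation[OF \<rho>])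
  moreover have "eventually (\<lambda>s. \<omega> s \<le> t1 * \<rho> / (\<kappa> * \<theta>) * s) at_top"
    using t1 \<rho> \<kappa>0 \<theta>0 by (intro le_linear_eventually) auto
  moreover have "eventually (\<lambda>s. \<omega> s \<ge> \<rho> * max 1 (ln (2 * C1) / (2 * b))) at_top" by (rule ge_eventually)
  moreover have "eventually (\<lambda>s. ln s \<le> b / 8 / \<rho> * \<omega> s) at_top" using b0 \<rho> by (intro ln_le_eventually) auto
  ultimately have "eventually good at_top" unfolding good_def by eventually_elim simp
  then obtain s0' where s0': "\<And>s. s \<ge> s0' \<Longrightarrow> good s" unfolding eventually_at_top_linorder by blast
  define s0 where "s0 = max 1 s0'"
  define s where "s = (\<lambda>l::nat. s0 * 2 ^ l)"
  have s1: "s l \<ge> 2 ^ l" for l unfolding s_def s0_def by simp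
  have s1': "s l \<ge> 1" for l by (rule order_trans[OF _ s1]) simp
  have ss: "s (Suc l) = 2 * s l" for l by (simp add: s_def)
  have "s l \<ge> s0'" for l
  proof -
    have "s0 * 1 \<le> s l" unfolding s_def by (intro mult_left_mono) (auto simp: s0_def)
    then show ?thesis by (simp add: s0_def)
  qed
  note props = s0'[OF this, unfolded good_def]
  have \<nu>1: "\<nu> (s l) \<ge> 1" for l
  proof -
    have "\<rho> * 1 \<le> \<rho> * max 1 (ln (2 * C1) / (2 * b))" using \<rho> by (intro mult_left_mono) auto
    also have "\<dots> \<le> \<omega> (s l)" using props[of l] by blast
    finally show ?thesis using \<rho> by (simp add: \<nu>_def field_simps)
  qed
  have \<nu>C: "C1 * exp (- (2 * b * \<nu> (s l))) \<le> 1 / 2" for l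
  proof -
    have "\<rho> * (ln (2 * C1) / (2 * b)) \<le> \<rho> * max 1 (ln (2 * C1) / (2 * b))" using \<rho> by (intro mult_left_mono) auto
    also have "\<dots> \<le> \<omega> (s l)" using props[of l] by blast
    finally have "ln (2 * C1) \<le> 2 * b * \<nu> (s l)" using \<rho> b0 by (simp add: \<nu>_def field_simps)
    then have "exp (ln (2 * C1)) \<le> exp (2 * b * \<nu> (s l))" by simp
    then have "2 * C1 \<le> exp (2 * b * \<nu> (s l))" using C10 by simp
    then show ?thesis by (simp add: exp_minus field_simps)
  qed
  have rt1: "r (s l) \<le> t1" for l
  proof -
    have "\<omega> (s l) \<le> t1 * \<rho> / (\<kappa> * \<theta>) * s l" using props[of l] by blast
    then show ?thesis using \<rho> \<kappa>0 \<theta>0 s1'[of l] by (simp add: r_def \<nu>_def field_simps)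
  qed
  have exp_half: "exp (- (b / 8 * \<nu> (s l))) \<le> (1 / 2) ^ l" for l
  proof -
    have "ln (s l) \<le> b / 8 * \<nu> (s l)" using props[of l] by (simp add: \<nu>_def)
    then have "exp (ln (s l)) \<le> exp (b / 8 * \<nu> (s l))" by simp
    then have "2 ^ l \<le> exp (b / 8 * \<nu> (s l))" using s1[of l] s1'[of l] by simp
    then have "1 / exp (b / 8 * \<nu> (s l)) \<le> 1 / 2 ^ l" by (intro divide_left_mono) auto
    then show ?thesis by (simp add: exp_minus inverse_eq_divide power_one_over)
  qed
  have \<nu>2: "\<nu> (s (Suc l)) \<le> 2 * \<nu> (s l)" for l
    using scale_le[of 2 "s l"] s1'[of l] \<rho> by (simp add: ss \<nu>_def divide_right_mono)
  have \<nu>mono: "\<nu> (s l) \<le> \<nu> (s (Suc l))" for l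
    using mono[of "s l" "2 * s l"] s1'[of l] \<rho> by (simp add: ss \<nu>_def divide_right_mono)
  have r0: "r (s l) > 0" for l using \<kappa>0 \<theta>0 \<nu>1[of l] s1'[of l] by (simp add: r_def)
  have rdec: "r (s (Suc l)) \<le> r (s l)" for l
  proof -
    have "\<kappa> * \<theta> * \<nu> (s (Suc l)) / s (Suc l) \<le> \<kappa> * \<theta> * (2 * \<nu> (s l)) / s (Suc l)"
      using \<nu>2[of l] \<kappa>0 \<theta>0 s1'[of "Suc l"] by (intro divide_right_mono mult_left_mono) auto
    also have "\<dots> = r (s l)" by (simp add: ss r_def)
    finally show ?thesis by (simp add: r_def)
  qed
  \<comment> \<open>Shifted by one because \<open>q (Suc i)\<close> will be the approximation made
    at scale \<open>s i\<close>; truncated subtraction gives \<open>R 0 = R 1\<close>.\<close>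
  define R where "R = (\<lambda>l. \<sigma> * r (s (l - 1)))"
  have RSuc: "R (Suc l) = \<sigma> * r (s l)" for l by (simp add: R_def)
  have R0: "R l > 0" for l using \<sigma>0 r0 by (simp add: R_def)
  have Rdec: "R (Suc l) \<le> R l" for l
    using rdec[of "l - 1"] \<sigma>0 by (cases l) (simp_all add: R_def)
  have Rlim: "R \<longlonglongrightarrow> 0"
  proof -
    have o: "\<omega> \<in> o[at_top](\<lambda>t. t)" using weight by (simp add: weight_function_def)
    have "filterlim s at_top sequentially"
    proof (rule filterlim_at_top_mono[OF filterlim_real_sequentially])
      have "real l \<le> s l" for l using of_nat_less_two_power[of l, where 'a = real] s1[of l] by linarith
      then show "eventually (\<lambda>l. real l \<le> s l) sequentially" by simp
    qed
    then have "(\<lambda>l. \<omega> (s l) / s l) \<longlonglongrightarrow> 0"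
      by (rule filterlim_compose[OF smalloD_tendsto[OF o]])
    then have "(\<lambda>l. \<sigma> * \<kappa> * \<theta> / \<rho> * (\<omega> (s l) / s l)) \<longlonglongrightarrow> \<sigma> * \<kappa> * \<theta> / \<rho> * 0" by (intro tendsto_intros)
    then have "(\<lambda>l. R (Suc l)) \<longlonglongrightarrow> 0" by (simp add: RSuc r_def \<nu>_def mult_ac)
    then show ?thesis by (rule LIMSEQ_imp_Suc)
  qed
  have RH: "1 / R (Suc l) = H * s l / \<nu> (s l)" for l
    by (simp add: RSuc r_def H)
  have W8: "s l ^ k * exp (- (b / 8 * \<nu> (s l))) \<le> W (8 * \<rho> / b) k" for l k
    using W_ge[of "8 * \<rho> / b" "s l" k] \<rho> b0 s1'[of l] by (simp add: \<nu>_def mult_ac)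
  \<comment> \<open>One factor is spent on the bound by \<open>W\<close>, the other on the geometric
    factor \<open>(1 / 2) ^ l\<close>.\<close>
  have expsplit: "exp (- (b / 4 * \<nu> (s l))) = exp (- (b / 8 * \<nu> (s l))) * exp (- (b / 8 * \<nu> (s l)))" for l
    unfolding mult_exp_exp by simp
  have sW: "s l ^ k * exp (- (b / 4 * \<nu> (s l))) \<le> W (8 * \<rho> / b) k * (1 / 2) ^ l" for l k
    unfolding expsplit mult.assoc[symmetric] using W8[of l k] exp_half[of l] s1'[of l] by (intro mult_mono) (auto simp: less_imp_le)
  define C2 where "C2 = 159 * A * C1"
  have C20: "C2 > 0" using A C10 by (simp add: C2_def)
  define F0 where "F0 = max 1 (A * W \<rho> 0)"
  \<comment> \<open>The second summand is for the start \<open>q 0 = 0\<close>, where nothing is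
    small: it inflates the bounds \<open>F0\<close> for \<open>f\<close> and \<open>F0 + C2\<close>
    for \<open>q 1\<close> so that they take the same form as those at later scales.\<close>
  define D0 where "D0 = 2 * C2 + (F0 + C2) * exp (b / 2 * \<nu> (s 0))"
  have F01: "F0 \<ge> 1" by (simp add: F0_def)
  have D00: "D0 > 0" using C20 F01 by (simp add: D0_def add_pos_pos)
  define d where "d = (\<lambda>l. D0 * exp (- (b / 4 * \<nu> (s l))))"
  have d_pos: "d l > 0" for l using D00 by (simp add: d_def)
  have dW: "d l * (H * s l) ^ k \<le> D0 * H ^ k * W (8 * \<rho> / b) k * (1 / 2) ^ l" for l k
  proof -
    have "d l * (H * s l) ^ k = D0 * H ^ k * (s l ^ k * exp (- (b / 4 * \<nu> (s l))))"
      by (simp add: d_def power_mult_distrib)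
    also have "\<dots> \<le> D0 * H ^ k * (W (8 * \<rho> / b) k * (1 / 2) ^ l)" using sW D00 H0 by (intro mult_left_mono) auto
    finally show ?thesis by simp
  qed
  have dR: "d l / R (Suc l) ^ k = d l * (H * s l) ^ k / \<nu> (s l) ^ k" for l k
  proof -
    have "d l / R (Suc l) ^ k = d l * (1 / R (Suc l)) ^ k" by (simp add: power_one_over)
    then show ?thesis unfolding RH by (simp add: power_divide)
  qed
  have geo: "(\<lambda>l. c * (1 / 2) ^ l) sums (c * 2)" for c :: real
    using sums_mult[OF geometric_sums[of "1 / 2 :: real"], of c] by simp
  have "summable (\<lambda>l. d l / R (Suc l) ^ M)" for M
  proof (rule summable_comparison_test'[OF sums_summable[OF geo], of 0])
    fix l :: nat
    have "d l * (H * s l) ^ M / \<nu> (s l) ^ M \<le> d l * (H * s l) ^ M / 1"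
      using \<nu>1[of l] d_pos[of l] H0 s1'[of l] by (intro divide_left_mono) auto
    also have "\<dots> \<le> D0 * H ^ M * W (8 * \<rho> / b) M * (1 / 2) ^ l" using dW by simp
    finally show "norm (d l / R (Suc l) ^ M) \<le> D0 * H ^ M * W (8 * \<rho> / b) M * (1 / 2) ^ l"
      unfolding dR[symmetric] using d_pos[of l] R0[of "Suc l"] by simp
  qed
  then have S: "(\<lambda>l. d l / R (Suc l) ^ M) sums (\<Sum>l. d l / R (Suc l) ^ M)" for M by (rule summable_sums)
  define N where "N = (\<lambda>l. nat \<lfloor>b / 8 * \<nu> (s l)\<rfloor>)"
  have b8: "b / 8 \<le> 1"
    using \<open>m \<ge> 1\<close> by (simp add: b divide_simps)
  have N\<nu>: "real (N l) \<le> b / 8 * \<nu> (s l)" for l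
    unfolding N_def using b0 \<nu>1[of l] by (intro of_nat_floor) auto
  have Nmono: "N l \<le> N (Suc l)" for l
    unfolding N_def using \<nu>mono[of l] b0 by (intro nat_mono floor_mono mult_left_mono) auto
  have six: "6 ^ N l \<le> exp (b / 4 * \<nu> (s l))" for l
  proof -
    have "(6::real) \<le> exp 2"
    proof -
      have "(6::real) \<le> (5 / 2) ^ 2" by (simp add: power2_eq_square)
      also have "\<dots> \<le> exp 1 ^ 2" using exp_lower_Taylor_quadratic[of "1::real"] by (intro power_mono) auto
      also have "\<dots> = exp 2" by (simp flip: exp_of_nat_mult)
      finally show ?thesis .
    qed
    then have "(6::real) ^ N l \<le> exp 2 ^ N l" by (intro power_mono) auto
    also have "\<dots> = exp (real (N l) * 2)" by (rule exp_of_nat_mult[symmetric])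
    also have "\<dots> \<le> exp (b / 4 * \<nu> (s l))" using N\<nu>[of l] by simp
    finally show ?thesis .
  qed
  have line: "\<exists>c. (\<forall>k. norm (c k) \<le> (2 * D0) * H ^ k * W (8 * \<rho> / b) k / fact k) \<and>
      (\<forall>p t. \<bar>t\<bar> \<le> R 0 / 2 \<longrightarrow> norm (f (x + t *\<^sub>R v) - (\<Sum>k<p. c k * of_real t ^ k))
        \<le> (3 + real p) * 2 ^ p * (\<Sum>l. d l / R (Suc l) ^ p) * \<bar>t\<bar> ^ p)"
    if x: "x \<in> X" and v: "norm v \<le> 1" for x v
  proof -
    define \<phi> where "\<phi> = (\<lambda>t. f (x + t *\<^sub>R v))"
    have v': "\<forall>w\<in>set (replicate k v). norm w \<le> 1" for k using v by simp
    have xK: "x \<in> K" using X[OF x v, of 0] t1 by simp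
    have "\<exists>T. degree T \<le> N l \<and> (\<forall>t. \<bar>t\<bar> \<le> R (Suc l) \<longrightarrow> norm (\<phi> t - poly T (of_real t)) \<le> C2 * exp (- (b * \<nu> (s l))))" for l
    proof -
      obtain n where n: "n \<ge> 1" "real n * ln 2 \<le> \<nu> (s l)"
        "\<And>k. k \<le> n \<Longrightarrow> W \<rho> k \<le> s l ^ k * exp (- (real k / real n) * (\<nu> (s l) / 2))" using props[of l] by blast
      have coef: "norm (iter_frechet G (replicate k v) x / fact k) \<le> A * (s l ^ k * exp (- (real k / real n) * (\<nu> (s l) / 2))) / fact k"
        if G: "deriv_bounded K A \<rho> G" and k: "k < n" for G k
      proof -
        have "norm (iter_frechet G (replicate k v) x) \<le> A * W \<rho> k" using deriv_boundedD[OF G xK v'[of k]] by simp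
        also have "\<dots> \<le> A * (s l ^ k * exp (- (real k / real n) * (\<nu> (s l) / 2)))"
          using n(3)[of k] k A by (intro mult_left_mono) auto
        finally show ?thesis by (simp add: norm_divide divide_right_mono)
      qed
      have tay: "norm (G (x + t *\<^sub>R v) - (\<Sum>k<n. iter_frechet G (replicate k v) x / fact k * of_real t ^ k))
          \<le> A * (s l ^ n * exp (- (\<nu> (s l) / 2))) * \<bar>t\<bar> ^ n / fact n"
        if G: "deriv_bounded K A \<rho> G"
          and Gs: "smooth_on U G" and t: "\<bar>t\<bar> \<le> r (s l)" for G t
      proof (rule Taylor_line[OF Gs])
        fix \<tau> assume "\<bar>\<tau>\<bar> \<le> \<bar>t\<bar>"
        then have \<tau>: "\<bar>\<tau>\<bar> \<le> t1" using t rt1[of l] by linarith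
        have K: "x + \<tau> *\<^sub>R v \<in> K" by (rule X[OF x v \<tau>])
        then show "x + \<tau> *\<^sub>R v \<in> U" using KU by blast
        have "norm (iter_frechet G (replicate n v) (x + \<tau> *\<^sub>R v)) \<le> A * W \<rho> n" using deriv_boundedD[OF G K v'[of n]] by simp
        also have "\<dots> \<le> A * (s l ^ n * exp (- (\<nu> (s l) / 2)))"
          using n(3)[of n] n(1) A by (intro mult_left_mono) auto
        finally show "norm (iter_frechet G (replicate n v) (x + \<tau> *\<^sub>R v)) \<le> A * (s l ^ n * exp (- (\<nu> (s l) / 2)))" .
      qed
      show ?thesis unfolding RSuc N_def C2_def
      proof (rule line_polynomial_approx[OF j m b \<theta> \<kappa> \<sigma> n(1,2) _ A _ C1_def \<nu>C])
        show "s l > 0" using s1'[of l] by simp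
        show "r (s l) = \<kappa> * \<theta> * \<nu> (s l) / s l" by (simp add: r_def)
      qed (unfold \<phi>_def, (rule coef[OF bd(1)] coef[OF bd(2)] tay[OF bd(1) smooth(1)] tay[OF bd(2) smooth(2)]; assumption)+)
    qed
    then obtain T where T: "\<And>l. degree (T l) \<le> N l"
      "\<And>l t. \<bar>t\<bar> \<le> R (Suc l) \<Longrightarrow> norm (\<phi> t - poly (T l) (of_real t)) \<le> C2 * exp (- (b * \<nu> (s l)))" by metis
    define q where "q = (\<lambda>l. case l of 0 \<Rightarrow> 0 | Suc i \<Rightarrow> T i)"
    have \<phi>F: "norm (\<phi> t) \<le> F0" if t: "\<bar>t\<bar> \<le> R 0" for t
    proof (rule ccontr)
      assume "\<not> norm (\<phi> t) \<le> F0"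
      then have big: "norm (\<phi> t) > F0" by simp
      have "exp (- (24 / b)) \<le> 1" using b0 by simp
      then have "\<sigma> \<le> 1" unfolding \<sigma> by linarith
      then have "R 0 \<le> 1 * r (s 0)" unfolding R_def using r0[of 0] by (intro mult_mono) auto
      then have "\<bar>t\<bar> \<le> t1" using t rt1[of 0] by simp
      then have "x + t *\<^sub>R v \<in> K" using X[OF x v] by blast
      then have "norm (\<phi> t ^ j) \<le> A * W \<rho> 0" using deriv_boundedD[OF bd(1), of "x + t *\<^sub>R v" "[]"] by (simp add: \<phi>_def)
      then have "norm (\<phi> t) ^ j \<le> F0" by (simp add: norm_power F0_def)
      moreover have "norm (\<phi> t) \<le> norm (\<phi> t) ^ j" using big F01 j by (intro self_le_power) auto
      ultimately show False using big by simp
    qed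
    \<comment> \<open>As \<open>\<nu>\<close> at most doubles from one scale to the next, the error
      of the coarser approximation still carries half of the exponent of the finer scale.\<close>
    have half: "exp (- (b * \<nu> (s l))) \<le> exp (- (b / 2 * \<nu> (s (Suc l))))" for l
      using mult_left_mono[OF \<nu>2[of l], of "b / 2"] b0 by simp
    have half': "exp (- (b * \<nu> (s l))) \<le> exp (- (b / 2 * \<nu> (s l)))" for l
      using b0 \<nu>1[of l] by simp
    have quarter: "exp (- (b / 2 * \<nu> (s l))) \<le> exp (- (b / 4 * \<nu> (s l)))" for l
      using b0 \<nu>1[of l] by simp
    have D0C: "2 * C2 \<le> D0" using C20 F01 by (simp add: D0_def)
    have D0F: "(F0 + C2) * exp (b / 2 * \<nu> (s 0)) \<le> D0" using C20 by (simp add: D0_def)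
    have qd: "norm (\<phi> t - poly (q l) (of_real t)) \<le> d l" if t: "\<bar>t\<bar> \<le> R l" for l t
    proof (cases l)
      case 0
      have "F0 * 1 \<le> (F0 + C2) * exp (b / 4 * \<nu> (s 0))"
        using F01 C20 b0 \<nu>1[of 0] by (intro mult_mono) auto
      also have "\<dots> = (F0 + C2) * exp (b / 2 * \<nu> (s 0)) * exp (- (b / 4 * \<nu> (s 0)))"
        unfolding mult.assoc mult_exp_exp by simp
      also have "\<dots> \<le> d 0" unfolding d_def using D0F by (intro mult_right_mono) auto
      finally show ?thesis using \<phi>F[of t] t 0 by (simp add: q_def)
    next
      case (Suc i)
      have "norm (\<phi> t - poly (T i) (of_real t)) \<le> C2 * exp (- (b * \<nu> (s i)))" using t Suc by (intro T) simp
      also have "\<dots> \<le> C2 * exp (- (b / 4 * \<nu> (s (Suc i))))"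
        using C20 order_trans[OF half quarter] by (intro mult_left_mono) auto
      also have "\<dots> \<le> d (Suc i)" unfolding d_def using D0C C20 by (intro mult_right_mono) auto
      finally show ?thesis using Suc by (simp add: q_def)
    qed
    have degq: "degree (q (Suc l) - q l) \<le> N l" for l
      using T(1) order_trans[OF T(1) Nmono] by (cases l) (auto simp: q_def intro!: degree_diff_le)
    have qc: "norm (coeff (q (Suc l) - q l) k) \<le> d l / R (Suc l) ^ k" for l k
    proof -
      have "\<exists>M. M * exp (b / 2 * \<nu> (s l)) \<le> D0 \<and> (\<forall>t. \<bar>t\<bar> \<le> R (Suc l) \<longrightarrow> norm (poly (q (Suc l) - q l) (of_real t)) \<le> M)"
      proof (cases l)
        case 0
        have "norm (poly (q (Suc l) - q l) (of_real t)) \<le> F0 + C2" if t: "\<bar>t\<bar> \<le> R (Suc l)" for t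
        proof -
          have "norm (\<phi> t) \<le> F0" using t 0 by (intro \<phi>F) (simp add: R_def)
          moreover have "norm (\<phi> t - poly (T 0) (of_real t)) \<le> C2 * exp (- (b * \<nu> (s 0)))" using t 0 by (intro T) simp
          moreover have "C2 * exp (- (b * \<nu> (s 0))) \<le> C2 * 1" using C20 b0 \<nu>1[of 0] by (intro mult_left_mono) auto
          ultimately show ?thesis
            using norm_triangle_ineq4[of "\<phi> t" "\<phi> t - poly (T 0) (of_real t)"] 0 by (simp add: q_def)
        qed
        then show ?thesis using D0F 0 by blast
      next
        case (Suc i)
        have "norm (poly (q (Suc l) - q l) (of_real t)) \<le> 2 * C2 * exp (- (b / 2 * \<nu> (s l)))" if t: "\<bar>t\<bar> \<le> R (Suc l)" for t
        proof -
          have "norm (\<phi> t - poly (T l) (of_real t)) \<le> C2 * exp (- (b * \<nu> (s l)))" using t by (intro T)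
          also have "\<dots> \<le> C2 * exp (- (b / 2 * \<nu> (s l)))" using C20 half'[of l] by (intro mult_left_mono) auto
          finally have 1: "norm (\<phi> t - poly (T l) (of_real t)) \<le> C2 * exp (- (b / 2 * \<nu> (s l)))" .
          have "norm (\<phi> t - poly (T i) (of_real t)) \<le> C2 * exp (- (b * \<nu> (s i)))"
            using t Rdec[of l] Suc by (intro T) simp
          also have "\<dots> \<le> C2 * exp (- (b / 2 * \<nu> (s l)))" using C20 half[of i] Suc by (intro mult_left_mono) auto
          finally have 2: "norm (\<phi> t - poly (T i) (of_real t)) \<le> C2 * exp (- (b / 2 * \<nu> (s l)))" .
          have "norm ((\<phi> t - poly (T i) (of_real t)) - (\<phi> t - poly (T l) (of_real t)))
              \<le> C2 * exp (- (b / 2 * \<nu> (s l))) + C2 * exp (- (b / 2 * \<nu> (s l)))"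
            by (rule order_trans[OF norm_triangle_ineq4 add_mono[OF 2 1]])
          then show ?thesis using Suc by (simp add: q_def)
        qed
        moreover have "2 * C2 * exp (- (b / 2 * \<nu> (s l))) * exp (b / 2 * \<nu> (s l)) \<le> D0"
          unfolding mult.assoc mult_exp_exp using D0C by simp
        ultimately show ?thesis by blast
      qed
      then obtain M where M: "M * exp (b / 2 * \<nu> (s l)) \<le> D0"
        "\<And>t. \<bar>t\<bar> \<le> R (Suc l) \<Longrightarrow> norm (poly (q (Suc l) - q l) (of_real t)) \<le> M" by blast
      have M0: "M \<ge> 0" using order_trans[OF norm_ge_zero M(2)[of 0]] R0[of "Suc l"] by simp
      have "norm (coeff (q (Suc l) - q l) k) \<le> 6 ^ N l * M / R (Suc l) ^ k"
        by (rule poly_coeff_bound_real[OF degq R0 M(2)])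
      also have "6 ^ N l * M \<le> exp (b / 4 * \<nu> (s l)) * M" using six M0 by (intro mult_right_mono)
      also have "\<dots> = M * exp (b / 2 * \<nu> (s l)) * exp (- (b / 4 * \<nu> (s l)))"
        unfolding mult.assoc mult_exp_exp by simp
      also have "\<dots> \<le> d l" unfolding d_def using M(1) by (intro mult_right_mono) auto
      finally show ?thesis using R0[of "Suc l"] by (simp add: divide_right_mono)
    qed
    obtain c where c: "\<And>k. (\<lambda>l. coeff (q (Suc l) - q l) k) sums c k"
      "\<And>p t. \<bar>t\<bar> \<le> R 0 / 2 \<Longrightarrow> norm (\<phi> t - (\<Sum>k<p. c k * of_real t ^ k))
        \<le> (3 + real p) * 2 ^ p * (\<Sum>l. d l / R (Suc l) ^ p) * \<bar>t\<bar> ^ p"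
      using peano_expansion[OF _ R0 Rdec Rlim qd qc S] by (auto simp: q_def)
    have "norm (c k) \<le> (2 * D0) * H ^ k * W (8 * \<rho> / b) k / fact k" for k
    proof -
      have "norm (c k) \<le> D0 * H ^ k * W (8 * \<rho> / b) k / fact k * 2"
      proof (rule norm_sums_le[OF c(1) geo])
        fix l
        show "norm (coeff (q (Suc l) - q l) k) \<le> D0 * H ^ k * W (8 * \<rho> / b) k / fact k * (1 / 2) ^ l"
        proof (cases "k \<le> N l")
          case False
          then have "coeff (q (Suc l) - q l) k = 0" using degq[of l] by (intro coeff_eq_0) simp
          then show ?thesis using D00 H0 by (simp add: less_imp_le)
        next
          case True
          have "real k \<le> \<nu> (s l)"
          proof -
            have "real k \<le> real (N l)" using True by simp
            also have "\<dots> \<le> b / 8 * \<nu> (s l)" by (rule N\<nu>)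
            also have "\<dots> \<le> 1 * \<nu> (s l)" using b8 \<nu>1[of l] by (intro mult_right_mono) auto
            finally show ?thesis by simp
          qed
          then have "real k ^ k \<le> \<nu> (s l) ^ k" by (intro power_mono) auto
          moreover have "fact k \<le> real k ^ k" using fact_le_power[of k, where 'a = real] by simp
          ultimately have fk: "fact k \<le> \<nu> (s l) ^ k" by linarith
          have "norm (coeff (q (Suc l) - q l) k) \<le> d l * (H * s l) ^ k / \<nu> (s l) ^ k" using qc[of l k] unfolding dR .
          also have "\<dots> \<le> d l * (H * s l) ^ k / fact k"
            using fk d_pos[of l] H0 s1'[of l] \<nu>1[of l] by (intro divide_left_mono) auto
          also have "\<dots> \<le> D0 * H ^ k * W (8 * \<rho> / b) k * (1 / 2) ^ l / fact k" using dW by (intro divide_right_mono) auto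
          finally show ?thesis by simp
        qed
      qed
      then show ?thesis by (simp add: mult_ac)
    qed
    then show ?thesis using c(2) unfolding \<phi>_def by blast
  qed
  show ?thesis
    by (rule exI[of _ "2 * D0"], rule exI[of _ "R 0 / 2"],
        rule exI[of _ "\<lambda>p. (3 + real p) * 2 ^ p * (\<Sum>l. d l / R (Suc l) ^ p)"])
      (use line R0[of 0] D00 in auto)
qed

end

section \<open>Constants depending on \<open>j\<close> only, and the seminorm estimate\<close>

definition root_exponent :: "nat \<Rightarrow> real" where
  "root_exponent j = 1 / (8 * real (2 * j\<^sup>2 * (j + 1)))"

text \<open>The product \<open>\<sigma> * \<kappa> * \<theta>\<close> of the line approximation,
  which is \<open>1 / H\<close> in \<open>root_expansion\<close>.\<close>

definition root_radius :: "nat \<Rightarrow> real" where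
  "root_radius j = exp (- (24 / root_exponent j)) / 4 * (1 / 288) ^ (2 * j\<^sup>2 * (j + 1)) * (root_exponent j / 2)"

text \<open>The 8 over the exponent comes from \<open>root_expansion\<close>. The maximum absorbs
  \<open>H ^ k\<close> together with \<open>(2 * k)^k / k!\<close>, which is at most
  \<open>6 ^ k\<close>, by means of \<open>W_scale\<close>; it is at least 1 as that lemma
  requires.\<close>

definition root_loss :: "nat \<Rightarrow> real" where
  "root_loss j = max 1 (6 / root_radius j) * 8 / root_exponent j"

lemma root_exponent_pos: "j > 0 \<Longrightarrow> root_exponent j > 0"
  by (simp add: root_exponent_def add_pos_pos)

lemma root_loss_pos: "j > 0 \<Longrightarrow> root_loss j > 0"
  using root_exponent_pos by (simp add: root_loss_def)

context concave_weight
begin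

lemma BMT_seminorm_root:
  fixes f :: "'a::euclidean_space \<Rightarrow> complex"
  assumes j: "j > 0" and \<rho>: "\<rho> > 0" and e: "e > 0"
    and smooth: "smooth_on U (\<lambda>x. f x ^ j)" "smooth_on U (\<lambda>x. f x ^ (j + 1))"
    and LU: "L \<subseteq> U" and KL: "\<forall>z\<in>K. cball z (2 * e) \<subseteq> L"
    and fin: "BMT_seminorm \<omega> L \<rho> (\<lambda>x. f x ^ j) < \<infinity>" "BMT_seminorm \<omega> L \<rho> (\<lambda>x. f x ^ (j + 1)) < \<infinity>"
  shows "z \<in> K \<Longrightarrow> iter_frechet f vs differentiable (at z)"
    and "BMT_seminorm \<omega> K (root_loss j * \<rho>) f < \<infinity>"
proof -
  have j1: "j \<ge> 1" using j by simp
  define m where "m = 2 * j\<^sup>2 * (j + 1)"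
  define b where "b = 1 / (8 * real m)"
  have b: "root_exponent j = b" by (simp only: root_exponent_def b_def m_def)
  define \<theta> where "\<theta> = b / 2"
  define \<kappa> where "\<kappa> = (1 / 288 :: real) ^ m"
  define \<sigma> where "\<sigma> = exp (- (24 / b)) / 4"
  define H where "H = 1 / (\<sigma> * \<kappa> * \<theta>)"
  define H' where "H' = max 1 (6 * H)"
  have b0: "b > 0" using root_exponent_pos[OF j] b by simp
  then have H0: "H > 0" by (simp add: H_def \<sigma>_def \<kappa>_def \<theta>_def)
  have loss: "root_loss j = H' * 8 / b"
    unfolding root_loss_def root_radius_def b H'_def H_def \<sigma>_def \<kappa>_def \<theta>_def m_def by simp
  obtain A1 A2 where A12: "A1 \<ge> 1" "A2 \<ge> 1"
    and bd: "deriv_bounded L A1 \<rho> (\<lambda>x. f x ^ j)" "deriv_bounded L A2 \<rho> (\<lambda>x. f x ^ (j + 1))"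
    using BMT_seminorm_bound[OF fin(1)] BMT_seminorm_bound[OF fin(2)] by blast
  define A where "A = max A1 A2"
  have A: "A \<ge> 1" using A12 by (simp add: A_def)
  have bd: "deriv_bounded L A \<rho> (\<lambda>x. f x ^ j)" "deriv_bounded L A \<rho> (\<lambda>x. f x ^ (j + 1))"
    by (rule deriv_bounded_mono[OF bd(1)] deriv_bounded_mono[OF bd(2)]; use A12 \<rho> in \<open>simp add: A_def\<close>)+
  \<comment> \<open>Mixed differences about a point of \<open>K\<close> have base points up to
    distance \<open>e\<close>, and from each of these the lines run up to length \<open>e\<close>;
    hence the radius \<open>2 * e\<close> in the hypothesis on \<open>L\<close>.\<close>
  define X where "X = (\<Union>z\<in>K. ball z e)"
  have X: "x + t *\<^sub>R v \<in> L" if x: "x \<in> X" and v: "norm v \<le> 1" and t: "\<bar>t\<bar> \<le> e" for x v t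
  proof -
    obtain z where z: "z \<in> K" "dist z x < e" using x by (auto simp: X_def)
    have "norm (t *\<^sub>R v) \<le> e * 1" unfolding norm_scaleR using v t e by (intro mult_mono) auto
    then have "dist z (x + t *\<^sub>R v) \<le> 2 * e"
      using z(2) norm_triangle_ineq4[of "z - x" "t *\<^sub>R v"] by (simp add: dist_norm diff_diff_eq)
    then show ?thesis using KL z(1) by (meson mem_cball subsetD)
  qed
  have "\<exists>D t0 C. t0 > 0 \<and> D \<ge> 0 \<and> (\<forall>x v. x \<in> X \<and> norm v \<le> 1 \<longrightarrow>
    (\<exists>c. (\<forall>k. norm (c k) \<le> D * H ^ k * W (8 * \<rho> / b) k / fact k) \<and>
    (\<forall>p t. \<bar>t\<bar> \<le> t0 \<longrightarrow> norm (f (x + t *\<^sub>R v) - (\<Sum>k<p. c k * of_real t ^ k)) \<le> C p * \<bar>t\<bar> ^ p)))"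
    by (rule root_expansion[OF j1 m_def b_def \<theta>_def \<kappa>_def \<sigma>_def H_def \<rho> A e smooth LU X bd])
  then obtain D t0 C where t0: "t0 > 0" and D: "D \<ge> 0" and ex: "\<And>x v. x \<in> X \<Longrightarrow> norm v \<le> 1 \<Longrightarrow>
    (\<exists>c. (\<forall>k. norm (c k) \<le> D * H ^ k * W (8 * \<rho> / b) k / fact k) \<and>
    (\<forall>p t. \<bar>t\<bar> \<le> t0 \<longrightarrow> norm (f (x + t *\<^sub>R v) - (\<Sum>k<p. c k * of_real t ^ k)) \<le> C p * \<bar>t\<bar> ^ p))"
    by blast
  define B where "B = (\<lambda>k. (2 * real k) ^ k * (D * H ^ k * W (8 * \<rho> / b) k / fact k))"
  have mb: "mdiff_bounded z e (iter_frechet f vs) (\<lambda>k. B (length vs + k) * (\<Prod>v\<leftarrow>vs. norm v))" if "z \<in> K" for z vs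
  proof -
    have "mdiff_bounded z e f B"
      unfolding B_def
    proof (rule mdiff_bounded_of_expansions[OF t0])
      fix x v :: 'a assume "norm (x - z) < e" "norm v \<le> 1"
      then show "\<exists>c. (\<forall>k. norm (c k) \<le> D * H ^ k * W (8 * \<rho> / b) k / fact k) \<and>
        (\<forall>p t. \<bar>t\<bar> \<le> t0 \<longrightarrow> norm (f (x + t *\<^sub>R v) - (\<Sum>k<p. c k * of_real t ^ k)) \<le> C p * \<bar>t\<bar> ^ p)"
        using \<open>z \<in> K\<close> by (intro ex) (auto simp: X_def dist_norm norm_minus_commute)
    qed
    then show ?thesis by (rule mdiff_bounded_iter_frechet)
  qed
  have Bk: "B k \<le> D * W (H' * 8 / b * \<rho>) k" for k
  proof -
    have "real k ^ k \<le> exp (real k) * fact k" by (rule power_self_le_exp_fact)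
    also have "exp (real k) = exp 1 ^ k" by (simp flip: exp_of_nat_mult)
    also have "exp 1 ^ k * fact k \<le> 3 ^ k * (fact k :: real)" using exp_le by (intro mult_right_mono power_mono) auto
    finally have kk: "real k ^ k / fact k \<le> 3 ^ k" by (simp add: divide_le_eq)
    have "B k = D * (2 * H) ^ k * W (8 * \<rho> / b) k * (real k ^ k / fact k)"
      by (simp add: B_def power_mult_distrib)
    also have "\<dots> \<le> D * (2 * H) ^ k * W (8 * \<rho> / b) k * 3 ^ k"
      using kk D H0 by (intro mult_left_mono) (auto simp: less_imp_le)
    also have "\<dots> = D * ((6 * H) ^ k * W (8 * \<rho> / b) k)"
    proof -
      have "(2 * H) ^ k * 3 ^ k = (2 * H * 3) ^ k" by (rule power_mult_distrib[symmetric])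
      also have "2 * H * 3 = 6 * H" by simp
      finally show ?thesis by (metis mult.assoc mult.commute)
    qed
    also have "\<dots> \<le> D * (H' ^ k * W (8 * \<rho> / b) k)"
      using D H0 by (intro mult_left_mono mult_right_mono power_mono) (auto simp: H'_def less_imp_le)
    also have "\<dots> \<le> D * W (H' * (8 * \<rho> / b)) k"
      using D \<rho> b0 by (intro mult_left_mono W_scale) (auto simp: H'_def)
    finally show ?thesis by (simp add: mult.assoc)
  qed
  have "norm (iter_frechet f vs z) \<le> D * W (H' * 8 / b * \<rho>) (length vs)"
    if z: "z \<in> K" and vs: "\<forall>v\<in>set vs. norm v \<le> 1" for z vs
  proof -
    have "norm (iter_frechet f vs z) \<le> B (length vs) * (\<Prod>v\<leftarrow>vs. norm v)"
      using mb[OF z, of vs, unfolded mdiff_bounded_def, rule_format, of z "[]"] e by simp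
    also have "\<dots> \<le> B (length vs) * 1"
    proof (intro mult_left_mono)
      show "(\<Prod>v\<leftarrow>vs. norm v) \<le> 1" using vs
        by (induction vs) (auto intro!: mult_le_one prod_list_nonneg)
      show "B (length vs) \<ge> 0" unfolding B_def using D H0 by (auto simp: less_imp_le)
    qed
    finally show ?thesis using Bk[of "length vs"] by simp
  qed
  then show "BMT_seminorm \<omega> K (root_loss j * \<rho>) f < \<infinity>"
    unfolding loss by (intro BMT_seminorm_finite[of K D]) (simp add: deriv_bounded_def)
  show "iter_frechet f vs differentiable (at z)" if z: "z \<in> K" for z vs
    using mdiff_bounded_has_derivative[OF mb[OF z], of z vs] e unfolding differentiable_def by auto
qed

lemma BMT_seminorm_finite_mono:
  fixes K :: "'a::euclidean_space set"
  assumes "BMT_seminorm \<omega> K \<rho> f < \<infinity>" "0 < \<rho>" "\<rho> \<le> \<rho>'"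
  shows "BMT_seminorm \<omega> K \<rho>' f < \<infinity>"
proof -
  obtain C where "C \<ge> 1" "deriv_bounded K C \<rho> f" using BMT_seminorm_bound[OF assms(1)] by blast
  then show ?thesis using assms by (intro BMT_seminorm_finite[of K C] deriv_bounded_mono[of K C \<rho> f \<rho>' C]) auto
qed

end

lemma compact_thickening:
  fixes K :: "'a::euclidean_space set"
  assumes "compact K" "K \<subseteq> U" "open U"
  shows "\<exists>e>0. \<exists>L. compact L \<and> L \<subseteq> U \<and> (\<forall>z\<in>K. cball z (2 * e) \<subseteq> L)"
proof -
  obtain \<epsilon> where \<epsilon>: "\<epsilon> > 0" "(\<Union>x\<in>K. cball x \<epsilon>) \<subseteq> U"
    using compact_subset_open_imp_cball_epsilon_subset[OF assms(1,3,2)] by blast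
  have eq: "(\<Union>x\<in>K. cball x \<epsilon>) = {x + y | x y. x \<in> K \<and> y \<in> cball 0 \<epsilon>}"
  proof (intro equalityI subsetI)
    fix w assume "w \<in> (\<Union>x\<in>K. cball x \<epsilon>)"
    then obtain x where "x \<in> K" "dist x w \<le> \<epsilon>" by auto
    then show "w \<in> {x + y | x y. x \<in> K \<and> y \<in> cball 0 \<epsilon>}"
      by (intro CollectI exI[of _ x] exI[of _ "w - x"]) (simp add: dist_norm norm_minus_commute)
  next
    fix w assume "w \<in> {x + y | x y. x \<in> K \<and> y \<in> cball 0 \<epsilon>}"
    then obtain x y where "x \<in> K" "norm y \<le> \<epsilon>" "w = x + y" by auto
    then show "w \<in> (\<Union>x\<in>K. cball x \<epsilon>)" by (intro UN_I[of x]) (simp_all add: dist_norm)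
  qed
  have "compact (\<Union>x\<in>K. cball x \<epsilon>)" unfolding eq by (intro compact_sums assms compact_cball)
  then show ?thesis using \<epsilon> by (intro exI[of _ "\<epsilon> / 2"] conjI exI[of _ "\<Union>x\<in>K. cball x \<epsilon>"]) auto
qed

theorem corollary1p2:
  fixes \<omega> :: "real \<Rightarrow> real"
    and U :: "(real ^ 'd) set"
    and f :: "real ^ 'd \<Rightarrow> complex"
    and j :: nat
  assumes "weight_function \<omega>"
    and "concave_on {0..} \<omega>"
    and "open U"
    and "j > 0"
  shows "((\<lambda>x. f x ^ j) \<in> BMT_Roumieu \<omega> U \<and> (\<lambda>x. f x ^ (j + 1)) \<in> BMT_Roumieu \<omega> U
           \<longrightarrow> f \<in> BMT_Roumieu \<omega> U)
       \<and> ((\<lambda>x. f x ^ j) \<in> BMT_Beurling \<omega> U \<and> (\<lambda>x. f x ^ (j + 1)) \<in> BMT_Beurling \<omega> U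
           \<longrightarrow> f \<in> BMT_Beurling \<omega> U)"
proof -
  interpret concave_weight \<omega> by unfold_locales fact+
  have Beurling_Roumieu: "g \<in> BMT_Roumieu \<omega> U" if "g \<in> BMT_Beurling \<omega> U" for g :: "real ^ 'd \<Rightarrow> complex"
    using that zero_less_one unfolding BMT_Beurling_def BMT_Roumieu_def by blast
  have Roumieu: "smooth_on U f \<and> (\<forall>K. compact K \<and> K \<subseteq> U \<longrightarrow> (\<exists>\<rho>>0. BMT_seminorm \<omega> K \<rho> f < \<infinity>))"
    if g: "(\<lambda>x. f x ^ j) \<in> BMT_Roumieu \<omega> U" and h: "(\<lambda>x. f x ^ (j + 1)) \<in> BMT_Roumieu \<omega> U"
  proof -
    have key: "(\<forall>z\<in>K. \<forall>vs. iter_frechet f vs differentiable (at z)) \<and> (\<exists>\<rho>>0. BMT_seminorm \<omega> K \<rho> f < \<infinity>)"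
      if K: "compact K" "K \<subseteq> U" for K
    proof -
      obtain e L where e: "e > 0" and L: "compact L" "L \<subseteq> U" "\<forall>z\<in>K. cball z (2 * e) \<subseteq> L"
        using compact_thickening[OF K assms(3)] by blast
      obtain \<rho>1 where \<rho>1: "\<rho>1 > 0" "BMT_seminorm \<omega> L \<rho>1 (\<lambda>x. f x ^ j) < \<infinity>"
        using g L unfolding BMT_Roumieu_def by blast
      obtain \<rho>2 where \<rho>2: "\<rho>2 > 0" "BMT_seminorm \<omega> L \<rho>2 (\<lambda>x. f x ^ (j + 1)) < \<infinity>"
        using h L unfolding BMT_Roumieu_def by blast
      have \<rho>: "max \<rho>1 \<rho>2 > 0" using \<rho>1(1) by simp
      have fin: "BMT_seminorm \<omega> L (max \<rho>1 \<rho>2) (\<lambda>x. f x ^ j) < \<infinity>"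
        "BMT_seminorm \<omega> L (max \<rho>1 \<rho>2) (\<lambda>x. f x ^ (j + 1)) < \<infinity>"
        by (rule BMT_seminorm_finite_mono[OF \<rho>1(2,1)] BMT_seminorm_finite_mono[OF \<rho>2(2,1)]; simp)+
      have smooth: "smooth_on U (\<lambda>x. f x ^ j)" "smooth_on U (\<lambda>x. f x ^ (j + 1))"
        using g h unfolding BMT_Roumieu_def by blast+
      have "root_loss j * max \<rho>1 \<rho>2 > 0" using root_loss_pos[OF assms(4)] \<rho> by simp
      then show ?thesis using BMT_seminorm_root[OF assms(4) \<rho> e smooth L(2,3) fin] by blast
    qed
    have "smooth_on U f"
      unfolding smooth_on_def
    proof (intro allI ballI)
      fix vs x assume "x \<in> U"
      then show "iter_frechet f vs differentiable (at x)" using key[of "{x}"] by simp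
    qed
    then show ?thesis using key by blast
  qed
  have Beurling: "smooth_on U f \<and> (\<forall>K. compact K \<and> K \<subseteq> U \<longrightarrow> (\<forall>\<rho>>0. BMT_seminorm \<omega> K \<rho> f < \<infinity>))"
    if g: "(\<lambda>x. f x ^ j) \<in> BMT_Beurling \<omega> U" and h: "(\<lambda>x. f x ^ (j + 1)) \<in> BMT_Beurling \<omega> U"
  proof (intro conjI allI impI)
    show "smooth_on U f" using Roumieu Beurling_Roumieu g h by blast
  next
    fix K \<rho> assume K: "compact K \<and> K \<subseteq> U" and \<rho>: "(\<rho>::real) > 0"
    obtain e L where e: "e > 0" and L: "compact L" "L \<subseteq> U" "\<forall>z\<in>K. cball z (2 * e) \<subseteq> L"
      using compact_thickening[of K U] K assms(3) by blast
    have c: "root_loss j > 0" by (rule root_loss_pos[OF assms(4)])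
    \<comment> \<open>The hypotheses hold for every parameter, so they are used at the one that the
      loss turns into the prescribed \<open>\<rho>\<close>.\<close>
    then have \<rho>c: "\<rho> / root_loss j > 0" using \<rho> by simp
    have "BMT_seminorm \<omega> K (root_loss j * (\<rho> / root_loss j)) f < \<infinity>"
      by (rule BMT_seminorm_root[OF assms(4) \<rho>c e _ _ L(2,3)]) (use g h L \<rho>c in \<open>auto simp: BMT_Beurling_def\<close>)
    then show "BMT_seminorm \<omega> K \<rho> f < \<infinity>" using c by simp
  qed
  show ?thesis using Roumieu Beurling unfolding BMT_Roumieu_def BMT_Beurling_def by blast
qed

end
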